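(* Let $E$ be a graph satisfying Condition (K) and let $R$ be a field. Then $$\left\{I(\Omega(M),B_{\Omega(M)}),\ I(\Omega(v),B_{\Omega(v)}\setminus\{v\}) : M\in M(E),\ v\in BV(E)\right\}$$ is the set of all (left, or right) primitive ideals of $L_R(E)$. In particular, the set of prime ideals and the set of primitive ideals of $L_R(E)$ coincide.
   Context: A graph $E=(E^0,E^1,r,s)$ consists of countable sets $E^0$ (vertices) and $E^1$ (edges) and range and source maps $r,s:E^1\to E^0$. A path of length $n\ge 1$ is $\alpha=e_1\cdots e_n$ with $r(e_i)=s(e_{i+1})$; $s(\alpha)=s(e_1)$, $r(\alpha)=r(e_n)$; vertices are paths of length $0$. Write $v\ge w$ if there is a path from $v$ to $w$. A closed path based at $v$ is a path $\alpha=e_1\cdots e_n$, $n\geq 1$, with $s(\alpha)=r(\alpha)=v$; it is a closed simple path if moreover $s(e_i)\ne s(e_1)$ for all $i>1$. $E$ satisfies Condition (K) if every vertex is either the base of no closed path or the base of at least two distinct closed simple paths. For a field $R$, $L_R(E)$ is the universal $R$-algebra generated by pairwise orthogonal idempotents $\{v:v\in E^0\}$ and elements $\{e,e^*:e\in E^1\}$ subject to: $s(e)e=er(e)=e$; $r(e)e^*=e^*s(e)=e^*$; $e^*f=\delta_{e,f}r(e)$; and $v=\sum_{s(e)=v}ee^*$ whenever $0<|s^{-1}(v)|<\infty$. $X\subseteq E^0$ is hereditary if $s(e)\in X$ implies $r(e)\in X$, and saturated if every $v$ with $0<|s^{-1}(v)|<\infty$ and $r(s^{-1}(v))\subseteq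 X$ lies in $X$. For $H$ saturated hereditary, $B_H:=\{v\in E^0\setminus H: |s^{-1}(v)|=\infty,\ 0<|s^{-1}(v)\cap r^{-1}(E^0\setminus H)|<\infty\}$ and, for $v\in B_H$, $v^H:=v-\sum_{s(e)=v,\,r(e)\notin H}ee^*$. For $S\subseteq B_H$, $I(H,S)$ is the (two-sided) ideal of $L_R(E)$ generated by $\{v:v\in H\}\cup\{v^H:v\in S\}$. $M(E)$ is the set of maximal tails: nonempty $M\subseteq E^0$ such that (MT1) if $v\in E^0$, $w\in M$, $v\ge w$, then $v\in M$; (MT2) if $v\in M$ with $0<|s^{-1}(v)|<\infty$, there is $e\in E^1$ with $s(e)=v$ and $r(e)\in M$; (MT3) for all $v,w\in M$ there is $y\in M$ with $v\ge y$ and $w\ge y$. For nonempty $X\subseteq E^0$, $\Omega(X):=\{w\in E^0\setminus X: w\not\ge v \text{ for every } v\in X\}$, and $\Omega(v):=\Omega(\{v\})$. If $M$ is a maximal tail, or if $v$ is an infinite emitter, then $\Omega(M)$, respectively $\Omega(v)$, is hereditary and saturated. The set of breaking vertices is $BV(E):=\{v\in E^0:|s^{-1}(v)|=\infty,\ 0<|s^{-1}(v)\setminus r^{-1}(\Omega(v))|<\infty\}$. A ring is left (right) primitive if it has a faithful simple left (right) module; an ideal $I$ of a ring $A$ is left (right) primitive if $A/I$ is a left (right) primitive ring; the claim holds for either side. A proper ideal $I$ of $A$ is prime if $J_1J_2\subseteq I$ for ideals $J_1,J_2$ of $A$ implies $J_1\subseteq I$ or $J_2\subseteq I$. *)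

theory Defs
  imports
    "HOL-Library.Countable_Set"
    "HOL-Library.Poly_Mapping"
    "HOL-Algebra.QuotRing"
    "HOL-Algebra.Ideal_Product"
    "HOL-Algebra.Module"
    "Graph_Theory.Arc_Walk"
begin

section \<open>Graphs\<close>

text \<open>
  A graph is a well-formed directed multigraph whose arcs have source \<^const>\<open>tail\<close> and range
  \<^const>\<open>head\<close>; the set of edges with source \<open>v\<close> is \<^const>\<open>out_arcs\<close>. Paths (of length
  at least 0) are the arc walks of the library.
\<close>

definition path_ge :: "('v, 'e) pre_digraph \<Rightarrow> 'v \<Rightarrow> 'v \<Rightarrow> bool" where
  "path_ge E v w \<longleftrightarrow> (\<exists>p. pre_digraph.awalk E v p w)"

definition closed_path :: "('v, 'e) pre_digraph \<Rightarrow> 'v \<Rightarrow> 'e list \<Rightarrow> bool" where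
  "closed_path E v p \<longleftrightarrow> p \<noteq> [] \<and> pre_digraph.awalk E v p v"

definition closed_simple_path :: "('v, 'e) pre_digraph \<Rightarrow> 'v \<Rightarrow> 'e list \<Rightarrow> bool" where
  "closed_simple_path E v p \<longleftrightarrow>
     closed_path E v p \<and> (\<forall>e \<in> set (tl p). tail E e \<noteq> tail E (hd p))"

definition condition_K :: "('v, 'e) pre_digraph \<Rightarrow> bool" where
  "condition_K E \<longleftrightarrow>
     (\<forall>v \<in> verts E. (\<nexists>p. closed_path E v p) \<or>
        (\<exists>p q. p \<noteq> q \<and> closed_simple_path E v p \<and> closed_simple_path E v q))"

definition infinite_emitter :: "('v, 'e) pre_digraph \<Rightarrow> 'v \<Rightarrow> bool" where
  "infinite_emitter E v \<longleftrightarrow> infinite (out_arcs E v)"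

definition regular_vertex :: "('v, 'e) pre_digraph \<Rightarrow> 'v \<Rightarrow> bool" where
  "regular_vertex E v \<longleftrightarrow> finite (out_arcs E v) \<and> out_arcs E v \<noteq> {}"

definition maximal_tails :: "('v, 'e) pre_digraph \<Rightarrow> 'v set set" where
  "maximal_tails E =
     {M. M \<noteq> {} \<and> M \<subseteq> verts E \<and>
         (\<forall>v \<in> verts E. \<forall>w \<in> M. path_ge E v w \<longrightarrow> v \<in> M) \<and>
         (\<forall>v \<in> M. regular_vertex E v \<longrightarrow> (\<exists>e \<in> out_arcs E v. head E e \<in> M)) \<and>
         (\<forall>v \<in> M. \<forall>w \<in> M. \<exists>y \<in> M. path_ge E v y \<and> path_ge E w y)}"

definition Omega :: "('v, 'e) pre_digraph \<Rightarrow> 'v set \<Rightarrow> 'v set" where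
  "Omega E X = {w \<in> verts E - X. \<forall>v \<in> X. \<not> path_ge E w v}"

definition arcs_avoiding :: "('v, 'e) pre_digraph \<Rightarrow> 'v set \<Rightarrow> 'v \<Rightarrow> 'e set" where
  "arcs_avoiding E H v = {e \<in> out_arcs E v. head E e \<notin> H}"

definition B_of :: "('v, 'e) pre_digraph \<Rightarrow> 'v set \<Rightarrow> 'v set" where
  "B_of E H = {v \<in> verts E - H. infinite_emitter E v \<and>
              finite (arcs_avoiding E H v) \<and> arcs_avoiding E H v \<noteq> {}}"

definition breaking_vertices :: "('v, 'e) pre_digraph \<Rightarrow> 'v set" where
  "breaking_vertices E =
     {v \<in> verts E. infinite_emitter E v \<and>
        finite (arcs_avoiding E (Omega E {v}) v) \<and> arcs_avoiding E (Omega E {v}) v \<noteq> {}}"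


section \<open>Ideals and modules of rings without unit\<close>

text \<open>
  Leavitt path algebras need not have a unit, so the locales \<^locale>\<open>ring\<close>, \<^locale>\<open>ideal\<close>
  and \<^locale>\<open>module\<close> of the library do not apply. Only their records are used; the field
  \<^const>\<open>one\<close> of a ring, and the fields \<^const>\<open>one\<close> and \<^const>\<open>mult\<close> of a module, are
  ignored throughout.
\<close>

locale nonunital_ring = abelian_group A for A (structure) +
  assumes m_closed: "\<lbrakk>a \<in> carrier A; b \<in> carrier A\<rbrakk> \<Longrightarrow> a \<otimes> b \<in> carrier A"
    and m_assoc: "\<lbrakk>a \<in> carrier A; b \<in> carrier A; c \<in> carrier A\<rbrakk> \<Longrightarrow> (a \<otimes> b) \<otimes> c = a \<otimes> (b \<otimes> c)"
    and l_distr: "\<lbrakk>a \<in> carrier A; b \<in> carrier A; c \<in> carrier A\<rbrakk> \<Longrightarrow>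
                    (a \<oplus> b) \<otimes> c = a \<otimes> c \<oplus> b \<otimes> c"
    and r_distr: "\<lbrakk>a \<in> carrier A; b \<in> carrier A; c \<in> carrier A\<rbrakk> \<Longrightarrow>
                    c \<otimes> (a \<oplus> b) = c \<otimes> a \<oplus> c \<otimes> b"

definition two_sided_ideal :: "'a set \<Rightarrow> ('a, 'c) ring_scheme \<Rightarrow> bool" where
  "two_sided_ideal I A \<longleftrightarrow> additive_subgroup I A \<and>
     (\<forall>a \<in> carrier A. \<forall>x \<in> I. a \<otimes>\<^bsub>A\<^esub> x \<in> I \<and> x \<otimes>\<^bsub>A\<^esub> a \<in> I)"

definition ideal_generated :: "('a, 'c) ring_scheme \<Rightarrow> 'a set \<Rightarrow> 'a set" where
  "ideal_generated A X = \<Inter>{I. two_sided_ideal I A \<and> X \<subseteq> I}"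

definition prime_ideals :: "('a, 'c) ring_scheme \<Rightarrow> 'a set set" where
  "prime_ideals A =
     {I. two_sided_ideal I A \<and> I \<noteq> carrier A \<and>
         (\<forall>J1 J2. two_sided_ideal J1 A \<longrightarrow> two_sided_ideal J2 A \<longrightarrow>
            ideal_prod A J1 J2 \<subseteq> I \<longrightarrow> J1 \<subseteq> I \<or> J2 \<subseteq> I)}"

locale left_module = abelian_group M
  for A :: "('a, 'c) ring_scheme" and M :: "('a, 'b, 'd) module_scheme" (structure) +
  assumes act_closed: "\<lbrakk>a \<in> carrier A; x \<in> carrier M\<rbrakk> \<Longrightarrow> a \<odot> x \<in> carrier M"
    and act_add_l: "\<lbrakk>a \<in> carrier A; b \<in> carrier A; x \<in> carrier M\<rbrakk> \<Longrightarrow>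
                      (a \<oplus>\<^bsub>A\<^esub> b) \<odot> x = a \<odot> x \<oplus> b \<odot> x"
    and act_add_r: "\<lbrakk>a \<in> carrier A; x \<in> carrier M; y \<in> carrier M\<rbrakk> \<Longrightarrow>
                      a \<odot> (x \<oplus> y) = a \<odot> x \<oplus> a \<odot> y"
    and act_mult: "\<lbrakk>a \<in> carrier A; b \<in> carrier A; x \<in> carrier M\<rbrakk> \<Longrightarrow>
                     (a \<otimes>\<^bsub>A\<^esub> b) \<odot> x = a \<odot> (b \<odot> x)"

text \<open>In a right module, \<open>a \<odot> x\<close> stands for \<open>x\<close> multiplied by \<open>a\<close> from the right.\<close>

locale right_module = abelian_group M
  for A :: "('a, 'c) ring_scheme" and M :: "('a, 'b, 'd) module_scheme" (structure) +
  assumes act_closed: "\<lbrakk>a \<in> carrier A; x \<in> carrier M\<rbrakk> \<Longrightarrow> a \<odot> x \<in> carrier M"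
    and act_add_l: "\<lbrakk>a \<in> carrier A; b \<in> carrier A; x \<in> carrier M\<rbrakk> \<Longrightarrow>
                      (a \<oplus>\<^bsub>A\<^esub> b) \<odot> x = a \<odot> x \<oplus> b \<odot> x"
    and act_add_r: "\<lbrakk>a \<in> carrier A; x \<in> carrier M; y \<in> carrier M\<rbrakk> \<Longrightarrow>
                      a \<odot> (x \<oplus> y) = a \<odot> x \<oplus> a \<odot> y"
    and act_mult: "\<lbrakk>a \<in> carrier A; b \<in> carrier A; x \<in> carrier M\<rbrakk> \<Longrightarrow>
                     (a \<otimes>\<^bsub>A\<^esub> b) \<odot> x = b \<odot> (a \<odot> x)"

text \<open>
  For rings without unit, simplicity includes the requirement that the action is not
  identically zero; in particular the zero module is not simple.
\<close>

definition simple_action :: "('a, 'c) ring_scheme \<Rightarrow> ('a, 'b, 'd) module_scheme \<Rightarrow> bool" where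
  "simple_action A M \<longleftrightarrow>
     (\<exists>a \<in> carrier A. \<exists>x \<in> carrier M. a \<odot>\<^bsub>M\<^esub> x \<noteq> \<zero>\<^bsub>M\<^esub>) \<and>
     (\<forall>N. additive_subgroup N M \<longrightarrow> (\<forall>a \<in> carrier A. \<forall>x \<in> N. a \<odot>\<^bsub>M\<^esub> x \<in> N) \<longrightarrow>
        N = {\<zero>\<^bsub>M\<^esub>} \<or> N = carrier M)"

definition faithful_action :: "('a, 'c) ring_scheme \<Rightarrow> ('a, 'b, 'd) module_scheme \<Rightarrow> bool" where
  "faithful_action A M \<longleftrightarrow>
     (\<forall>a \<in> carrier A. (\<forall>x \<in> carrier M. a \<odot>\<^bsub>M\<^esub> x = \<zero>\<^bsub>M\<^esub>) \<longrightarrow> a = \<zero>\<^bsub>A\<^esub>)"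

text \<open>
  HOL cannot quantify over the type of module elements. Elements of type \<^typ>\<open>'a set\<close> suffice:
  a simple module over \<open>A\<close> is a quotient of \<open>A\<close> and so can be realised on cosets. The lemmas
  \<open>left_primitiveI\<close> and \<open>right_primitiveI\<close> below make this precise.
\<close>

definition left_primitive :: "('a, 'c) ring_scheme \<Rightarrow> bool" where
  "left_primitive A \<longleftrightarrow>
     (\<exists>M :: ('a, 'a set) module. left_module A M \<and> simple_action A M \<and> faithful_action A M)"

definition right_primitive :: "('a, 'c) ring_scheme \<Rightarrow> bool" where
  "right_primitive A \<longleftrightarrow>
     (\<exists>M :: ('a, 'a set) module. right_module A M \<and> simple_action A M \<and> faithful_action A M)"

definition left_primitive_ideals :: "('a, 'c) ring_scheme \<Rightarrow> 'a set set" where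
  "left_primitive_ideals A = {I. two_sided_ideal I A \<and> left_primitive (A Quot I)}"

definition right_primitive_ideals :: "('a, 'c) ring_scheme \<Rightarrow> 'a set set" where
  "right_primitive_ideals A = {I. two_sided_ideal I A \<and> right_primitive (A Quot I)}"


section \<open>Leavitt path algebras\<close>

text \<open>
  Words form the free monoid, written additively because the multiplication of
  \<^typ>\<open>'w \<Rightarrow>\<^sub>0 'k\<close> (the monoid algebra) is convolution with respect to \<open>+\<close> on \<open>'w\<close>.
\<close>

datatype 'g word = Word (letters: "'g list")

instantiation word :: (type) monoid_add
begin
definition zero_word :: "'a word" where "0 = Word []"
definition plus_word :: "'a word \<Rightarrow> 'a word \<Rightarrow> 'a word" where
  "u + w = Word (letters u @ letters w)"
instance by standard (simp_all add: zero_word_def plus_word_def)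
end

datatype ('v, 'e) generator = Vertex 'v | Edge 'e | Ghost 'e

type_synonym ('v, 'e, 'k) free_element = "('v, 'e) generator word \<Rightarrow>\<^sub>0 'k"
type_synonym ('v, 'e, 'k) lpa = "('v, 'e, 'k) free_element set ring"

definition generators :: "('v, 'e) pre_digraph \<Rightarrow> ('v, 'e) generator set" where
  "generators E = Vertex ` verts E \<union> Edge ` arcs E \<union> Ghost ` arcs E"

definition gen :: "('v, 'e) generator \<Rightarrow> ('v, 'e, 'k::field) free_element" where
  "gen x = Poly_Mapping.single (Word [x]) 1"

definition free_algebra :: "('v, 'e) pre_digraph \<Rightarrow> ('v, 'e, 'k::field) free_element ring" where
  "free_algebra E =
     \<lparr>carrier = {a. \<forall>w \<in> Poly_Mapping.keys a. set (letters w) \<subseteq> generators E},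
      mult = (*), one = 1, zero = 0, add = (+)\<rparr>"

text \<open>The free algebra without unit: the constant term, at the empty word, is zero.\<close>

definition free_nonunital :: "('v, 'e) pre_digraph \<Rightarrow> ('v, 'e, 'k::field) free_element ring" where
  "free_nonunital E =
     free_algebra E \<lparr>carrier := {a \<in> carrier (free_algebra E). Poly_Mapping.lookup a 0 = 0}\<rparr>"

definition lpa_relations :: "('v, 'e) pre_digraph \<Rightarrow> ('v, 'e, 'k::field) free_element set" where
  "lpa_relations E =
     {gen (Vertex v) * gen (Vertex w) - (if v = w then gen (Vertex v) else 0)
        | v w. v \<in> verts E \<and> w \<in> verts E} \<union>
     {gen (Vertex (tail E e)) * gen (Edge e) - gen (Edge e) | e. e \<in> arcs E} \<union>
     {gen (Edge e) * gen (Vertex (head E e)) - gen (Edge e) | e. e \<in> arcs E} \<union>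
     {gen (Vertex (head E e)) * gen (Ghost e) - gen (Ghost e) | e. e \<in> arcs E} \<union>
     {gen (Ghost e) * gen (Vertex (tail E e)) - gen (Ghost e) | e. e \<in> arcs E} \<union>
     {gen (Ghost e) * gen (Edge f) - (if e = f then gen (Vertex (head E e)) else 0)
        | e f. e \<in> arcs E \<and> f \<in> arcs E} \<union>
     {gen (Vertex v) - (\<Sum>e \<in> out_arcs E v. gen (Edge e) * gen (Ghost e))
        | v. v \<in> verts E \<and> regular_vertex E v}"

text \<open>
  The relations lie in \<^const>\<open>free_nonunital\<close>. The ideal they generate is taken in the unital
  free algebra, which contains the scalars, so that it is an ideal of algebras and not merely
  of rings.
\<close>

definition lpa_kernel :: "('v, 'e) pre_digraph \<Rightarrow> ('v, 'e, 'k::field) free_element set" where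
  "lpa_kernel E = genideal (free_algebra E) (lpa_relations E)"

definition leavitt_path_algebra :: "('v, 'e) pre_digraph \<Rightarrow> ('v, 'e, 'k::field) lpa" where
  "leavitt_path_algebra E = free_nonunital E Quot lpa_kernel E"

definition lpa_class ::
  "('v, 'e) pre_digraph \<Rightarrow> ('v, 'e, 'k::field) free_element \<Rightarrow> ('v, 'e, 'k) free_element set" where
  "lpa_class E a = lpa_kernel E +>\<^bsub>free_nonunital E\<^esub> a"

definition lpa_vertex ::
  "('v, 'e) pre_digraph \<Rightarrow> 'v \<Rightarrow> ('v, 'e, 'k::field) free_element set" where
  "lpa_vertex E v = lpa_class E (gen (Vertex v))"

text \<open>The element \<open>v\<^sup>H\<close>; the sum is finite for \<open>v \<in> B_of E H\<close>.\<close>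

definition lpa_gap_vertex ::
  "('v, 'e) pre_digraph \<Rightarrow> 'v set \<Rightarrow> 'v \<Rightarrow> ('v, 'e, 'k::field) free_element set" where
  "lpa_gap_vertex E H v =
     lpa_class E (gen (Vertex v) - (\<Sum>e \<in> arcs_avoiding E H v. gen (Edge e) * gen (Ghost e)))"

definition graph_ideal ::
  "('v, 'e) pre_digraph \<Rightarrow> 'v set \<Rightarrow> 'v set \<Rightarrow> ('v, 'e, 'k::field) free_element set set" where
  "graph_ideal E H S =
     ideal_generated (leavitt_path_algebra E) (lpa_vertex E ` H \<union> lpa_gap_vertex E H ` S)"


section \<open>Primitivity does not depend on the type of module elements\<close>

definition transported_module ::
  "('b \<Rightarrow> 'b2) \<Rightarrow> ('a, 'b, 'd) module_scheme \<Rightarrow> ('a, 'b2) module" where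
  "transported_module g M =
     (let h = the_inv_into (carrier M) g in
      \<lparr>carrier = g ` carrier M, mult = undefined, one = undefined, zero = g \<zero>\<^bsub>M\<^esub>,
       add = (\<lambda>x y. g (h x \<oplus>\<^bsub>M\<^esub> h y)), smult = (\<lambda>a x. g (a \<odot>\<^bsub>M\<^esub> h x))\<rparr>)"

context
  fixes g :: "'b \<Rightarrow> 'b2" and M :: "('a, 'b, 'd) module_scheme"
  assumes inj: "inj_on g (carrier M)"
begin

lemma transported_simps:
  "carrier (transported_module g M) = g ` carrier M"
  "\<zero>\<^bsub>transported_module g M\<^esub> = g \<zero>\<^bsub>M\<^esub>"
  "\<lbrakk>x \<in> carrier M; y \<in> carrier M\<rbrakk> \<Longrightarrow> g x \<oplus>\<^bsub>transported_module g M\<^esub> g y = g (x \<oplus>\<^bsub>M\<^esub> y)"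
  "x \<in> carrier M \<Longrightarrow> a \<odot>\<^bsub>transported_module g M\<^esub> g x = g (a \<odot>\<^bsub>M\<^esub> x)"
  using inj by (auto simp: transported_module_def Let_def the_inv_into_f_f)

lemma transported_abelian_group:
  assumes "abelian_group M"
  shows "abelian_group (transported_module g M)"
proof -
  interpret abelian_group M by fact
  show ?thesis
    apply (rule abelian_groupI)
         apply (auto simp: transported_simps a_ac)
    subgoal for x by (intro bexI[of _ "\<ominus>\<^bsub>M\<^esub> x"]) (auto simp: transported_simps l_neg r_neg)
    done
qed

lemma transported_simple:
  assumes "abelian_group M" "simple_action A M"
    and cl: "\<And>a x. \<lbrakk>a \<in> carrier A; x \<in> carrier M\<rbrakk> \<Longrightarrow> a \<odot>\<^bsub>M\<^esub> x \<in> carrier M"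
  shows "simple_action A (transported_module g M)"
proof -
  interpret abelian_group M by fact
  interpret T: abelian_group "transported_module g M"
    by (rule transported_abelian_group) fact
  have "\<exists>a\<in>carrier A. \<exists>x\<in>carrier (transported_module g M).
      a \<odot>\<^bsub>transported_module g M\<^esub> x \<noteq> \<zero>\<^bsub>transported_module g M\<^esub>"
    using assms(2) inj cl unfolding simple_action_def
    by (auto simp: transported_simps inj_on_eq_iff)
  moreover have "N = {\<zero>\<^bsub>transported_module g M\<^esub>} \<or> N = carrier (transported_module g M)"
    if N: "additive_subgroup N (transported_module g M)"
      and st: "\<And>a x. \<lbrakk>a \<in> carrier A; x \<in> N\<rbrakk> \<Longrightarrow> a \<odot>\<^bsub>transported_module g M\<^esub> x \<in> N" for N
  proof -
    interpret N: additive_subgroup N "transported_module g M" by fact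
    define K where "K = {x \<in> carrier M. g x \<in> N}"
    have NK: "N = g ` K"
      using N.a_subset by (auto simp: K_def transported_simps)
    have neg: "g (\<ominus>\<^bsub>M\<^esub> x) = \<ominus>\<^bsub>transported_module g M\<^esub> (g x)" if "x \<in> carrier M" for x
      using that by (intro T.minus_equality[symmetric]) (auto simp: transported_simps l_neg r_neg)
    have "additive_subgroup K M"
      apply (rule additive_subgroup.intro)
      apply (rule add.subgroupI)
      using N.zero_closed
         apply (auto simp: K_def transported_simps a_inv_def[symmetric] neg)
      subgoal for x y using N.a_closed[of "g x" "g y"] by (simp add: transported_simps)
      done
    moreover have "a \<odot>\<^bsub>M\<^esub> x \<in> K" if "a \<in> carrier A" "x \<in> K" for a x
      using that st[of a "g x"] cl by (auto simp: K_def transported_simps)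
    ultimately have "K = {\<zero>\<^bsub>M\<^esub>} \<or> K = carrier M"
      using assms(2) unfolding simple_action_def by blast
    then show ?thesis by (auto simp: NK transported_simps)
  qed
  ultimately show ?thesis unfolding simple_action_def by blast
qed

lemma transported_faithful:
  assumes "abelian_group M" "faithful_action A M"
    and cl: "\<And>a x. \<lbrakk>a \<in> carrier A; x \<in> carrier M\<rbrakk> \<Longrightarrow> a \<odot>\<^bsub>M\<^esub> x \<in> carrier M"
  shows "faithful_action A (transported_module g M)"
proof -
  interpret abelian_group M by fact
  show ?thesis
    using assms(2) inj cl unfolding faithful_action_def
    by (auto simp: transported_simps inj_on_eq_iff)
qed

end

lemma simple_action_cyclic:
  assumes "abelian_group A" "abelian_group M" "simple_action A M"
    and cl: "\<And>a x. \<lbrakk>a \<in> carrier A; x \<in> carrier M\<rbrakk> \<Longrightarrow> a \<odot>\<^bsub>M\<^esub> x \<in> carrier M"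
    and add_l: "\<And>a b x. \<lbrakk>a \<in> carrier A; b \<in> carrier A; x \<in> carrier M\<rbrakk> \<Longrightarrow>
                  (a \<oplus>\<^bsub>A\<^esub> b) \<odot>\<^bsub>M\<^esub> x = a \<odot>\<^bsub>M\<^esub> x \<oplus>\<^bsub>M\<^esub> b \<odot>\<^bsub>M\<^esub> x"
    and act: "\<And>a b x. \<lbrakk>a \<in> carrier A; b \<in> carrier A; x \<in> carrier M\<rbrakk> \<Longrightarrow>
                \<exists>c \<in> carrier A. a \<odot>\<^bsub>M\<^esub> (b \<odot>\<^bsub>M\<^esub> x) = c \<odot>\<^bsub>M\<^esub> x"
  obtains m where "m \<in> carrier M" "carrier M = (\<lambda>a. a \<odot>\<^bsub>M\<^esub> m) ` carrier A"
proof -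
  interpret A: abelian_group A by fact
  interpret abelian_group M by fact
  from assms(3) obtain b m where bm: "b \<in> carrier A" "m \<in> carrier M" "b \<odot>\<^bsub>M\<^esub> m \<noteq> \<zero>\<^bsub>M\<^esub>"
    unfolding simple_action_def by blast
  let ?N = "(\<lambda>a. a \<odot>\<^bsub>M\<^esub> m) ` carrier A"
  have z: "\<zero>\<^bsub>A\<^esub> \<odot>\<^bsub>M\<^esub> m = \<zero>\<^bsub>M\<^esub>"
    using add_l[of "\<zero>\<^bsub>A\<^esub>" "\<zero>\<^bsub>A\<^esub>" m] cl[of "\<zero>\<^bsub>A\<^esub>" m] bm by simp
  have ng: "\<ominus>\<^bsub>M\<^esub> (a \<odot>\<^bsub>M\<^esub> m) = (\<ominus>\<^bsub>A\<^esub> a) \<odot>\<^bsub>M\<^esub> m" if "a \<in> carrier A" for a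
    using that bm z cl add_l[of "\<ominus>\<^bsub>A\<^esub> a" a m]
    by (intro minus_equality) (auto simp: A.l_neg)
  have "additive_subgroup ?N M"
    apply (rule additive_subgroup.intro)
    apply (rule add.subgroupI)
       apply (use bm cl in \<open>auto simp: a_inv_def[symmetric]\<close>)
    subgoal for a using ng[of a] by auto
    subgoal for a a' by (intro image_eqI[of _ _ "a \<oplus>\<^bsub>A\<^esub> a'"]) (auto simp: add_l)
    done
  moreover have "a \<odot>\<^bsub>M\<^esub> x \<in> ?N" if "a \<in> carrier A" "x \<in> ?N" for a x
    using that act[of a _ m] bm(2) by (auto simp: image_iff)
  ultimately have "?N = {\<zero>\<^bsub>M\<^esub>} \<or> ?N = carrier M"
    using assms(3) unfolding simple_action_def by blast
  then have "carrier M = ?N" using bm by blast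
  with bm(2) show ?thesis by (rule that)
qed

lemma left_primitiveI:
  fixes M :: "('a, 'b, 'd) module_scheme"
  assumes "nonunital_ring A" "left_module A M" "simple_action A M" "faithful_action A M"
  shows "left_primitive A"
proof -
  interpret A: nonunital_ring A by fact
  interpret left_module A M by fact
  obtain m where m: "m \<in> carrier M" "carrier M = (\<lambda>a. a \<odot>\<^bsub>M\<^esub> m) ` carrier A"
  proof (rule simple_action_cyclic[of A M])
    show "\<exists>c\<in>carrier A. a \<odot>\<^bsub>M\<^esub> (b \<odot>\<^bsub>M\<^esub> x) = c \<odot>\<^bsub>M\<^esub> x"
      if "a \<in> carrier A" "b \<in> carrier A" "x \<in> carrier M" for a b x
      using that act_mult[of a b x] A.m_closed[of a b] by (intro bexI[of _ "a \<otimes>\<^bsub>A\<^esub> b"]) auto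
  qed (use assms act_add_l act_closed A.abelian_group_axioms abelian_group_axioms in auto)
  define g where "g x = {a \<in> carrier A. a \<odot>\<^bsub>M\<^esub> m = x}" for x
  have inj: "inj_on g (carrier M)"
    using m(2) by (auto simp: inj_on_def g_def)
  have ab: "abelian_group M" by (rule abelian_group_axioms)
  note simps = transported_simps[OF inj]
  have "left_module A (transported_module g M)"
    apply (intro left_module.intro left_module_axioms.intro transported_abelian_group inj ab)
    apply (auto simp: simps act_closed act_add_l act_add_r act_mult)
    done
  then show ?thesis
    unfolding left_primitive_def
    using transported_simple[OF inj ab assms(3)] transported_faithful[OF inj ab assms(4)] act_closed
    by blast
qed

lemma right_primitiveI:
  fixes M :: "('a, 'b, 'd) module_scheme"
  assumes "nonunital_ring A" "right_module A M" "simple_action A M" "faithful_action A M"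
  shows "right_primitive A"
proof -
  interpret A: nonunital_ring A by fact
  interpret right_module A M by fact
  obtain m where m: "m \<in> carrier M" "carrier M = (\<lambda>a. a \<odot>\<^bsub>M\<^esub> m) ` carrier A"
  proof (rule simple_action_cyclic[of A M])
    show "\<exists>c\<in>carrier A. a \<odot>\<^bsub>M\<^esub> (b \<odot>\<^bsub>M\<^esub> x) = c \<odot>\<^bsub>M\<^esub> x"
      if "a \<in> carrier A" "b \<in> carrier A" "x \<in> carrier M" for a b x
      using that act_mult[of b a x] A.m_closed[of b a] by (intro bexI[of _ "b \<otimes>\<^bsub>A\<^esub> a"]) auto
  qed (use assms act_add_l act_closed A.abelian_group_axioms abelian_group_axioms in auto)
  define g where "g x = {a \<in> carrier A. a \<odot>\<^bsub>M\<^esub> m = x}" for x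
  have inj: "inj_on g (carrier M)"
    using m(2) by (auto simp: inj_on_def g_def)
  have ab: "abelian_group M" by (rule abelian_group_axioms)
  note simps = transported_simps[OF inj]
  have "right_module A (transported_module g M)"
    apply (intro right_module.intro right_module_axioms.intro transported_abelian_group inj ab)
    apply (auto simp: simps act_closed act_add_l act_add_r act_mult)
    done
  then show ?thesis
    unfolding right_primitive_def
    using transported_simple[OF inj ab assms(3)] transported_faithful[OF inj ab assms(4)] act_closed
    by blast
qed

section \<open>The Leavitt path algebra is a ring without unit in which the relations hold\<close>

lemma letters_zero [simp]: "letters 0 = []"
  and letters_plus [simp]: "letters (u + w) = letters u @ letters w"
  by (simp_all add: zero_word_def plus_word_def)

lemma free_algebra_simps:
  "zero (free_algebra E) = 0" "one (free_algebra E) = 1"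
  "add (free_algebra E) = (+)" "mult (free_algebra E) = (*)"
  by (simp_all add: free_algebra_def)

lemma free_algebra_closed:
  fixes a b :: "('v, 'e, 'k::field) free_element" and E :: "('v, 'e) pre_digraph"
  shows "(0 :: ('v, 'e, 'k) free_element) \<in> carrier (free_algebra E)"
    and "(1 :: ('v, 'e, 'k) free_element) \<in> carrier (free_algebra E)"
    and "a \<in> carrier (free_algebra E) \<Longrightarrow> b \<in> carrier (free_algebra E) \<Longrightarrow>
           a + b \<in> carrier (free_algebra E)"
    and "a \<in> carrier (free_algebra E) \<Longrightarrow> - a \<in> carrier (free_algebra E)"
    and "a \<in> carrier (free_algebra E) \<Longrightarrow> b \<in> carrier (free_algebra E) \<Longrightarrow>
           a * b \<in> carrier (free_algebra E)"
proof -
  show "(0 :: ('v, 'e, 'k) free_element) \<in> carrier (free_algebra E)"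
    "(1 :: ('v, 'e, 'k) free_element) \<in> carrier (free_algebra E)"
    by (simp_all add: free_algebra_def)
  show "a + b \<in> carrier (free_algebra E)"
    if "a \<in> carrier (free_algebra E)" "b \<in> carrier (free_algebra E)"
    using that Poly_Mapping.keys_add[of a b] unfolding free_algebra_def by auto
  show "- a \<in> carrier (free_algebra E)" if "a \<in> carrier (free_algebra E)"
    using that by (simp add: free_algebra_def keys_minus)
  show "a * b \<in> carrier (free_algebra E)"
    if "a \<in> carrier (free_algebra E)" "b \<in> carrier (free_algebra E)"
  proof -
    have "set (letters w) \<subseteq> generators E" if w: "w \<in> Poly_Mapping.keys (a * b)" for w
    proof -
      from w obtain u u' where "w = u + u'" "u \<in> Poly_Mapping.keys a" "u' \<in> Poly_Mapping.keys b"
        using keys_mult[of a b] by blast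
      with \<open>a \<in> _\<close> \<open>b \<in> _\<close> show ?thesis by (simp add: free_algebra_def)
    qed
    then show ?thesis by (simp add: free_algebra_def)
  qed
qed

lemma ring_free_algebra: "ring (free_algebra E :: ('v, 'e, 'k::field) free_element ring)"
proof (rule ringI)
  let ?F = "free_algebra E :: ('v, 'e, 'k::field) free_element ring"
  show "abelian_group ?F"
  proof (rule abelian_groupI, goal_cases)
    case (6 x)
    then show ?case
      using free_algebra_closed(4)[of x E]
      by (intro bexI[of _ "- x"]) (simp_all add: free_algebra_simps)
  qed (simp_all add: free_algebra_simps free_algebra_closed add.assoc add.commute)
  show "Group.monoid ?F"
    by (rule Group.monoidI)
       (simp_all add: free_algebra_simps free_algebra_closed mult.assoc)
qed (simp_all add: free_algebra_simps distrib_left distrib_right)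

lemma lookup_mult_zero_word:
  fixes a b :: "'g word \<Rightarrow>\<^sub>0 'k::field"
  assumes "Poly_Mapping.lookup a 0 = 0 \<or> Poly_Mapping.lookup b 0 = 0"
  shows "Poly_Mapping.lookup (a * b) 0 = 0"
proof -
  have "0 \<notin> Poly_Mapping.keys (a * b)"
  proof
    assume "0 \<in> Poly_Mapping.keys (a * b)"
    then obtain u w where "u \<in> Poly_Mapping.keys a" "w \<in> Poly_Mapping.keys b" "0 = u + w"
      using keys_mult[of a b] by blast
    moreover then have "u = 0" "w = 0"
      by (cases u; cases w; simp add: zero_word_def plus_word_def)+
    ultimately show False using assms by (simp add: in_keys_iff)
  qed
  then show ?thesis by (simp add: in_keys_iff)
qed

lemma gen_in_free_nonunital:
  assumes "x \<in> generators E"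
  shows "(gen x :: ('v, 'e, 'k::field) free_element) \<in> carrier (free_nonunital E)"
  using assms by (auto simp: gen_def free_nonunital_def free_algebra_def lookup_single
      zero_word_def when_def)

lemma free_nonunital_simps:
  "zero (free_nonunital E) = 0" "add (free_nonunital E) = (+)" "mult (free_nonunital E) = (*)"
  by (simp_all add: free_nonunital_def free_algebra_def)

lemma free_algebra_minus:
  assumes "(a :: ('v, 'e, 'k::field) free_element) \<in> carrier (free_algebra E)"
  shows "\<ominus>\<^bsub>free_algebra E\<^esub> a = - a" "- a \<in> carrier (free_algebra E)"
proof -
  interpret ring "free_algebra E :: ('v, 'e, 'k) free_element ring" by (rule ring_free_algebra)
  show *: "- a \<in> carrier (free_algebra E)"
    using assms by (auto simp: free_algebra_def keys_minus)
  show "\<ominus>\<^bsub>free_algebra E\<^esub> a = - a"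
    using assms * by (intro minus_equality) (auto simp: free_algebra_simps)
qed

lemma ideal_free_nonunital:
  "ideal (carrier (free_nonunital E)) (free_algebra E :: ('v, 'e, 'k::field) free_element ring)"
proof -
  interpret ring "free_algebra E :: ('v, 'e, 'k) free_element ring" by (rule ring_free_algebra)
  show ?thesis
  proof (rule idealI)
    show "subgroup (carrier (free_nonunital E)) (add_monoid (free_algebra E :: ('v, 'e, 'k) free_element ring))"
      by (rule add.subgroupI)
         (use zero_closed a_closed in \<open>auto simp: free_nonunital_def free_algebra_simps lookup_add
            a_inv_def[symmetric] free_algebra_minus\<close>)
  qed (use ring_axioms m_closed in \<open>auto simp: free_nonunital_def free_algebra_simps lookup_mult_zero_word\<close>)
qed

lemma free_nonunital_closed:
  fixes E :: "('v, 'e) pre_digraph" and a b :: "('v, 'e, 'k::field) free_element"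
  defines "C \<equiv> carrier (free_nonunital E) :: ('v, 'e, 'k) free_element set"
  shows "0 \<in> C" "a \<in> C \<Longrightarrow> b \<in> C \<Longrightarrow> a + b \<in> C" "a \<in> C \<Longrightarrow> - a \<in> C"
    "a \<in> C \<Longrightarrow> b \<in> C \<Longrightarrow> a - b \<in> C" "a \<in> C \<Longrightarrow> b \<in> C \<Longrightarrow> a * b \<in> C"
proof -
  interpret I: ideal C "free_algebra E :: ('v, 'e, 'k) free_element ring"
    unfolding C_def by (rule ideal_free_nonunital)
  show "0 \<in> C"
    using additive_subgroup.zero_closed[OF I.is_additive_subgroup] by (simp add: free_algebra_simps)
  show add: "a + b \<in> C" if "a \<in> C" "b \<in> C" for a b
    using additive_subgroup.a_closed[OF I.is_additive_subgroup that] by (simp add: free_algebra_simps)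
  show neg: "- a \<in> C" if "a \<in> C" for a
    using that by (simp add: C_def free_nonunital_def free_algebra_def keys_minus)
  show "a - b \<in> C" if "a \<in> C" "b \<in> C"
    using add[OF that(1) neg[OF that(2)]] by simp
  show "a * b \<in> C" if "a \<in> C" "b \<in> C"
    using I.I_l_closed[of b a] that I.a_subset by (auto simp: free_algebra_simps)
qed

lemma lpa_relations_subset:
  assumes "wf_digraph E"
  shows "(lpa_relations E :: ('v, 'e, 'k::field) free_element set) \<subseteq> carrier (free_nonunital E)"
proof -
  interpret wf_digraph E by fact
  let ?C = "carrier (free_nonunital E) :: ('v, 'e, 'k) free_element set"
  note add = free_nonunital_closed(2) and diff = free_nonunital_closed(4)
    and mult = free_nonunital_closed(5) and zero = free_nonunital_closed(1)
  have sum: "(\<Sum>x\<in>X. f x) \<in> ?C" if "\<forall>x \<in> X. f x \<in> ?C" for f and X :: "'e set"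
  proof (cases "finite X")
    case True
    then show ?thesis using that
      by (induction X) (simp_all add: zero add)
  qed (simp add: zero)
  have g: "gen (Vertex v) \<in> ?C" if "v \<in> verts E" for v
    using that by (intro gen_in_free_nonunital) (auto simp: generators_def)
  have e: "gen (Edge v) \<in> ?C" if "v \<in> arcs E" for v
    using that by (intro gen_in_free_nonunital) (auto simp: generators_def)
  have gh: "gen (Ghost v) \<in> ?C" if "v \<in> arcs E" for v
    using that by (intro gen_in_free_nonunital) (auto simp: generators_def)
  show ?thesis
    unfolding lpa_relations_def
proof (intro Un_least subsetI, goal_cases)
    case (1 x)
    then show ?case by (auto intro!: diff mult g simp: zero)
  next
    case (6 x)
    then show ?case by (auto intro!: diff mult g e gh simp: zero)
  next
    case (7 x)
    then show ?case by (auto intro!: diff g sum mult e gh)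
  qed (auto intro!: diff mult g e gh)
qed

lemma ideal_lpa_kernel:
  assumes "wf_digraph E"
  shows "ideal (lpa_kernel E) (free_algebra E :: ('v, 'e, 'k::field) free_element ring)"
    and "lpa_kernel E \<subseteq> (carrier (free_nonunital E) :: ('v, 'e, 'k) free_element set)"
    and "lpa_relations E \<subseteq> (lpa_kernel E :: ('v, 'e, 'k) free_element set)"
proof -
  interpret ring "free_algebra E :: ('v, 'e, 'k) free_element ring" by (rule ring_free_algebra)
  interpret I: ideal "carrier (free_nonunital E)" "free_algebra E :: ('v, 'e, 'k) free_element ring"
    by (rule ideal_free_nonunital)
  note * = lpa_relations_subset[OF assms]
  note ** = subset_trans[OF * I.a_subset]
  show "ideal (lpa_kernel E) (free_algebra E :: ('v, 'e, 'k::field) free_element ring)"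
    unfolding lpa_kernel_def by (rule genideal_ideal[OF **])
  show "lpa_kernel E \<subseteq> (carrier (free_nonunital E) :: ('v, 'e, 'k) free_element set)"
    unfolding lpa_kernel_def by (rule genideal_minimal[OF ideal_free_nonunital *])
  show "lpa_relations E \<subseteq> (lpa_kernel E :: ('v, 'e, 'k) free_element set)"
    unfolding lpa_kernel_def by (rule genideal_self[OF **])
qed

lemma lpa_carrier: "carrier (leavitt_path_algebra E) = lpa_class E ` carrier (free_nonunital E)"
  by (auto simp: leavitt_path_algebra_def FactRing_def A_RCOSETS_def' lpa_class_def)

lemma lpa_class_def':
  "lpa_class E a = lpa_kernel E +>\<^bsub>free_algebra E\<^esub> a"
  by (simp add: lpa_class_def a_r_coset_def' free_nonunital_simps free_algebra_simps)

lemma lpa_ops: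
  assumes "wf_digraph E"
    "(a :: ('v, 'e, 'k::field) free_element) \<in> carrier (free_nonunital E)"
    "b \<in> carrier (free_nonunital E)"
  shows "lpa_class E a \<oplus>\<^bsub>leavitt_path_algebra E\<^esub> lpa_class E b = lpa_class E (a + b)"
    and "lpa_class E a \<otimes>\<^bsub>leavitt_path_algebra E\<^esub> lpa_class E b = lpa_class E (a * b)"
    and "\<zero>\<^bsub>leavitt_path_algebra E\<^esub> = lpa_class E (0 :: ('v, 'e, 'k) free_element)"
    and "lpa_class E a = lpa_class E b \<longleftrightarrow> a - b \<in> lpa_kernel E"
proof -
  interpret J: ideal "lpa_kernel E" "free_algebra E :: ('v, 'e, 'k) free_element ring"
    by (rule ideal_lpa_kernel[OF assms(1)])
  interpret I: ideal "carrier (free_nonunital E)" "free_algebra E :: ('v, 'e, 'k) free_element ring"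
    by (rule ideal_free_nonunital)
  have ab: "a \<in> carrier (free_algebra E)" "b \<in> carrier (free_algebra E)"
    using assms I.a_subset by auto
  show "lpa_class E a \<oplus>\<^bsub>leavitt_path_algebra E\<^esub> lpa_class E b = lpa_class E (a + b)"
    using J.a_rcos_sum[OF ab]
    by (simp add: lpa_class_def' leavitt_path_algebra_def FactRing_def set_add_def'
        free_algebra_simps free_nonunital_simps)
  show "lpa_class E a \<otimes>\<^bsub>leavitt_path_algebra E\<^esub> lpa_class E b = lpa_class E (a * b)"
    using J.rcoset_mult_add[OF ab]
    by (simp add: lpa_class_def' leavitt_path_algebra_def FactRing_def rcoset_mult_def a_r_coset_def'
        free_algebra_simps free_nonunital_simps)
  show "\<zero>\<^bsub>leavitt_path_algebra E\<^esub> = lpa_class E (0 :: ('v, 'e, 'k) free_element)"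
    by (simp add: lpa_class_def leavitt_path_algebra_def FactRing_def a_r_coset_def' free_nonunital_simps)
  show "lpa_class E a = lpa_class E b \<longleftrightarrow> a - b \<in> lpa_kernel E"
    using J.quotient_eq_iff_same_a_r_cos[OF J.is_ideal ab] free_algebra_minus[OF ab(2)] 
    by (simp add: lpa_class_def' a_minus_def free_algebra_simps)
qed

lemma nonunital_ring_lpa:
  assumes "wf_digraph E"
  shows "nonunital_ring (leavitt_path_algebra E :: ('v, 'e, 'k::field) lpa)"
proof -
  let ?C = "carrier (free_nonunital E) :: ('v, 'e, 'k) free_element set"
  note add = free_nonunital_closed(2) and neg = free_nonunital_closed(3)
    and mult = free_nonunital_closed(5) and zero = free_nonunital_closed(1)
  note ops = lpa_ops(1,2)[OF assms] lpa_ops(3)[OF assms zero zero] lpa_carrier add mult zero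
  have "abelian_group (leavitt_path_algebra E :: ('v, 'e, 'k) lpa)"
  proof (rule abelian_groupI, goal_cases)
    case (6 x)
    then obtain a where "a \<in> ?C" "x = lpa_class E a" by (auto simp: ops)
    then show ?case
      using neg[of a] by (intro bexI[of _ "lpa_class E (- a)"]) (auto simp: ops)
  qed (auto simp: ops ac_simps)
  then show ?thesis
    by (intro nonunital_ring.intro nonunital_ring_axioms.intro) (auto simp: ops algebra_simps)
qed

end

theory Submission
  imports Defs
begin

text \<open>
  The four sets of ideals coincide for the following reasons. Primitive ideals are prime in
  every ring. Let \<open>I\<close> be an ideal, \<open>H\<close> the set of vertices in \<open>I\<close> and \<open>S\<close> the set of those
  \<open>v \<in> B\<^sub>H\<close> with \<open>v\<^sup>H \<in> I\<close>. An element of \<open>I\<close> outside \<open>I(H,S)\<close> could be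
  multiplied from both sides, modulo \<open>I(H,S)\<close>, into a nonzero multiple of a vertex or gap vertex that
  is not in \<open>I(H,S)\<close> either; Condition (K) serves to remove the closed paths from \<open>c v + \<Sum> c\<^sub>i \<gamma>\<^sub>i\<close>. Hence
  \<open>I = I(H,S)\<close>, and any larger ideal contains a further vertex or gap vertex. If \<open>I\<close> is prime, any
  two of the vertices and gap vertices outside \<open>I\<close> are connected by a path and a ghost path not in
  \<open>I\<close>. For vertices this is the directedness of a maximal tail. For gap vertices the two paths have
  length 0, so at most one \<open>v\<^sup>H\<close> is missing from \<open>I\<close>, and then \<open>H = \<Omega>(v)\<close>. Conversely the listed
  ideals are prime because the same elements stay outside them, as a module shows.

  A prime \<open>I\<close> is primitive because the graph is countable: the connecting paths give idempotents
  \<open>f\<^sub>0 \<ge> f\<^sub>1 \<ge> \<dots>\<close> modulo \<open>I\<close>, each of the form \<open>\<lambda>e\<lambda>\<^sup>*\<close>, such that every larger ideal contains some \<open>f\<^sub>n\<close>.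
  A left ideal that is maximal among those containing \<open>{a. \<exists>n. a f\<^sub>n \<in> I}\<close> but not \<open>f\<^sub>0\<close> has a simple
  quotient, whose annihilator contains no \<open>f\<^sub>n\<close> and hence equals \<open>I\<close>. The construction is symmetric
  in the left and the right side.
\<close>

section \<open>Primitive ideals of rings without unit\<close>

text \<open>The comparison of ideals runs by induction on the length of the ghost paths in an
  element \<open>x\<close> that ends at a vertex \<open>v\<close>. Multiplying by an edge
  \<open>f\<close> at \<open>v\<close> shortens the ghosts, so every \<open>x f\<close> is settled
  by induction. At a regular vertex \<open>x = \<Sum> x f f\<^sup>*\<close> finishes. The obstacle
  is an infinite emitter, where the products \<open>x f\<close> do not determine \<open>x\<close>.
  There the ghost-free part \<open>b\<close> of \<open>x\<close> decides: if it is nonzero, all but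
  finitely many edges at \<open>v\<close> lie in the ideal, and \<open>x\<close> becomes
  \<open>b v\<^sup>H\<close>. This is how gap vertices enter.

  The missing unit shapes the ring theory. Finite sums of vertices are local units: they make ring
  ideals closed under scalars, turn primeness into a statement about \<open>a A b\<close>, and split
  an element into parts that end at single vertices. In the simple module, the idempotent
  \<open>f 0\<close> takes over the role of the unit.

  No basis of the algebra is used. Calculations are congruences modulo a varying ideal, and that an
  element lies outside a graph ideal is seen from its action on a module.\<close>

lemma two_sided_ideal_abelian_subgroup:
  "two_sided_ideal I A \<Longrightarrow> abelian_group A \<Longrightarrow> abelian_subgroup I A"
  by (simp add: two_sided_ideal_def abelian_subgroupI3)

context abelian_group
begin

lemma additive_subgroupI:
  assumes "N \<subseteq> carrier G" "\<zero> \<in> N" "\<And>x y. x \<in> N \<Longrightarrow> y \<in> N \<Longrightarrow> x \<oplus> y \<in> N"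
    "\<And>x. x \<in> N \<Longrightarrow> \<ominus> x \<in> N"
  shows "additive_subgroup N G"
  by (rule additive_subgroup.intro, rule add.subgroupI) (use assms in \<open>auto simp: a_inv_def[symmetric]\<close>)

lemma minus_closed_subgroup:
  "additive_subgroup N G \<Longrightarrow> x \<in> N \<Longrightarrow> \<ominus> x \<in> N"
  using additive_subgroup.a_inv_closed abelian_group_axioms by fastforce

end

context abelian_subgroup
begin

lemma coset_eq_iff:
  assumes "x \<in> carrier G" "y \<in> carrier G"
  shows "H +> x = H +> y \<longleftrightarrow> x \<ominus> y \<in> H"
  using a_rcos_module[OF assms(2,1)] a_repr_independence'[of x y] a_repr_independenceD[OF assms(1), of y] assms
  unfolding a_minus_def by metis

lemma coset_zero [simp]: "H +> \<zero> = H"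
  using a_rcos_const[OF additive_subgroup.zero_closed[OF additive_subgroup_axioms]] by simp

lemma coset_self_mem [simp]: "H \<in> (\<lambda>x. H +> x) ` carrier G"
  by (rule image_eqI[of _ _ \<zero>]) simp_all

lemma coset_eq_self_iff: "x \<in> carrier G \<Longrightarrow> H +> x = H \<longleftrightarrow> x \<in> H"
  using a_rcos_const a_rcos_self by blast

text \<open>Stated for an arbitrary record \<open>Q\<close> with these fields, so that it serves
  quotient rings as well as quotient modules.\<close>

lemma coset_abelian_group:
  fixes Q :: "('a set, 'c) ring_scheme"
  assumes "carrier Q = (\<lambda>x. H +> x) ` carrier G" "\<zero>\<^bsub>Q\<^esub> = H" "add Q = set_add G"
  shows "abelian_group Q"
proof (rule abelian_groupI, goal_cases)
  case (6 x)
  then obtain a where "a \<in> carrier G" "x = H +> a" using assms by auto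
  then show ?case
    using a_rcos_sum[of "\<ominus> a" a]
    by (intro bexI[of _ "H +> \<ominus> a"]) (auto simp: assms l_neg)
qed (use a_rcos_sum[of \<zero>] in \<open>auto simp: assms a_rcos_sum a_ac\<close>)

end

context nonunital_ring
begin

lemma zero_mult [simp]: "a \<in> carrier A \<Longrightarrow> \<zero> \<otimes> a = \<zero>"
  using l_distr[of \<zero> \<zero> a] m_closed[of \<zero> a] by simp

lemma mult_zero [simp]: "a \<in> carrier A \<Longrightarrow> a \<otimes> \<zero> = \<zero>"
  using r_distr[of \<zero> \<zero> a] m_closed[of a \<zero>] by simp

lemma minus_mult: "\<lbrakk>a \<in> carrier A; b \<in> carrier A\<rbrakk> \<Longrightarrow> (\<ominus> a) \<otimes> b = \<ominus> (a \<otimes> b)"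
  using l_distr[of "\<ominus> a" a b] by (intro minus_equality[symmetric]) (simp_all add: l_neg m_closed)

lemma mult_minus: "\<lbrakk>a \<in> carrier A; b \<in> carrier A\<rbrakk> \<Longrightarrow> a \<otimes> (\<ominus> b) = \<ominus> (a \<otimes> b)"
  using r_distr[of "\<ominus> b" b a] by (intro minus_equality[symmetric]) (simp_all add: l_neg m_closed)

lemma diff_mult:
  "\<lbrakk>a \<in> carrier A; b \<in> carrier A; c \<in> carrier A\<rbrakk> \<Longrightarrow> (a \<ominus> b) \<otimes> c = a \<otimes> c \<ominus> b \<otimes> c"
  by (simp add: a_minus_def l_distr minus_mult)

lemma two_sided_idealD:
  assumes "two_sided_ideal I A"
  shows "I \<subseteq> carrier A" "\<zero> \<in> I" "x \<in> I \<Longrightarrow> y \<in> I \<Longrightarrow> x \<oplus> y \<in> I" "x \<in> I \<Longrightarrow> \<ominus> x \<in> I"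
    "x \<in> I \<Longrightarrow> y \<in> I \<Longrightarrow> x \<ominus> y \<in> I"
    "a \<in> carrier A \<Longrightarrow> x \<in> I \<Longrightarrow> a \<otimes> x \<in> I" "a \<in> carrier A \<Longrightarrow> x \<in> I \<Longrightarrow> x \<otimes> a \<in> I"
proof -
  have s: "additive_subgroup I A" using assms by (simp add: two_sided_ideal_def)
  interpret additive_subgroup I A by (rule s)
  show "I \<subseteq> carrier A" by auto
  show "\<zero> \<in> I" by (rule zero_closed)
  show "x \<oplus> y \<in> I" if "x \<in> I" "y \<in> I" using that by (rule a_closed)
  show m: "\<ominus> x \<in> I" if "x \<in> I" for x using minus_closed_subgroup[OF s that] .
  show "x \<ominus> y \<in> I" if "x \<in> I" "y \<in> I" using a_closed[OF that(1) m[OF that(2)]] by (simp add: a_minus_def)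
  show "a \<in> carrier A \<Longrightarrow> x \<in> I \<Longrightarrow> a \<otimes> x \<in> I" "a \<in> carrier A \<Longrightarrow> x \<in> I \<Longrightarrow> x \<otimes> a \<in> I"
    using assms by (auto simp: two_sided_ideal_def)
qed

lemma two_sided_idealI:
  assumes "I \<subseteq> carrier A" "\<zero> \<in> I" "\<And>x y. x \<in> I \<Longrightarrow> y \<in> I \<Longrightarrow> x \<oplus> y \<in> I"
    "\<And>x. x \<in> I \<Longrightarrow> \<ominus> x \<in> I"
    "\<And>a x. a \<in> carrier A \<Longrightarrow> x \<in> I \<Longrightarrow> a \<otimes> x \<in> I"
    "\<And>a x. a \<in> carrier A \<Longrightarrow> x \<in> I \<Longrightarrow> x \<otimes> a \<in> I"
  shows "two_sided_ideal I A"
  using assms additive_subgroupI by (auto simp: two_sided_ideal_def)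

lemma two_sided_ideal_carrier: "two_sided_ideal (carrier A) A"
  by (rule two_sided_idealI) (auto simp: m_closed)

lemma two_sided_ideal_generated:
  assumes "X \<subseteq> carrier A"
  shows "two_sided_ideal (ideal_generated A X) A"
  using two_sided_ideal_carrier assms
  by (intro two_sided_idealI; unfold ideal_generated_def; blast intro: two_sided_idealD)

end

lemma subset_ideal_generated: "X \<subseteq> ideal_generated A X"
  and ideal_generated_subset: "two_sided_ideal I A \<Longrightarrow> X \<subseteq> I \<Longrightarrow> ideal_generated A X \<subseteq> I"
  by (auto simp: ideal_generated_def)

locale ring_mod_ideal = nonunital_ring +
  fixes I
  assumes I: "two_sided_ideal I A"
begin

sublocale abelian_subgroup I A
  using I abelian_group_axioms by (rule two_sided_ideal_abelian_subgroup)

lemmas I_mem = two_sided_idealD[OF I]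

lemma quot_carrier: "carrier (A Quot I) = (\<lambda>x. I +> x) ` carrier A"
  by (auto simp: FactRing_def A_RCOSETS_def')

lemma quot_zero: "\<zero>\<^bsub>A Quot I\<^esub> = I +> \<zero>"
  by (simp add: FactRing_def)

lemma quot_add:
  "x \<in> carrier A \<Longrightarrow> y \<in> carrier A \<Longrightarrow> (I +> x) \<oplus>\<^bsub>A Quot I\<^esub> (I +> y) = I +> (x \<oplus> y)"
  by (simp add: FactRing_def a_rcos_sum)

lemma coset_memD: "x' \<in> I +> x \<Longrightarrow> x \<in> carrier A \<Longrightarrow> \<exists>h \<in> I. x' = h \<oplus> x"
  by (auto simp: a_r_coset_def')

lemma quot_mult:
  assumes xy: "x \<in> carrier A" "y \<in> carrier A"
  shows "(I +> x) \<otimes>\<^bsub>A Quot I\<^esub> (I +> y) = I +> (x \<otimes> y)"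
proof -
  have "I +> x' \<otimes> y' = I +> x \<otimes> y" if x': "x' \<in> I +> x" and y': "y' \<in> I +> y" for x' y'
  proof -
    obtain h k where hk: "h \<in> I" "k \<in> I" "x' = h \<oplus> x" "y' = k \<oplus> y"
      using coset_memD x' y' xy by meson
    have c: "h \<in> carrier A" "k \<in> carrier A" using hk I_mem(1) by auto
    \<comment> \<open>The bracket is the error made by changing representatives. It lies in
      \<open>I\<close>, so the union in \<open>rcoset_mult\<close> is a union of equal
      cosets.\<close>
    have "x' \<otimes> y' = (h \<otimes> (k \<oplus> y) \<oplus> x \<otimes> k) \<oplus> x \<otimes> y"
      using hk c xy by (simp add: l_distr r_distr m_closed a_ac)
    moreover have "h \<otimes> (k \<oplus> y) \<oplus> x \<otimes> k \<in> I"
      using hk c xy by (intro I_mem(3) I_mem(6) I_mem(7)) auto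
    ultimately have "x' \<otimes> y' \<in> I +> x \<otimes> y"
      by (auto simp: a_r_coset_def')
    then show ?thesis using a_repr_independence' m_closed[OF xy] by blast
  qed
  then have "(\<Union>y'\<in>I +> y. I +> x' \<otimes> y') = I +> x \<otimes> y" if "x' \<in> I +> x" for x'
    using that a_rcos_self[OF xy(2)] by (intro UN_constant_eq[of y]) blast+
  then have "(\<Union>x'\<in>I +> x. \<Union>y'\<in>I +> y. I +> x' \<otimes> y') = I +> x \<otimes> y"
    using a_rcos_self[OF xy(1)] by (intro UN_constant_eq[of x]) blast+
  then show ?thesis
    unfolding FactRing_def rcoset_mult_def by simp
qed

lemma nonunital_ring_quot: "nonunital_ring (A Quot I)"
proof (intro nonunital_ring.intro nonunital_ring_axioms.intro)
  show "abelian_group (A Quot I)"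
    by (rule coset_abelian_group[OF quot_carrier]) (simp_all add: FactRing_def)
qed (auto simp: quot_carrier quot_mult quot_add m_closed m_assoc l_distr r_distr)

end

section \<open>Exchanging left and right: the opposite ring\<close>

definition opposite_ring :: "('a, 'c) ring_scheme \<Rightarrow> ('a, 'c) ring_scheme" where
  "opposite_ring A = A\<lparr>mult := \<lambda>a b. b \<otimes>\<^bsub>A\<^esub> a\<rparr>"

lemma opposite_ring_simps:
  "carrier (opposite_ring A) = carrier A" "\<zero>\<^bsub>opposite_ring A\<^esub> = \<zero>\<^bsub>A\<^esub>"
  "add (opposite_ring A) = add A" "a \<otimes>\<^bsub>opposite_ring A\<^esub> b = b \<otimes>\<^bsub>A\<^esub> a"
  by (simp_all add: opposite_ring_def)

lemma add_monoid_opposite: "add_monoid (opposite_ring A) = add_monoid A"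
  by (simp add: opposite_ring_def)

lemma abelian_group_opposite: "abelian_group (opposite_ring A) \<longleftrightarrow> abelian_group A"
proof -
  have "abelian_group (opposite_ring A)" if "abelian_group A" for A :: "('a, 'c) ring_scheme"
  proof -
    interpret abelian_group A by fact
    show ?thesis
      by (rule abelian_groupI) (auto simp: opposite_ring_simps a_ac intro: a_closed add.l_inv_ex)
  qed
  from this[of A] this[of "opposite_ring A"] show ?thesis
    by (auto simp: opposite_ring_def)
qed

lemma nonunital_ring_opposite: "nonunital_ring A \<Longrightarrow> nonunital_ring (opposite_ring A)"
  by (auto simp: nonunital_ring_def nonunital_ring_axioms_def opposite_ring_simps abelian_group_opposite)

lemma two_sided_ideal_opposite: "two_sided_ideal I (opposite_ring A) \<longleftrightarrow> two_sided_ideal I A"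
  by (auto simp: two_sided_ideal_def additive_subgroup_def add_monoid_opposite opposite_ring_simps)

lemma opposite_quot: "opposite_ring A Quot I = opposite_ring (A Quot I)"
  by (auto simp: FactRing_def opposite_ring_def A_RCOSETS_def rcoset_mult_def a_r_coset_def
      set_add_def fun_eq_iff)

lemma ideal_prod_opposite: "ideal_prod (opposite_ring A) I J = ideal_prod A J I"
proof -
  have *: "x \<in> ideal_prod B I J \<Longrightarrow> x \<in> ideal_prod (opposite_ring B) J I" 
    for B :: "('a, 'c) ring_scheme" and x I J
    by (induction rule: ideal_prod.induct)
       (metis ideal_prod.prod opposite_ring_simps(4), metis ideal_prod.sum opposite_ring_simps(3))
  from *[of _ "opposite_ring A"] *[of _ A] show ?thesis by (auto simp: opposite_ring_def)
qed

lemma prime_ideals_opposite: "prime_ideals (opposite_ring A) = prime_ideals A"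
  unfolding prime_ideals_def
  by (auto simp: two_sided_ideal_opposite ideal_prod_opposite opposite_ring_simps)

lemma right_module_opposite: "right_module A M \<longleftrightarrow> left_module (opposite_ring A) M"
proof
  assume "right_module A M"
  then interpret right_module A M .
  show "left_module (opposite_ring A) M"
    by (intro left_module.intro left_module_axioms.intro abelian_group_axioms; unfold opposite_ring_simps)
       (rule act_closed act_add_l act_add_r act_mult; assumption)+
next
  assume "left_module (opposite_ring A) M"
  then interpret left_module "opposite_ring A" M .
  note ax = act_closed act_add_l act_add_r act_mult
  show "right_module A M"
    by (intro right_module.intro right_module_axioms.intro abelian_group_axioms)
       (rule ax[unfolded opposite_ring_simps]; assumption)+
qed

text \<open>Two-sided ideals and prime ideals of a ring and its opposite coincide and quotients
  correspond, so this turns each result on left primitivity into its right-handed version.\<close>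

lemma right_primitive_opposite: "right_primitive A \<longleftrightarrow> left_primitive (opposite_ring A)"
  unfolding right_primitive_def left_primitive_def right_module_opposite
  by (simp add: simple_action_def faithful_action_def opposite_ring_simps)

context ring_mod_ideal
begin

text \<open>The elements killed by \<open>J1\<close> form a submodule \<open>N\<close>, and
  \<open>J2\<close> maps the module into it when \<open>J1 J2\<close> acts as zero. By simplicity
  either \<open>N\<close> is zero, and \<open>J2\<close> acts as zero, or \<open>N\<close> is
  everything, and \<open>J1\<close> does. Faithfulness puts that ideal into
  \<open>I\<close>.\<close>

lemma left_primitive_imp_prime:
  assumes "left_primitive (A Quot I)"
  shows "I \<in> prime_ideals A"
proof -
  interpret B: nonunital_ring "A Quot I" by (rule nonunital_ring_quot)
  obtain M :: "('a set, 'a set set) module"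
    where M: "left_module (A Quot I) M" "simple_action (A Quot I) M" "faithful_action (A Quot I) M"
    using assms unfolding left_primitive_def by blast
  interpret M: left_module "A Quot I" M by (rule M)
  have zero_act: "(I +> \<zero>) \<odot>\<^bsub>M\<^esub> x = \<zero>\<^bsub>M\<^esub>" if "x \<in> carrier M" for x
  proof -
    have c: "I +> \<zero> \<in> carrier (A Quot I)" by (auto simp: quot_carrier)
    have "(I +> \<zero>) \<oplus>\<^bsub>A Quot I\<^esub> (I +> \<zero>) = I +> \<zero>"
      using quot_add[of \<zero> \<zero>] by (simp del: coset_zero)
    from M.act_add_l[OF c c that, unfolded this] show ?thesis
      using M.add.l_cancel_one M.act_closed[OF c that] by metis
  qed
  have act_zero: "b \<odot>\<^bsub>M\<^esub> \<zero>\<^bsub>M\<^esub> = \<zero>\<^bsub>M\<^esub>" if "b \<in> carrier (A Quot I)" for b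
    using M.act_add_r[OF that M.zero_closed M.zero_closed, unfolded M.l_zero[OF M.zero_closed]]
      M.add.l_cancel_one M.act_closed[OF that M.zero_closed] by metis
  have act_inv: "b \<odot>\<^bsub>M\<^esub> (\<ominus>\<^bsub>M\<^esub> x) = \<ominus>\<^bsub>M\<^esub> (b \<odot>\<^bsub>M\<^esub> x)" if "b \<in> carrier (A Quot I)" "x \<in> carrier M" for b x
    using M.act_add_r[OF that(1), of "\<ominus>\<^bsub>M\<^esub> x" x] that
    by (intro M.minus_equality[symmetric]) (simp_all add: M.l_neg M.act_closed act_zero)
  have mem_I: "a \<in> I" if "a \<in> carrier A" "\<And>x. x \<in> carrier M \<Longrightarrow> (I +> a) \<odot>\<^bsub>M\<^esub> x = \<zero>\<^bsub>M\<^esub>" for a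
  proof -
    have "I +> a \<in> carrier (A Quot I)" using that(1) by (simp add: quot_carrier)
    then have "I +> a = I +> \<zero>"
      using M(3) that(2) unfolding faithful_action_def quot_zero by blast
    then show ?thesis using that(1) coset_eq_self_iff by simp
  qed
  \<comment> \<open>Otherwise the quotient ring is zero, against the nonzero action that
    \<open>simple_action\<close> demands.\<close>
  have proper: "I \<noteq> carrier A"
  proof
    assume "I = carrier A"
    then have "I +> a = I +> \<zero>" if "a \<in> carrier A" for a
      using that coset_eq_self_iff by simp
    then have "b = I +> \<zero>" if "b \<in> carrier (A Quot I)" for b
      using that unfolding quot_carrier by blast
    then show False
      using M(2) zero_act unfolding simple_action_def by blast
  qed
  have "J1 \<subseteq> I \<or> J2 \<subseteq> I"
    if J: "two_sided_ideal J1 A" "two_sided_ideal J2 A" "ideal_prod A J1 J2 \<subseteq> I" for J1 J2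
  proof -
    note J1 = two_sided_idealD[OF J(1)] and J2 = two_sided_idealD[OF J(2)]
    have J12: "a \<otimes> b \<in> I" if "a \<in> J1" "b \<in> J2" for a b
      using J(3) that by (auto intro: ideal_prod.prod)
    define N where "N = {x \<in> carrier M. \<forall>a \<in> J1. (I +> a) \<odot>\<^bsub>M\<^esub> x = \<zero>\<^bsub>M\<^esub>}"
    have cJ1: "I +> a \<in> carrier (A Quot I)" if "a \<in> J1" for a
      using J1(1) that by (auto simp: quot_carrier)
    have "additive_subgroup N M"
    proof (rule M.additive_subgroupI)
      show "\<zero>\<^bsub>M\<^esub> \<in> N" by (simp add: N_def cJ1 act_zero)
      show "N \<subseteq> carrier M" by (auto simp: N_def)
      fix x assume "x \<in> N"
      then have x: "x \<in> carrier M" "\<And>a. a \<in> J1 \<Longrightarrow> (I +> a) \<odot>\<^bsub>M\<^esub> x = \<zero>\<^bsub>M\<^esub>"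
        by (simp_all add: N_def)
      have "(I +> a) \<odot>\<^bsub>M\<^esub> (\<ominus>\<^bsub>M\<^esub> x) = \<zero>\<^bsub>M\<^esub>" if "a \<in> J1" for a
        using act_inv[OF cJ1[OF that] x(1)] x(2)[OF that] M.minus_equality[of "\<zero>\<^bsub>M\<^esub>" "\<zero>\<^bsub>M\<^esub>"] by simp
      then show "\<ominus>\<^bsub>M\<^esub> x \<in> N"
        unfolding N_def using x(1) by simp
      fix y assume "y \<in> N"
      then have y: "y \<in> carrier M" "\<And>a. a \<in> J1 \<Longrightarrow> (I +> a) \<odot>\<^bsub>M\<^esub> y = \<zero>\<^bsub>M\<^esub>"
        by (simp_all add: N_def)
      show "x \<oplus>\<^bsub>M\<^esub> y \<in> N"
        unfolding N_def using x y M.act_add_r[OF cJ1 x(1) y(1)] by simp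
    qed
    moreover have "b \<odot>\<^bsub>M\<^esub> x \<in> N" if "b \<in> carrier (A Quot I)" "x \<in> N" for b x
    proof -
      from that(1) obtain b' where b': "b = I +> b'" "b' \<in> carrier A" unfolding quot_carrier by (rule imageE)
      have "(I +> a) \<odot>\<^bsub>M\<^esub> (b \<odot>\<^bsub>M\<^esub> x) = \<zero>\<^bsub>M\<^esub>" if a: "a \<in> J1" for a
      proof -
        have "(I +> a) \<odot>\<^bsub>M\<^esub> (b \<odot>\<^bsub>M\<^esub> x) = (I +> (a \<otimes> b')) \<odot>\<^bsub>M\<^esub> x"
        proof -
          have "a \<in> carrier A" "x \<in> carrier M" using a J1(1) \<open>x \<in> N\<close> by (auto simp: N_def)
          then show ?thesis
            using M.act_mult[OF cJ1[OF a] \<open>b \<in> _\<close>, of x] quot_mult[OF _ b'(2), of a] unfolding b'(1) by simp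
        qed
        then show ?thesis using \<open>x \<in> N\<close> J1(7)[OF b'(2) a] by (simp add: N_def)
      qed
      then show ?thesis using that M.act_closed by (simp add: N_def)
    qed
    ultimately have "N = {\<zero>\<^bsub>M\<^esub>} \<or> N = carrier M"
      using M(2) unfolding simple_action_def by blast
    then show ?thesis
    proof
      assume N: "N = {\<zero>\<^bsub>M\<^esub>}"
      have "b \<in> I" if b: "b \<in> J2" for b
      proof (rule mem_I)
        have cb: "b \<in> carrier A" "I +> b \<in> carrier (A Quot I)" using b J2(1) by (auto simp: quot_carrier)
        show "(I +> b) \<odot>\<^bsub>M\<^esub> x = \<zero>\<^bsub>M\<^esub>" if x: "x \<in> carrier M" for x
        proof -
          have "(I +> a) \<odot>\<^bsub>M\<^esub> ((I +> b) \<odot>\<^bsub>M\<^esub> x) = \<zero>\<^bsub>M\<^esub>" if a: "a \<in> J1" for a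
          proof -
            have "(I +> a) \<odot>\<^bsub>M\<^esub> ((I +> b) \<odot>\<^bsub>M\<^esub> x) = (I +> (a \<otimes> b)) \<odot>\<^bsub>M\<^esub> x"
              using M.act_mult[OF cJ1[OF a] cb(2) x] quot_mult[OF _ cb(1), of a] a J1(1) by (simp add: subset_iff)
            also have "I +> (a \<otimes> b) = I +> \<zero>"
              using a_rcos_const[OF J12[OF a b]] by simp
            finally show ?thesis using zero_act x by simp
          qed
          then have "(I +> b) \<odot>\<^bsub>M\<^esub> x \<in> N" using M.act_closed[OF cb(2) x] by (simp add: N_def)
          then show ?thesis using N by simp
        qed
      qed (use b J2(1) in auto)
      then show ?thesis by blast
    next
      assume N: "N = carrier M"
      have "a \<in> I" if "a \<in> J1" for a
        using that J1(1) N by (intro mem_I) (auto simp: N_def)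
      then show ?thesis by blast
    qed
  qed
  with proper I show ?thesis by (simp add: prime_ideals_def)
qed

lemma ring_mod_ideal_opposite: "ring_mod_ideal (opposite_ring A) I"
  using I nonunital_ring_axioms
  by (simp add: ring_mod_ideal_def ring_mod_ideal_axioms_def nonunital_ring_opposite
      two_sided_ideal_opposite)

lemma right_primitive_imp_prime:
  "right_primitive (A Quot I) \<Longrightarrow> I \<in> prime_ideals A"
  using ring_mod_ideal.left_primitive_imp_prime[OF ring_mod_ideal_opposite]
  by (simp add: opposite_quot right_primitive_opposite prime_ideals_opposite)

end


text \<open>Modulo \<open>N0\<close> all idempotents agree, since
  \<open>(f 0 - f n) f n = 0\<close>. So a left ideal above \<open>N0\<close> that contains some
  \<open>f n\<close> also contains \<open>f 0\<close>. If \<open>f n\<close> annihilated the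
  quotient by \<open>N\<close>, then \<open>f n = f n f 0\<close> would lie in \<open>N\<close>,
  which excludes \<open>f 0\<close>; hence the annihilator, a two-sided ideal, contains no
  \<open>f n\<close> and is zero.\<close>

lemma (in nonunital_ring) left_primitive_of_descending_idempotents:
  fixes f :: "nat \<Rightarrow> 'a"
  assumes f: "\<And>n. f n \<in> carrier A" "\<And>n m. f n \<otimes> f m = f (max n m)" "\<And>n. f n \<noteq> \<zero>"
    and ideals: "\<And>J. two_sided_ideal J A \<Longrightarrow> J \<noteq> {\<zero>} \<Longrightarrow> \<exists>n. f n \<in> J"
  shows "left_primitive A"
proof -
  define left_ideals where
    "left_ideals = {N. additive_subgroup N A \<and> (\<forall>a \<in> carrier A. \<forall>x \<in> N. a \<otimes> x \<in> N)}"
  define N0 where "N0 = {a \<in> carrier A. \<exists>n. a \<otimes> f n = \<zero>}"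
  have N0_mono: "a \<otimes> f m = \<zero>" if "a \<otimes> f n = \<zero>" "a \<in> carrier A" "n \<le> m" for a n m
    using that f m_assoc[of a "f n" "f m"] by (simp add: max_def)
  have N0_add: "a \<oplus> b \<in> N0" if ab: "a \<in> N0" "b \<in> N0" for a b
  proof -
    obtain n m where nm: "a \<otimes> f n = \<zero>" "b \<otimes> f m = \<zero>" "a \<in> carrier A" "b \<in> carrier A"
      using ab by (auto simp: N0_def)
    then have "(a \<oplus> b) \<otimes> f (max n m) = \<zero>"
      using N0_mono[of a n "max n m"] N0_mono[of b m "max n m"] f by (simp add: l_distr)
    with nm show ?thesis by (auto simp: N0_def)
  qed
  have N0: "N0 \<in> left_ideals"
    unfolding left_ideals_def
  proof (intro CollectI conjI ballI additive_subgroupI)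
    show "\<zero> \<in> N0" using f by (auto simp: N0_def)
    show "\<ominus> x \<in> N0" if x: "x \<in> N0" for x
    proof -
      obtain n where n: "x \<in> carrier A" "x \<otimes> f n = \<zero>" using x by (auto simp: N0_def)
      then have "(\<ominus> x) \<otimes> f n = \<zero>" using minus_mult[OF n(1) f(1)] minus_equality[of \<zero> \<zero>] by simp
      then show ?thesis using n by (auto simp: N0_def)
    qed
    show "a \<otimes> x \<in> N0" if ax: "a \<in> carrier A" "x \<in> N0" for a x
    proof -
      obtain n where n: "x \<in> carrier A" "x \<otimes> f n = \<zero>" using ax by (auto simp: N0_def)
      then have "(a \<otimes> x) \<otimes> f n = \<zero>" using m_assoc[OF ax(1) n(1) f(1)] ax by simp
      then show ?thesis using n ax by (auto simp: N0_def m_closed)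
    qed
  qed (use N0_add in \<open>auto simp: N0_def\<close>)
  have f0N0: "f 0 \<notin> N0" using f by (auto simp: N0_def)
  define \<A> where "\<A> = {N \<in> left_ideals. N0 \<subseteq> N \<and> f 0 \<notin> N}"
  have "\<exists>N\<in>\<A>. \<forall>X\<in>\<A>. N \<subseteq> X \<longrightarrow> X = N"
  proof (rule subset_Zorn_nonempty)
    show "\<A> \<noteq> {}" using N0 f0N0 by (auto simp: \<A>_def)
    show "\<Union>C \<in> \<A>" if "C \<noteq> {}" "subset.chain \<A> C" for C
    proof -
      have C: "C \<subseteq> \<A>" and ch: "\<And>X Y. X \<in> C \<Longrightarrow> Y \<in> C \<Longrightarrow> X \<subseteq> Y \<or> Y \<subseteq> X"
        using that(2) by (auto simp: subset_chain_def)
      have mem: "additive_subgroup X A" "\<forall>a \<in> carrier A. \<forall>x \<in> X. a \<otimes> x \<in> X" "N0 \<subseteq> X" "f 0 \<notin> X"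
        if "X \<in> C" for X using that C by (auto simp: \<A>_def left_ideals_def)
      have "\<Union>C \<in> left_ideals"
        unfolding left_ideals_def
      proof (intro CollectI conjI ballI additive_subgroupI)
        show "\<Union>C \<subseteq> carrier A" using mem(1) additive_subgroup.a_subset by blast
        show "\<zero> \<in> \<Union>C" using that(1) mem(1) additive_subgroup.zero_closed by blast
        show "\<ominus> x \<in> \<Union>C" if "x \<in> \<Union>C" for x
          using that mem(1) minus_closed_subgroup by blast
        show "a \<otimes> x \<in> \<Union>C" if "a \<in> carrier A" "x \<in> \<Union>C" for a x
          using that mem(2) by blast
        show "x \<oplus> y \<in> \<Union>C" if xy: "x \<in> \<Union>C" "y \<in> \<Union>C" for x y
        proof -
          obtain X Y where XY: "X \<in> C" "Y \<in> C" "x \<in> X" "y \<in> Y" using xy by blast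
          then obtain Z where "Z \<in> C" "x \<in> Z" "y \<in> Z" using ch[of X Y] by blast
          then show ?thesis using additive_subgroup.a_closed[OF mem(1)] by blast
        qed
      qed
      moreover have "N0 \<subseteq> \<Union>C" using mem(3) that(1) by blast
      ultimately show ?thesis using mem(4) by (simp add: \<A>_def)
    qed
  qed
  then obtain N where "N \<in> \<A>" and N_max: "\<And>X. X \<in> \<A> \<Longrightarrow> N \<subseteq> X \<Longrightarrow> X = N" by blast
  then have N: "additive_subgroup N A" "\<And>a x. a \<in> carrier A \<Longrightarrow> x \<in> N \<Longrightarrow> a \<otimes> x \<in> N" "N0 \<subseteq> N" "f 0 \<notin> N"
    by (auto simp: \<A>_def left_ideals_def)
  interpret N: abelian_subgroup N A using N(1) abelian_group_axioms by (rule abelian_subgroupI3)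
  have N_minus: "x \<ominus> y \<in> N" if "x \<in> N" "y \<in> N" for x y
    using that minus_closed_subgroup[OF N(1)] by (simp add: a_minus_def N.a_closed)
  \<comment> \<open>Thus \<open>f 0\<close> is a right unit modulo \<open>N\<close>: a left ideal
    above \<open>N\<close> that contains \<open>f 0\<close> is the whole ring. By the maximality of
    \<open>N\<close> this covers every left ideal strictly above \<open>N\<close>.\<close>
  have f0_unit: "a \<ominus> a \<otimes> f 0 \<in> N" if "a \<in> carrier A" for a
  proof -
    have "(a \<ominus> a \<otimes> f 0) \<otimes> f 0 = \<zero>"
      using that f m_assoc[OF that f(1) f(1), of 0 0] by (simp add: diff_mult m_closed, simp add: a_minus_def r_neg m_closed)
    then show ?thesis using N(3) that f by (auto simp: N0_def m_closed)
  qed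
  \<comment> \<open>The action is a union over representatives; \<open>V_smult\<close> shows that
    they all yield the same coset.\<close>
  define V :: "('a, 'a set) module" where
    "V = \<lparr>carrier = (\<lambda>x. N +> x) ` carrier A, mult = undefined, one = undefined, zero = N, add = set_add A,
          smult = \<lambda>a X. \<Union>x\<in>X. N +> (a \<otimes> x)\<rparr>"
  have V_simps: "carrier V = (\<lambda>x. N +> x) ` carrier A" "\<zero>\<^bsub>V\<^esub> = N" "add V = set_add A"
    by (simp_all add: V_def)
  have V_add: "(N +> x) \<oplus>\<^bsub>V\<^esub> (N +> y) = N +> (x \<oplus> y)" if "x \<in> carrier A" "y \<in> carrier A" for x y
    using that by (simp add: V_simps N.a_rcos_sum)
  have V_smult: "a \<odot>\<^bsub>V\<^esub> (N +> x) = N +> (a \<otimes> x)" if ax: "a \<in> carrier A" "x \<in> carrier A" for a x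
  proof -
    have "N +> (a \<otimes> x') = N +> (a \<otimes> x)" if x': "x' \<in> N +> x" for x'
    proof -
      obtain h where h: "h \<in> N" "x' = h \<oplus> x" using x' by (auto simp: a_r_coset_def')
      then have "a \<otimes> x' = a \<otimes> h \<oplus> a \<otimes> x" using ax N.a_subset by (auto simp: r_distr)
      then have "a \<otimes> x' \<in> N +> (a \<otimes> x)" using h N(2)[OF ax(1)] by (auto simp: a_r_coset_def')
      then show ?thesis using N.a_repr_independence' m_closed[OF ax] by blast
    qed
    then have "(\<Union>x'\<in>N +> x. N +> (a \<otimes> x')) = N +> (a \<otimes> x)"
      using N.a_rcos_self[OF ax(2)] by (intro UN_constant_eq[of x]) blast+
    then show ?thesis unfolding V_def by simp
  qed
  have zero_iff: "N +> x = N \<longleftrightarrow> x \<in> N" if "x \<in> carrier A" for x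
    using that by (rule N.coset_eq_self_iff)
  interpret V: abelian_group V by (rule N.coset_abelian_group) (rule V_simps)+
  have "left_module A V"
  proof (intro left_module.intro left_module_axioms.intro V.abelian_group_axioms)
  qed (auto simp only: V_simps(1) V_smult V_add m_closed m_assoc l_distr r_distr a_closed image_iff)
  moreover have "simple_action A V"
    unfolding simple_action_def
  proof (intro conjI allI impI)
    show "\<exists>a\<in>carrier A. \<exists>x\<in>carrier V. a \<odot>\<^bsub>V\<^esub> x \<noteq> \<zero>\<^bsub>V\<^esub>"
      using f N(4) zero_iff[of "f 0"]
      by (intro bexI[of _ "f 0"] bexI[of _ "N +> f 0"]) (auto simp: V_simps V_smult)
    show "W = {\<zero>\<^bsub>V\<^esub>} \<or> W = carrier V"
      if W: "additive_subgroup W V" "\<forall>a\<in>carrier A. \<forall>x\<in>W. a \<odot>\<^bsub>V\<^esub> x \<in> W" for W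
    proof (cases "W = {N}")
      case False
      interpret W: additive_subgroup W V by (rule W)
      define X where "X = {x \<in> carrier A. N +> x \<in> W}"
      have NW: "N \<in> W" using W.zero_closed by (simp add: V_simps)
      have "N \<subseteq> X"
      proof
        fix x assume x: "x \<in> N"
        then have "x \<in> carrier A" using N.a_subset by blast
        moreover have "N +> x = N" using x zero_iff calculation by blast
        ultimately show "x \<in> X" using NW by (simp add: X_def)
      qed
      have neg: "N +> (\<ominus> x) \<in> W" if "N +> x \<in> W" "x \<in> carrier A" for x
      proof -
        have "\<ominus>\<^bsub>V\<^esub> (N +> x) = N +> (\<ominus> x)"
          using that V_add[of "\<ominus> x" x]
          by (intro V.minus_equality) (auto simp: V_simps l_neg)
        moreover have "\<ominus>\<^bsub>V\<^esub> (N +> x) \<in> W"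
          using W.a_inv_closed V.abelian_group_axioms that by auto
        ultimately show ?thesis by simp
      qed
      have Xl: "X \<in> left_ideals"
        unfolding left_ideals_def
      proof (intro CollectI conjI ballI additive_subgroupI)
        show "\<zero> \<in> X" using NW by (simp add: X_def)
        show "x \<oplus> y \<in> X" if "x \<in> X" "y \<in> X" for x y
          using that W.a_closed[of "N +> x" "N +> y"] by (simp add: X_def V_add)
        show "a \<otimes> x \<in> X" if "a \<in> carrier A" "x \<in> X" for a x
          using that W(2) V_smult[of a x] m_closed by (force simp: X_def)
      qed (auto simp: X_def neg)
      have "X \<noteq> N"
      proof
        assume "X = N"
        then have "w = N" if "w \<in> W" for w
          using that W.a_subset zero_iff unfolding V_simps X_def by blast
        then show False using False NW by blast
      qed
      then have "f 0 \<in> X"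
        using N_max[of X] \<open>N \<subseteq> X\<close> Xl N(3) by (auto simp: \<A>_def)
      have "x \<in> X" if x: "x \<in> carrier A" for x
      proof -
        have c: "x \<otimes> f 0 \<in> carrier A" using x f m_closed by blast
        have "N +> x = N +> x \<otimes> f 0"
          unfolding N.coset_eq_iff[OF x c] by (rule f0_unit[OF x])
        moreover have "x \<otimes> f 0 \<in> X" using Xl \<open>f 0 \<in> X\<close> x by (auto simp: left_ideals_def)
        ultimately show ?thesis using x by (simp add: X_def)
      qed
      then have "W = carrier V" using W.a_subset by (auto simp: X_def V_simps)
      then show ?thesis ..
    qed (simp add: V_simps)
  qed
  moreover have "faithful_action A V"
  proof -
    \<comment> \<open>These are the elements that act as zero on \<open>V\<close>.\<close>
    define K where "K = {a \<in> carrier A. \<forall>x \<in> carrier A. a \<otimes> x \<in> N}"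
    have "two_sided_ideal K A"
    proof (rule two_sided_idealI)
      show "x \<oplus> y \<in> K" if "x \<in> K" "y \<in> K" for x y
        using that N.a_closed by (auto simp: K_def l_distr)
      show "\<ominus> x \<in> K" if "x \<in> K" for x
        using that minus_closed_subgroup[OF N(1)] by (auto simp: K_def minus_mult)
      show "a \<otimes> x \<in> K" if "a \<in> carrier A" "x \<in> K" for a x
        using that N(2) by (auto simp: K_def m_closed m_assoc)
      show "x \<otimes> a \<in> K" if "a \<in> carrier A" "x \<in> K" for a x
        using that by (auto simp: K_def m_closed m_assoc)
    qed (auto simp: K_def intro: N.zero_closed)
    moreover have "f n \<notin> K" for n
    proof
      assume "f n \<in> K"
      then have "f n \<otimes> f 0 \<in> N" using f(1) unfolding K_def by blast
      then have "f n \<in> N" using f by (simp add: max_def)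
      moreover have "f 0 \<ominus> f n \<in> N"
      proof -
        have "(f 0 \<ominus> f n) \<otimes> f n = \<zero>" using f by (simp add: diff_mult, simp add: a_minus_def r_neg)
        then show ?thesis using N(3) f by (auto simp: N0_def)
      qed
      ultimately have "(f 0 \<ominus> f n) \<oplus> f n \<in> N" by (rule N.a_closed[rotated])
      then show False using N(4) f by (simp add: a_minus_def a_assoc l_neg)
    qed
    ultimately have "K = {\<zero>}" using ideals by blast
    moreover have "a \<in> K" if "a \<in> carrier A" "\<forall>x\<in>carrier V. a \<odot>\<^bsub>V\<^esub> x = \<zero>\<^bsub>V\<^esub>" for a
      using that zero_iff m_closed by (auto simp: K_def V_simps V_smult)
    ultimately show ?thesis unfolding faithful_action_def by blast
  qed
  ultimately show ?thesis unfolding left_primitive_def by blast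
qed

context ring_mod_ideal
begin

lemma left_primitive_quot:
  fixes f :: "nat \<Rightarrow> 'a"
  assumes f: "\<And>n. f n \<in> carrier A" "\<And>n m. f n \<otimes> f m \<ominus> f (max n m) \<in> I" "\<And>n. f n \<notin> I"
    and ideals: "\<And>J. two_sided_ideal J A \<Longrightarrow> I \<subset> J \<Longrightarrow> \<exists>n. f n \<in> J"
  shows "left_primitive (A Quot I)"
proof -
  interpret B: nonunital_ring "A Quot I" by (rule nonunital_ring_quot)
  show ?thesis
  proof (rule B.left_primitive_of_descending_idempotents[of "\<lambda>n. I +> f n"])
    show "I +> f n \<in> carrier (A Quot I)" for n using f by (simp add: quot_carrier)
    show "(I +> f n) \<otimes>\<^bsub>A Quot I\<^esub> (I +> f m) = I +> f (max n m)" for n m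
      using f by (simp add: quot_mult m_closed coset_eq_iff)
    show "I +> f n \<noteq> \<zero>\<^bsub>A Quot I\<^esub>" for n
      using f coset_eq_self_iff[of "f n"] by (simp add: quot_zero)
    show "\<exists>n. I +> f n \<in> J" if J: "two_sided_ideal J (A Quot I)" "J \<noteq> {\<zero>\<^bsub>A Quot I\<^esub>}" for J
    proof -
      note JD = B.two_sided_idealD[OF J(1)]
      define J' where "J' = {a \<in> carrier A. I +> a \<in> J}"
      have inv: "I +> \<ominus> x \<in> J" if "x \<in> carrier A" "I +> x \<in> J" for x
      proof -
        have "\<ominus>\<^bsub>A Quot I\<^esub> (I +> x) = I +> \<ominus> x"
          using that by (intro B.minus_equality) (auto simp: quot_add quot_zero quot_carrier l_neg)
        then show ?thesis using JD(4)[OF that(2)] by simp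
      qed
      have "two_sided_ideal J' A"
      proof (rule two_sided_idealI)
        show "\<zero> \<in> J'" using JD(2) by (simp add: J'_def quot_zero)
        show "x \<oplus> y \<in> J'" if "x \<in> J'" "y \<in> J'" for x y
          using that JD(3)[of "I +> x" "I +> y"] by (simp add: J'_def quot_add)
        show "a \<otimes> x \<in> J'" if "a \<in> carrier A" "x \<in> J'" for a x
          using that JD(6)[of "I +> a" "I +> x"] by (simp add: J'_def quot_mult quot_carrier m_closed)
        show "x \<otimes> a \<in> J'" if "a \<in> carrier A" "x \<in> J'" for a x
          using that JD(7)[of "I +> a" "I +> x"] by (simp add: J'_def quot_mult quot_carrier m_closed)
      qed (auto simp: J'_def inv)
      moreover have "I \<subset> J'"
      proof -
        have IJ': "x \<in> J'" if "x \<in> I" for x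
          using that I_mem(1) a_rcos_const[OF that] JD(2) by (auto simp: J'_def quot_zero)
        obtain X where "X \<in> J" "X \<noteq> \<zero>\<^bsub>A Quot I\<^esub>" using J(2) JD(2) by blast
        moreover from \<open>X \<in> J\<close> obtain x where "x \<in> carrier A" "X = I +> x"
          using JD(1) unfolding quot_carrier by (meson imageE subsetD)
        ultimately have "x \<in> carrier A" "I +> x \<in> J" "I +> x \<noteq> I"
          by (simp_all add: quot_zero)
        then have "x \<in> J'" "x \<notin> I" using a_rcos_const by (auto simp: J'_def)
        moreover have "I \<subseteq> J'" using IJ' by blast
        ultimately show ?thesis by blast
      qed
      ultimately obtain n where "f n \<in> J'" using ideals by blast
      then show ?thesis by (auto simp: J'_def)
    qed
  qed
qed

end

text \<open>The hypotheses on \<open>f\<close> survive the passage to the opposite ring because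
  \<open>max\<close> is commutative, so the same sequence serves both sides.\<close>

lemma (in ring_mod_ideal) right_primitive_quot:
  fixes f :: "nat \<Rightarrow> 'a"
  assumes f: "\<And>n. f n \<in> carrier A" "\<And>n m. f n \<otimes> f m \<ominus> f (max n m) \<in> I" "\<And>n. f n \<notin> I"
    and ideals: "\<And>J. two_sided_ideal J A \<Longrightarrow> I \<subset> J \<Longrightarrow> \<exists>n. f n \<in> J"
  shows "right_primitive (A Quot I)"
proof -
  interpret op: ring_mod_ideal "opposite_ring A" I by (rule ring_mod_ideal_opposite)
  have minus: "a \<ominus>\<^bsub>opposite_ring A\<^esub> b = a \<ominus> b" for a b
    by (simp add: a_minus_def opposite_ring_simps a_inv_def add_monoid_opposite)
  show ?thesis
    unfolding right_primitive_opposite opposite_quot[symmetric]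
  proof (rule op.left_primitive_quot)
    show "f n \<otimes>\<^bsub>opposite_ring A\<^esub> f m \<ominus>\<^bsub>opposite_ring A\<^esub> f (max n m) \<in> I" for n m
      unfolding minus opposite_ring_simps using f(2)[of m n] by (simp only: max.commute)
    show "\<exists>n. f n \<in> J" if "two_sided_ideal J (opposite_ring A)" "I \<subset> J" for J
      using that ideals by (simp only: two_sided_ideal_opposite)
  qed (use f in \<open>simp_all only: opposite_ring_simps not_False_eq_True\<close>)
qed

section \<open>Paths in the free algebra modulo an ideal\<close>

abbreviation vtx :: "'v \<Rightarrow> ('v, 'e, 'k::field) free_element" where "vtx v \<equiv> gen (Vertex v)"
abbreviation edg :: "'e \<Rightarrow> ('v, 'e, 'k::field) free_element" where "edg e \<equiv> gen (Edge e)"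
abbreviation gho :: "'e \<Rightarrow> ('v, 'e, 'k::field) free_element" where "gho e \<equiv> gen (Ghost e)"

text \<open>Multiplication by a scalar is multiplication by a central element of the unital monoid
  algebra, so an ideal of the whole type is closed under scalars automatically.\<close>

definition scalar :: "'k \<Rightarrow> ('v, 'e, 'k::field) free_element" where
  "scalar c = Poly_Mapping.single 0 c"

text \<open>One monomial is added at a time. Freshness of its word excludes cancellation, so a
  hypothesis on all words of the sum passes to the smaller summand by
  \<open>keys_single_add\<close>.\<close>

lemma poly_mapping_single_induct [case_names zero add]:
  fixes a :: "'w \<Rightarrow>\<^sub>0 'k::comm_monoid_add"
  assumes "P 0" "\<And>w c a. w \<notin> Poly_Mapping.keys a \<Longrightarrow> c \<noteq> 0 \<Longrightarrow> P a \<Longrightarrow> P (Poly_Mapping.single w c + a)"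
  shows "P a"
proof (induction a rule: Poly_Mapping.update_induct)
  case (update f a b)
  have "Poly_Mapping.update a b f = Poly_Mapping.single a b + f"
    using update.hyps
    by (intro poly_mapping_eqI) (auto simp: lookup_update lookup_add lookup_single when_def in_keys_iff)
  with update assms(2) show ?case by simp
qed (rule assms(1))

lemma keys_single_add:
  fixes a :: "'w \<Rightarrow>\<^sub>0 'k::comm_monoid_add"
  assumes "w \<notin> Poly_Mapping.keys a" "c \<noteq> 0"
  shows "Poly_Mapping.keys (Poly_Mapping.single w c + a) = insert w (Poly_Mapping.keys a)"
  using assms by (auto simp: in_keys_iff lookup_add lookup_single when_def split: if_splits)

lemma scalar_commute: "scalar c * a = a * scalar c"
proof (induction a rule: poly_mapping_single_induct)
  case (add w d a)
  then show ?case by (simp add: distrib_left distrib_right scalar_def mult_single mult.commute)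
qed simp

lemma scalar_left: "a * (scalar c * b) = scalar c * (a * b)"
  by (simp only: mult.assoc[symmetric] scalar_commute[of c a])

lemma scalar_mult: "scalar c * scalar d = scalar (c * d)"
  by (simp add: scalar_def mult_single)

lemma scalar_one [simp]: "scalar 1 = 1"
  by (simp add: scalar_def single_one)

lemma single_conv_scalar: "Poly_Mapping.single w c = scalar c * Poly_Mapping.single w 1"
  by (simp add: scalar_def mult_single)

lemma single_Cons: "Poly_Mapping.single (Word (g # gs)) c = gen g * Poly_Mapping.single (Word gs) c"
  by (simp add: gen_def mult_single plus_word_def)

lemma single_snoc: "Poly_Mapping.single (Word (gs @ [g])) c = Poly_Mapping.single (Word gs) c * gen g"
  by (simp add: gen_def mult_single plus_word_def)

text \<open>The empty path is sent to the unit and not to a vertex. A path therefore occurs mostly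
  next to the vertex at its end, as in \<open>epath p * vtx v\<close>.\<close>

definition epath :: "'e list \<Rightarrow> ('v, 'e, 'k::field) free_element" where
  "epath p = prod_list (map (\<lambda>e. gen (Edge e)) p)"

definition gpath :: "'e list \<Rightarrow> ('v, 'e, 'k::field) free_element" where
  "gpath p = prod_list (map (\<lambda>e. gen (Ghost e)) (rev p))"

lemma epath_simps [simp]: "epath [] = 1" "epath (e # p) = edg e * epath p" "epath (p @ q) = epath p * epath q"
  by (simp_all add: epath_def)

lemma gpath_simps [simp]: "gpath [] = 1" "gpath (e # p) = gpath p * gho e" "gpath (p @ q) = gpath q * gpath p"
  by (simp_all add: gpath_def)

lemma single_edges: "Poly_Mapping.single (Word (map Edge p)) c = scalar c * epath p"
proof (induction p)
  case (Cons e p)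
  show ?case by (simp add: single_Cons Cons.IH scalar_left)
qed (simp add: scalar_def zero_word_def)

text \<open>A calculus of congruences in the free algebra on all generators of the type. The ideal
  is left open because it is instantiated by the kernel of the presentation, by preimages of ideals,
  by the annihilator of a module, and by pairs of nested ideals.\<close>

locale lpa_ideal = wf_digraph E for E :: "('v, 'e) pre_digraph" +
  fixes P :: "('v, 'e, 'k::field) free_element set"
  assumes zero_mem: "0 \<in> P"
    and add_mem: "x \<in> P \<Longrightarrow> y \<in> P \<Longrightarrow> x + y \<in> P"
    and lmul_mem: "x \<in> P \<Longrightarrow> a * x \<in> P"
    and rmul_mem: "x \<in> P \<Longrightarrow> x * a \<in> P"
    and rels_mem: "lpa_relations E \<subseteq> P"
begin

definition eqv :: "('v, 'e, 'k) free_element \<Rightarrow> ('v, 'e, 'k) free_element \<Rightarrow> bool" (infix "\<approx>" 50) where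
  "a \<approx> b \<longleftrightarrow> a - b \<in> P"

lemma uminus_mem: "x \<in> P \<Longrightarrow> - x \<in> P"
  using lmul_mem[of x "-1"] by simp

lemma diff_mem: "x \<in> P \<Longrightarrow> y \<in> P \<Longrightarrow> x - y \<in> P"
  using add_mem[OF _ uminus_mem, of x y] by simp

lemma sum_mem: "(\<And>i. i \<in> X \<Longrightarrow> f i \<in> P) \<Longrightarrow> sum f X \<in> P"
  by (induction X rule: infinite_finite_induct) (simp_all add: zero_mem add_mem)

lemma eqv_refl [simp]: "a \<approx> a"
  by (simp add: eqv_def zero_mem)

lemma eqv_sym: "a \<approx> b \<Longrightarrow> b \<approx> a"
  using uminus_mem[of "a - b"] by (simp add: eqv_def)

lemma eqv_trans [trans]: "a \<approx> b \<Longrightarrow> b \<approx> c \<Longrightarrow> a \<approx> c"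
  using add_mem[of "a - b" "b - c"] by (simp add: eqv_def)

lemma eqv_add: "a \<approx> b \<Longrightarrow> c \<approx> d \<Longrightarrow> a + c \<approx> b + d"
  using add_mem[of "a - b" "c - d"] by (simp add: eqv_def algebra_simps)

lemma eqv_minus: "a \<approx> b \<Longrightarrow> c \<approx> d \<Longrightarrow> a - c \<approx> b - d"
  using diff_mem[of "a - b" "c - d"] by (simp add: eqv_def algebra_simps)

lemma eqv_sum: "(\<And>i. i \<in> X \<Longrightarrow> f i \<approx> g i) \<Longrightarrow> sum f X \<approx> sum g X"
  unfolding eqv_def sum_subtractf[symmetric] by (rule sum_mem)

lemma eqv_lmul: "a \<approx> b \<Longrightarrow> c * a \<approx> c * b"
  using lmul_mem[of "a - b" c] by (simp add: eqv_def algebra_simps)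

lemma eqv_rmul: "a \<approx> b \<Longrightarrow> a * c \<approx> b * c"
  using rmul_mem[of "a - b" c] by (simp add: eqv_def algebra_simps)

lemma eqv_mult: "a \<approx> b \<Longrightarrow> c \<approx> d \<Longrightarrow> a * c \<approx> b * d"
  by (rule eqv_trans[OF eqv_lmul eqv_rmul])

lemma eqv_mid: "a \<approx> b \<Longrightarrow> c * a * d \<approx> c * b * d"
  by (intro eqv_lmul eqv_rmul)

lemma eqv_zero_iff: "a \<approx> 0 \<longleftrightarrow> a \<in> P"
  by (simp add: eqv_def)

lemma eqv_zero_mid: "a \<approx> 0 \<Longrightarrow> c * a * d \<approx> 0"
  unfolding eqv_zero_iff by (intro lmul_mem rmul_mem)

lemma eqv_mem_iff: "a \<approx> b \<Longrightarrow> a \<in> P \<longleftrightarrow> b \<in> P"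
  using eqv_trans[of a b 0] eqv_trans[of b a 0] eqv_sym[of a b] by (auto simp: eqv_zero_iff)

lemma scalar_mem_cancel:
  assumes "scalar c * x \<in> P" "c \<noteq> 0"
  shows "x \<in> P"
proof -
  have "scalar (inverse c) * (scalar c * x) = x"
    unfolding mult.assoc[symmetric] scalar_mult using assms(2) by simp
  then show ?thesis using lmul_mem[OF assms(1), of "scalar (inverse c)"] by simp
qed

section \<open>The defining relations as congruences\<close>

lemma vtx_vtx_relation: "v \<in> verts E \<Longrightarrow> w \<in> verts E \<Longrightarrow> vtx v * vtx w - (if v = w then vtx v else 0) \<in> P"
  by (rule subsetD[OF rels_mem], unfold lpa_relations_def, rule UnI1, rule UnI1, rule UnI1, rule UnI1, rule UnI1, rule UnI1, rule CollectI, intro exI conjI, rule refl) assumption+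

lemma vtx_edg: "e \<in> arcs E \<Longrightarrow> vtx (tail E e) * edg e \<approx> edg e"
  unfolding eqv_def
  by (rule subsetD[OF rels_mem], unfold lpa_relations_def, rule UnI1, rule UnI1, rule UnI1, rule UnI1, rule UnI1, rule UnI2, rule CollectI, intro exI conjI, rule refl) assumption+

lemma edg_vtx: "e \<in> arcs E \<Longrightarrow> edg e * vtx (head E e) \<approx> edg e"
  unfolding eqv_def
  by (rule subsetD[OF rels_mem], unfold lpa_relations_def, rule UnI1, rule UnI1, rule UnI1, rule UnI1, rule UnI2, rule CollectI, intro exI conjI, rule refl) assumption+

lemma vtx_gho: "e \<in> arcs E \<Longrightarrow> vtx (head E e) * gho e \<approx> gho e"
  unfolding eqv_def
  by (rule subsetD[OF rels_mem], unfold lpa_relations_def, rule UnI1, rule UnI1, rule UnI1, rule UnI2, rule CollectI, intro exI conjI, rule refl) assumption+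

lemma gho_vtx: "e \<in> arcs E \<Longrightarrow> gho e * vtx (tail E e) \<approx> gho e"
  unfolding eqv_def
  by (rule subsetD[OF rels_mem], unfold lpa_relations_def, rule UnI1, rule UnI1, rule UnI2, rule CollectI, intro exI conjI, rule refl) assumption+

lemma gho_edg_relation: "e \<in> arcs E \<Longrightarrow> f \<in> arcs E \<Longrightarrow> gho e * edg f - (if e = f then vtx (head E e) else 0) \<in> P"
  by (rule subsetD[OF rels_mem], unfold lpa_relations_def, rule UnI1, rule UnI2, rule CollectI, intro exI conjI, rule refl) assumption+

lemma vtx_sum: "v \<in> verts E \<Longrightarrow> regular_vertex E v \<Longrightarrow> vtx v \<approx> (\<Sum>e \<in> out_arcs E v. edg e * gho e)"
  unfolding eqv_def
  by (rule subsetD[OF rels_mem], unfold lpa_relations_def, rule UnI2, rule CollectI, intro exI conjI, rule refl) assumption+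

lemma vtx_vtx: "v \<in> verts E \<Longrightarrow> vtx v * vtx v \<approx> vtx v"
  using vtx_vtx_relation[of v v] by (simp add: eqv_def)

lemma vtx_neq: "v \<in> verts E \<Longrightarrow> w \<in> verts E \<Longrightarrow> v \<noteq> w \<Longrightarrow> vtx v * vtx w \<approx> 0"
  using vtx_vtx_relation[of v w] by (simp add: eqv_def)

lemma gho_edg: "e \<in> arcs E \<Longrightarrow> gho e * edg e \<approx> vtx (head E e)"
  using gho_edg_relation[of e e] by (simp add: eqv_def)

lemma gho_edg_neq: "e \<in> arcs E \<Longrightarrow> f \<in> arcs E \<Longrightarrow> e \<noteq> f \<Longrightarrow> gho e * edg f \<approx> 0"
  using gho_edg_relation[of e f] by (simp add: eqv_def)

section \<open>Products of real paths, ghost paths and vertices\<close>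

lemma awalk_ConsD:
  "awalk u (e # p) v \<Longrightarrow> e \<in> arcs E \<and> u = tail E e \<and> awalk (head E e) p v"
  by (simp add: awalk_Cons_iff)

text \<open>Keeping a vertex on both sides covers the empty path, for which
  \<open>vtx u * epath p\<close> is \<open>vtx u\<close> and not \<open>epath p\<close>.\<close>

lemma vtx_epath: "awalk u p v \<Longrightarrow> vtx u * epath p \<approx> epath p * vtx v"
proof (induction p arbitrary: u)
  case Nil
  then show ?case by (simp add: awalk_Nil_iff)
next
  case (Cons e p)
  note e = awalk_ConsD[OF Cons.prems]
  have "vtx u * epath (e # p) = vtx (tail E e) * edg e * epath p" using e by (simp add: mult.assoc)
  also have "\<dots> \<approx> edg e * epath p" using e by (intro eqv_rmul vtx_edg) simp
  also have "\<dots> \<approx> edg e * vtx (head E e) * epath p" using e by (intro eqv_rmul eqv_sym[OF edg_vtx]) simp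
  also have "\<dots> = edg e * (vtx (head E e) * epath p)" by (simp add: mult.assoc)
  also have "\<dots> \<approx> edg e * (epath p * vtx v)" using e by (intro eqv_lmul Cons.IH) simp
  finally show ?case by (simp add: mult.assoc)
qed

lemma gpath_vtx: "awalk u p v \<Longrightarrow> gpath p * vtx u \<approx> vtx v * gpath p"
proof (induction p arbitrary: u)
  case Nil
  then show ?case by (simp add: awalk_Nil_iff)
next
  case (Cons e p)
  note e = awalk_ConsD[OF Cons.prems]
  have "gpath (e # p) * vtx u = gpath p * (gho e * vtx (tail E e))" using e by (simp add: mult.assoc)
  also have "\<dots> \<approx> gpath p * gho e" using e by (intro eqv_lmul gho_vtx) simp
  also have "\<dots> \<approx> gpath p * (vtx (head E e) * gho e)" using e by (intro eqv_lmul eqv_sym[OF vtx_gho]) simp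
  also have "\<dots> = (gpath p * vtx (head E e)) * gho e" by (simp add: mult.assoc)
  also have "\<dots> \<approx> (vtx v * gpath p) * gho e" using e by (intro eqv_rmul Cons.IH) simp
  finally show ?case by (simp add: mult.assoc)
qed

lemma vtx_epath_vtx: "awalk u p v \<Longrightarrow> vtx u * epath p * vtx v \<approx> epath p * vtx v"
proof -
  assume p: "awalk u p v"
  have "vtx u * epath p * vtx v \<approx> epath p * vtx v * vtx v" by (rule eqv_rmul[OF vtx_epath[OF p]])
  also have "\<dots> = epath p * (vtx v * vtx v)" by (simp add: mult.assoc)
  also have "\<dots> \<approx> epath p * vtx v" by (rule eqv_lmul[OF vtx_vtx]) (rule awalk_last_in_verts[OF p])
  finally show ?thesis .
qed

lemma vtx_epath_neq:
  assumes "awalk u p v" "w \<in> verts E" "w \<noteq> u"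
  shows "vtx w * epath p * vtx v \<approx> 0"
proof -
  have "vtx w * epath p * vtx v = vtx w * (epath p * vtx v)" by (simp add: mult.assoc)
  also have "\<dots> \<approx> vtx w * (vtx u * epath p)" by (intro eqv_lmul eqv_sym[OF vtx_epath]) fact
  also have "\<dots> = (vtx w * vtx u) * epath p" by (simp add: mult.assoc)
  also have "\<dots> \<approx> 0 * epath p"
    using assms awalk_hd_in_verts[OF assms(1)] by (intro eqv_rmul vtx_neq) auto
  finally show ?thesis by simp
qed

text \<open>Ghost letters meet edges one by one: equal edges cancel to a vertex, and the first
  differing pair gives zero. The alternatives do not exclude each other, since a remaining path may
  itself lie in \<open>P\<close>.\<close>

lemma gpath_epath_compare:
  assumes "awalk u p v" "awalk u' p' w" "length p \<le> length p'"
  shows "vtx v * gpath p * epath p' * vtx w \<approx> 0 \<or>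
    (\<exists>r. p' = p @ r \<and> awalk v r w \<and> vtx v * gpath p * epath p' * vtx w \<approx> epath r * vtx w)"
  using assms
proof (induction p arbitrary: u u' p')
  case Nil
  have v: "v \<in> verts E" by (rule awalk_last_in_verts[OF Nil.prems(1)])
  show ?case
  proof (cases "u' = v")
    case True
    then show ?thesis using vtx_epath_vtx[OF Nil.prems(2)] Nil.prems(2) by simp
  next
    case False
    then show ?thesis using vtx_epath_neq[OF Nil.prems(2) v] by simp
  qed
next
  case (Cons e p)
  note e = awalk_ConsD[OF Cons.prems(1)]
  from Cons.prems(3) obtain f q where p': "p' = f # q" and le: "length p \<le> length q"
    by (cases p') auto
  note f = awalk_ConsD[OF Cons.prems(2)[unfolded p']]
  have v: "v \<in> verts E" using awalk_last_in_verts Cons.prems(1) by blast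
  have split: "vtx v * gpath (e # p) * epath p' * vtx w = (vtx v * gpath p) * (gho e * edg f) * (epath q * vtx w)"
    by (simp add: p' mult.assoc)
  show ?case
  proof (cases "e = f")
    case False
    then show ?thesis using eqv_zero_mid[OF gho_edg_neq] e f unfolding split by blast
  next
    case True
    have "vtx v * gpath (e # p) * epath p' * vtx w \<approx> (vtx v * gpath p) * vtx (head E e) * (epath q * vtx w)"
      unfolding split True[symmetric] by (rule eqv_mid[OF gho_edg]) (use e in simp)
    also have "\<dots> = vtx v * (gpath p * vtx (head E e)) * (epath q * vtx w)" by (simp add: mult.assoc)
    also have "\<dots> \<approx> vtx v * (vtx v * gpath p) * (epath q * vtx w)"
      by (rule eqv_mid[OF gpath_vtx]) (use e in simp)
    also have "\<dots> = (vtx v * vtx v) * (gpath p * epath q * vtx w)" by (simp add: mult.assoc)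
    also have "\<dots> \<approx> vtx v * (gpath p * epath q * vtx w)" by (rule eqv_rmul[OF vtx_vtx[OF v]])
    finally have *: "vtx v * gpath (e # p) * epath p' * vtx w \<approx> vtx v * gpath p * epath q * vtx w"
      by (simp add: mult.assoc)
    show ?thesis
      using Cons.IH[OF conjunct2[OF conjunct2[OF e]] conjunct2[OF conjunct2[OF f]] le]
        eqv_trans[OF *] True p' by (metis append_Cons)
  qed
qed

lemma gpath_epath_self: "awalk u p v \<Longrightarrow> vtx v * gpath p * epath p * vtx v \<approx> vtx v"
proof (induction p arbitrary: u)
  case Nil
  have v: "v \<in> verts E" by (rule awalk_last_in_verts[OF Nil])
  show ?case using vtx_vtx[OF v] by simp
next
  case (Cons e p)
  note e = awalk_ConsD[OF Cons.prems]
  have v: "v \<in> verts E" using awalk_last_in_verts Cons.prems(1) by blast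
  have "vtx v * gpath (e # p) * epath (e # p) * vtx v = (vtx v * gpath p) * (gho e * edg e) * (epath p * vtx v)"
    by (simp add: mult.assoc)
  also have "\<dots> \<approx> (vtx v * gpath p) * vtx (head E e) * (epath p * vtx v)"
    by (rule eqv_mid[OF gho_edg]) (use e in simp)
  also have "\<dots> = (vtx v * gpath p) * (vtx (head E e) * epath p * vtx v)" by (simp add: mult.assoc)
  also have "\<dots> \<approx> (vtx v * gpath p) * (epath p * vtx v)"
    by (rule eqv_lmul[OF vtx_epath_vtx]) (use e in simp)
  also have "\<dots> = vtx v * gpath p * epath p * vtx v" by (simp add: mult.assoc)
  also have "\<dots> \<approx> vtx v" by (rule Cons.IH[OF conjunct2[OF conjunct2[OF e]]])
  finally show ?case .
qed

text \<open>Modulo \<open>P\<close>, these are the linear combinations of monomials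
  \<open>p q\<^sup>*\<close> in which \<open>q\<close> starts at \<open>v\<close> and has length at
  most \<open>m\<close>. The bound on the ghost part is the parameter of the later
  induction.\<close>

inductive_set gspan :: "nat \<Rightarrow> 'v \<Rightarrow> ('v, 'e, 'k) free_element set" for m v where
  base: "x \<in> P \<Longrightarrow> x \<in> gspan m v"
| step: "x \<in> gspan m v \<Longrightarrow> awalk u p y \<Longrightarrow> awalk v q y \<Longrightarrow> length q \<le> m \<Longrightarrow>
           scalar c * (epath p * vtx y * gpath q) + x \<in> gspan m v"

lemma gspan_add:
  assumes "x \<in> gspan m v" "z \<in> gspan m v"
  shows "x + z \<in> gspan m v"
  using assms(1)
proof induction
  case (base x)
  from assms(2) show ?case
  proof induction
    case (base z)
    then show ?case using \<open>x \<in> P\<close> by (intro gspan.base add_mem)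
  next
    case (step z u p y q c)
    then show ?case using gspan.step[OF step.IH step.hyps(2-4), of c] by (simp add: add.left_commute)
  qed
next
  case (step x u p y q c)
  then show ?case using gspan.step[OF step.IH step.hyps(2-4), of c] by (simp add: add.assoc)
qed

lemma gspan_eqv: "x \<in> gspan m v \<Longrightarrow> z \<approx> x \<Longrightarrow> z \<in> gspan m v"
  using gspan_add[of x m v "z - x"] gspan.base[of "z - x"] by (simp add: eqv_def)

lemma gspan_mono: "x \<in> gspan m v \<Longrightarrow> m \<le> n \<Longrightarrow> x \<in> gspan n v"
proof (induction rule: gspan.induct)
  case (step x u p y q c)
  then show ?case by (intro gspan.step) auto
qed (rule gspan.base)

lemma gspan_monomial:
  "awalk u p y \<Longrightarrow> awalk v q y \<Longrightarrow> length q \<le> m \<Longrightarrow> scalar c * (epath p * vtx y * gpath q) \<in> gspan m v"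
  using gspan.step[OF gspan.base[OF zero_mem]] by simp

lemma gspan_vtx: "v \<in> verts E \<Longrightarrow> scalar c * vtx v \<in> gspan m v"
  using gspan_monomial[of v "[]" v v "[]" m c] by (simp add: awalk_Nil_iff)

text \<open>Left multiplication by a generator keeps the form of a monomial or kills it. The ghost
  part grows only when a ghost edge meets a monomial whose real part is empty.\<close>

lemma gen_monomial:
  assumes g: "g \<in> generators E" and p: "awalk u p y" and q: "awalk v q y"
  shows "gen g * (epath p * vtx y * gpath q) \<approx> 0 \<or>
    (\<exists>u' p' y' q'. awalk u' p' y' \<and> awalk v q' y' \<and> length q' \<le> Suc (length q) \<and>
       gen g * (epath p * vtx y * gpath q) \<approx> epath p' * vtx y' * gpath q')"
proof (cases g)
  case (Vertex w)
  then have w: "w \<in> verts E" using g unfolding generators_def by blast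
  have eq: "gen g * (epath p * vtx y * gpath q) = (vtx w * epath p * vtx y) * gpath q"
    by (simp add: Vertex mult.assoc)
  show ?thesis
  proof (cases "w = u")
    case True
    then have "gen g * (epath p * vtx y * gpath q) \<approx> epath p * vtx y * gpath q"
      unfolding eq using vtx_epath_vtx[OF p] by (intro eqv_rmul[where c = "gpath q"]) simp
    then show ?thesis using p q by (blast intro: le_SucI)
  next
    case False
    then show ?thesis unfolding eq using eqv_rmul[OF vtx_epath_neq[OF p w False], of "gpath q"] by simp
  qed
next
  case (Edge e)
  then have e: "e \<in> arcs E" using g unfolding generators_def by blast
  show ?thesis
  proof (cases "head E e = u")
    case True
    then have "awalk (tail E e) (e # p) y" using e p by (simp add: awalk_Cons_iff)
    moreover have "gen g * (epath p * vtx y * gpath q) \<approx> epath (e # p) * vtx y * gpath q"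
      by (simp add: Edge mult.assoc)
    ultimately show ?thesis using q by (blast intro: le_SucI)
  next
    case False
    have "gen g * (epath p * vtx y * gpath q) = edg e * (epath p * vtx y * gpath q)" by (simp add: Edge)
    also have "\<dots> \<approx> (edg e * vtx (head E e)) * (epath p * vtx y * gpath q)"
      by (rule eqv_rmul[OF eqv_sym[OF edg_vtx[OF e]]])
    also have "\<dots> = edg e * (vtx (head E e) * epath p * vtx y) * gpath q" by (simp add: mult.assoc)
    also have "\<dots> \<approx> 0" using e False by (intro eqv_zero_mid vtx_epath_neq[OF p]) auto
    finally show ?thesis ..
  qed
next
  case (Ghost e)
  then have e: "e \<in> arcs E" using g unfolding generators_def by blast
  have y: "y \<in> verts E" using awalk_last_in_verts[OF p] .
  show ?thesis
  proof (cases p)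
    case Nil
    show ?thesis
    proof (cases "tail E e = y")
      case True
      have q': "awalk v (q @ [e]) (head E e)"
        using q e True by (simp add: awalk_append_iff awalk_Cons_iff awalk_Nil_iff)
      have "gen g * (epath p * vtx y * gpath q) = gho e * vtx (tail E e) * gpath q"
        by (simp add: Ghost Nil True mult.assoc)
      also have "\<dots> \<approx> gho e * gpath q" by (rule eqv_rmul[OF gho_vtx[OF e]])
      also have "\<dots> \<approx> vtx (head E e) * gho e * gpath q" by (rule eqv_rmul[OF eqv_sym[OF vtx_gho[OF e]]])
      also have "\<dots> = epath [] * vtx (head E e) * gpath (q @ [e])" by (simp add: mult.assoc)
      finally have "gen g * (epath p * vtx y * gpath q) \<approx> epath [] * vtx (head E e) * gpath (q @ [e])" .
      moreover have "awalk (head E e) [] (head E e)" using e by (simp add: awalk_Nil_iff)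
      moreover have "length (q @ [e]) \<le> Suc (length q)" by simp
      ultimately show ?thesis using q' by blast
    next
      case False
      have "gen g * (epath p * vtx y * gpath q) = gho e * (vtx y * gpath q)" by (simp add: Ghost Nil mult.assoc)
      also have "\<dots> \<approx> (gho e * vtx (tail E e)) * (vtx y * gpath q)"
        by (rule eqv_rmul[OF eqv_sym[OF gho_vtx[OF e]]])
      also have "\<dots> = gho e * (vtx (tail E e) * vtx y) * gpath q" by (simp add: mult.assoc)
      also have "\<dots> \<approx> 0" using e y False by (intro eqv_zero_mid vtx_neq) auto
      finally show ?thesis ..
    qed
  next
    case (Cons f p1)
    note f = awalk_ConsD[OF p[unfolded Cons]]
    have eq: "gen g * (epath p * vtx y * gpath q) = 1 * (gho e * edg f) * (epath p1 * vtx y * gpath q)"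
      by (simp add: Ghost Cons mult.assoc)
    show ?thesis
    proof (cases "e = f")
      case True
      have "gen g * (epath p * vtx y * gpath q) \<approx> 1 * vtx (head E e) * (epath p1 * vtx y * gpath q)"
        unfolding eq True[symmetric] by (rule eqv_mid[OF gho_edg[OF e]])
      also have "\<dots> = (vtx (head E e) * epath p1 * vtx y) * gpath q" by (simp add: mult.assoc)
      also have "\<dots> \<approx> epath p1 * vtx y * gpath q"
        using f True by (intro eqv_rmul vtx_epath_vtx) simp
      finally show ?thesis using f q by (blast intro: le_SucI)
    next
      case False
      then show ?thesis unfolding eq using eqv_zero_mid[OF gho_edg_neq[OF e]] f by blast
    qed
  qed
qed

lemma gspan_gen:
  assumes g: "g \<in> generators E" and x: "x \<in> gspan m v"
  shows "gen g * x \<in> gspan (Suc m) v"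
  using x
proof induction
  case (base x)
  then show ?case by (intro gspan.base lmul_mem)
next
  case (step x u p y q c)
  let ?m = "epath p * vtx y * gpath q"
  have eq: "gen g * (scalar c * ?m + x) = scalar c * (gen g * ?m) + gen g * x"
    by (simp only: distrib_left scalar_left)
  have "scalar c * (gen g * ?m) \<in> gspan (Suc m) v"
  proof -
    consider "gen g * ?m \<approx> 0"
      | u' p' y' q' where "awalk u' p' y'" "awalk v q' y'" "length q' \<le> Suc (length q)"
          "gen g * ?m \<approx> epath p' * vtx y' * gpath q'"
      using gen_monomial[OF g step.hyps(2,3)] by blast
    then show ?thesis
    proof cases
      case 1
      then show ?thesis unfolding eqv_zero_iff by (rule gspan.base[OF lmul_mem])
    next
      case 2
      have "scalar c * (epath p' * vtx y' * gpath q') \<in> gspan (Suc m) v"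
        using 2 step.hyps by (intro gspan_monomial) auto
      then show ?thesis by (rule gspan_eqv) (rule eqv_lmul[OF 2(4)])
    qed
  qed
  then show ?case unfolding eq using step.IH by (rule gspan_add)
qed

lemma gspan_word:
  assumes "v \<in> verts E"
  shows "set gs \<subseteq> generators E \<Longrightarrow> Poly_Mapping.single (Word gs) c * vtx v \<in> gspan (length gs) v"
proof (induction gs)
  case Nil
  show ?case using gspan_vtx[OF assms, of c 0] by (simp add: scalar_def zero_word_def)
next
  case (Cons g gs)
  then show ?case using gspan_gen[of g "Poly_Mapping.single (Word gs) c * vtx v" "length gs" v]
    by (simp add: single_Cons mult.assoc)
qed

lemma gspan_free_algebra:
  assumes v: "v \<in> verts E"
  shows "a \<in> carrier (free_algebra E) \<Longrightarrow> \<exists>m. a * vtx v \<in> gspan m v"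
proof (induction a rule: poly_mapping_single_induct)
  case zero
  then show ?case by (auto intro: gspan.base zero_mem)
next
  case (add w c a)
  then have "a \<in> carrier (free_algebra E)" and w: "set (letters w) \<subseteq> generators E"
    using keys_single_add[OF add.hyps(1,2)] by (auto simp: free_algebra_def)
  with add.IH obtain m where m: "a * vtx v \<in> gspan m v" by blast
  let ?n = "max m (length (letters w))"
  have "Poly_Mapping.single w c * vtx v \<in> gspan ?n v"
    using gspan_mono[OF gspan_word[OF v w, of c], of ?n] by simp
  with gspan_mono[OF m, of ?n] have "(Poly_Mapping.single w c + a) * vtx v \<in> gspan ?n v"
    unfolding distrib_right by (intro gspan_add) simp_all
  then show ?case ..
qed

end

section \<open>Ideals of the Leavitt path algebra as ideals of the free algebra\<close>

context lpa_ideal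
begin

section \<open>Finite sums of vertices as local units\<close>

lemma vtx_mult_sum:
  assumes "finite Y" "Y \<subseteq> verts E" "y \<in> Y"
  shows "vtx y * (\<Sum>v\<in>Y. vtx v) \<approx> vtx y"
proof -
  have "(\<Sum>v\<in>Y. vtx y * vtx v) \<approx> (\<Sum>v\<in>Y. if y = v then vtx y else 0)"
    by (rule eqv_sum) (use assms(2,3) in \<open>auto intro: vtx_vtx vtx_neq\<close>)
  then show ?thesis using assms by (simp add: sum_distrib_left)
qed

lemma gen_right_vertex:
  assumes "g \<in> generators E"
  shows "\<exists>y \<in> verts E. gen g * vtx y \<approx> gen g"
proof (cases g)
  case (Vertex v)
  then show ?thesis using assms vtx_vtx[of v] unfolding generators_def by blast
next
  case (Edge e)
  then have e: "e \<in> arcs E" using assms unfolding generators_def by blast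
  with Edge show ?thesis using edg_vtx[OF e] head_in_verts[OF e] by blast
next
  case (Ghost e)
  then have e: "e \<in> arcs E" using assms unfolding generators_def by blast
  with Ghost show ?thesis using gho_vtx[OF e] tail_in_verts[OF e] by blast
qed

text \<open>The quantification over all larger \<open>Y'\<close> carries the induction: two summands
  need a common unit, and the union of their vertex sets provides it.\<close>

lemma right_unit_mono:
  assumes "a \<in> carrier (free_nonunital E)"
  shows "\<exists>Y. finite Y \<and> Y \<subseteq> verts E \<and>
    (\<forall>Y'. Y \<subseteq> Y' \<longrightarrow> finite Y' \<longrightarrow> Y' \<subseteq> verts E \<longrightarrow> a * (\<Sum>v\<in>Y'. vtx v) \<approx> a)"
proof -
  \<comment> \<open>Excluding the empty word is essential: it is the last letter of a word that
    absorbs a vertex.\<close>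
  have "\<forall>w \<in> Poly_Mapping.keys a. set (letters w) \<subseteq> generators E \<and> letters w \<noteq> []"
  proof
    fix w assume w: "w \<in> Poly_Mapping.keys a"
    have "letters w \<noteq> []"
    proof
      assume "letters w = []"
      then have "w = 0" by (cases w) (simp add: zero_word_def)
      then show False using w assms by (simp add: free_nonunital_def in_keys_iff)
    qed
    then show "set (letters w) \<subseteq> generators E \<and> letters w \<noteq> []"
      using w assms by (simp add: free_nonunital_def free_algebra_def)
  qed
  then show ?thesis
  proof (induction a rule: poly_mapping_single_induct)
    case zero
    show ?case by (rule exI[of _ "{}"]) simp
  next
    case (add w c a)
    have keys: "Poly_Mapping.keys (Poly_Mapping.single w c + a) = insert w (Poly_Mapping.keys a)"
      by (rule keys_single_add[OF add.hyps(1,2)])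
    then obtain Y where Y: "finite Y" "Y \<subseteq> verts E"
      "\<And>Y'. Y \<subseteq> Y' \<Longrightarrow> finite Y' \<Longrightarrow> Y' \<subseteq> verts E \<Longrightarrow> a * (\<Sum>v\<in>Y'. vtx v) \<approx> a"
      using add.IH add.prems by auto
    have w: "set (letters w) \<subseteq> generators E" "letters w \<noteq> []" using add.prems unfolding keys by auto
    then obtain gs g where gs: "letters w = gs @ [g]" by (cases "letters w" rule: rev_cases) auto
    then have w': "w = Word (gs @ [g])" by (cases w) simp
    obtain y where y: "y \<in> verts E" "gen g * vtx y \<approx> gen g"
      using gen_right_vertex[of g] w(1) unfolding gs by auto
    have "Poly_Mapping.single w c * (\<Sum>v\<in>Y'. vtx v) \<approx> Poly_Mapping.single w c"
      if Y': "insert y Y \<subseteq> Y'" "finite Y'" "Y' \<subseteq> verts E" for Y'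
    proof -
      have "gen g * (\<Sum>v\<in>Y'. vtx v) \<approx> gen g * vtx y * (\<Sum>v\<in>Y'. vtx v)"
        by (rule eqv_rmul[OF eqv_sym[OF y(2)]])
      also have "\<dots> = gen g * (vtx y * (\<Sum>v\<in>Y'. vtx v))" by (simp add: mult.assoc)
      also have "\<dots> \<approx> gen g * vtx y" by (rule eqv_lmul[OF vtx_mult_sum]) (use Y' in auto)
      also have "\<dots> \<approx> gen g" by (rule y(2))
      finally have "gen g * (\<Sum>v\<in>Y'. vtx v) \<approx> gen g" .
      from eqv_lmul[OF this] show ?thesis unfolding w' single_snoc mult.assoc .
    qed
    then have "(Poly_Mapping.single w c + a) * (\<Sum>v\<in>Y'. vtx v) \<approx> Poly_Mapping.single w c + a"
      if "insert y Y \<subseteq> Y'" "finite Y'" "Y' \<subseteq> verts E" for Y'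
      unfolding distrib_right using that Y(3)[of Y'] by (intro eqv_add) simp_all
    then show ?case using y(1) Y(1,2) by (intro exI[of _ "insert y Y"]) simp
  qed
qed

lemma right_unit:
  assumes "a \<in> carrier (free_nonunital E)"
  obtains Y where "finite Y" "Y \<subseteq> verts E" "a * (\<Sum>v\<in>Y. vtx v) \<approx> a"
  using right_unit_mono[OF assms] by blast

section \<open>From ideals of the free algebra to ideals of the Leavitt path algebra\<close>

lemma vtx_mem_free_nonunital: "v \<in> verts E \<Longrightarrow> vtx v \<in> carrier (free_nonunital E)"
  by (rule gen_in_free_nonunital) (simp add: generators_def)

lemma edg_mem_free_nonunital: "e \<in> arcs E \<Longrightarrow> edg e \<in> carrier (free_nonunital E)"
  by (rule gen_in_free_nonunital) (simp add: generators_def)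

lemma gho_mem_free_nonunital: "e \<in> arcs E \<Longrightarrow> gho e \<in> carrier (free_nonunital E)"
  by (rule gen_in_free_nonunital) (simp add: generators_def)

lemma kernel_subset: "lpa_kernel E \<subseteq> P"
proof -
  interpret F: ring "free_algebra E :: ('v, 'e, 'k) free_element ring" by (rule ring_free_algebra)
  \<comment> \<open>The kernel is a least ideal of the free algebra on the generators of
    \<open>E\<close>, so \<open>P\<close> is cut down to that algebra before minimality
    applies.\<close>
  have AS: "additive_subgroup (P \<inter> carrier (free_algebra E)) (free_algebra E :: ('v, 'e, 'k) free_element ring)"
      proof (rule F.additive_subgroupI)
        show "\<zero>\<^bsub>free_algebra E\<^esub> \<in> P \<inter> carrier (free_algebra E)"
          using zero_mem by (simp add: free_algebra_simps free_algebra_closed(1))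
        show "x \<oplus>\<^bsub>free_algebra E\<^esub> y \<in> P \<inter> carrier (free_algebra E)"
          if "x \<in> P \<inter> carrier (free_algebra E)" "y \<in> P \<inter> carrier (free_algebra E)" for x y
          using that add_mem free_algebra_closed(3)[of x E y] by (simp add: free_algebra_simps)
        show "\<ominus>\<^bsub>free_algebra E\<^esub> x \<in> P \<inter> carrier (free_algebra E)"
          if "x \<in> P \<inter> carrier (free_algebra E)" for x
          using that uminus_mem free_algebra_minus[of x E] by simp
      qed simp
  have "ideal (P \<inter> carrier (free_algebra E)) (free_algebra E :: ('v, 'e, 'k) free_element ring)"
  proof (rule idealI[OF F.ring_axioms])
    show "subgroup (P \<inter> carrier (free_algebra E)) (add_monoid (free_algebra E))"
      by (rule additive_subgroup.a_subgroup[OF AS])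
    show "x \<otimes>\<^bsub>free_algebra E\<^esub> a \<in> P \<inter> carrier (free_algebra E)"
      "a \<otimes>\<^bsub>free_algebra E\<^esub> x \<in> P \<inter> carrier (free_algebra E)"
      if "a \<in> P \<inter> carrier (free_algebra E)" "x \<in> carrier (free_algebra E)" for a x
      using that lmul_mem[of a x] rmul_mem[of a x] free_algebra_closed(5)[of x E a] free_algebra_closed(5)[of a E x]
      by (simp_all add: free_algebra_simps)
  qed
  moreover have "lpa_relations E \<subseteq> (carrier (free_algebra E) :: ('v, 'e, 'k) free_element set)"
    using lpa_relations_subset[OF wf_digraph] unfolding free_nonunital_def by auto
  ultimately show ?thesis
    unfolding lpa_kernel_def using F.genideal_minimal[of "P \<inter> carrier (free_algebra E)" "lpa_relations E"] rels_mem
    by blast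
qed

lemma class_mem_image_iff:
  assumes "a \<in> carrier (free_nonunital E)"
  shows "lpa_class E a \<in> lpa_class E ` (P \<inter> carrier (free_nonunital E)) \<longleftrightarrow> a \<in> P"
proof
  assume "lpa_class E a \<in> lpa_class E ` (P \<inter> carrier (free_nonunital E))"
  then obtain b where b: "b \<in> P" "b \<in> carrier (free_nonunital E)" "lpa_class E a = lpa_class E b" by blast
  then have "a - b \<in> P" using lpa_ops(4)[OF wf_digraph assms b(2)] kernel_subset by blast
  then show "a \<in> P" using add_mem[OF _ b(1)] by fastforce
qed (use assms in blast)

lemma two_sided_ideal_image:
  "two_sided_ideal (lpa_class E ` (P \<inter> carrier (free_nonunital E))) (leavitt_path_algebra E)"
proof -
  interpret L: nonunital_ring "leavitt_path_algebra E :: ('v, 'e, 'k) lpa"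
    by (rule nonunital_ring_lpa[OF wf_digraph])
  have zero: "\<zero>\<^bsub>leavitt_path_algebra E\<^esub> = lpa_class E (0 :: ('v, 'e, 'k) free_element)"
    by (rule lpa_ops(3)[OF wf_digraph free_nonunital_closed(1) free_nonunital_closed(1)])
  note ops = lpa_ops(1,2)[OF wf_digraph] zero
  let ?C = "carrier (free_nonunital E) :: ('v, 'e, 'k) free_element set"
  have img: "lpa_class E a \<in> lpa_class E ` (P \<inter> ?C)" if "a \<in> P" "a \<in> ?C" for a
    using that by blast
  show ?thesis
  proof (rule L.two_sided_idealI)
    show "lpa_class E ` (P \<inter> ?C) \<subseteq> carrier (leavitt_path_algebra E)"
      unfolding lpa_carrier by blast
    show "\<zero>\<^bsub>leavitt_path_algebra E\<^esub> \<in> lpa_class E ` (P \<inter> ?C)"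
      unfolding ops(3) by (rule img[OF zero_mem free_nonunital_closed(1)])
    fix x assume "x \<in> lpa_class E ` (P \<inter> ?C)"
    then obtain a where a: "a \<in> P" "a \<in> ?C" "x = lpa_class E a" by blast
    have "lpa_class E a \<oplus>\<^bsub>leavitt_path_algebra E\<^esub> lpa_class E (- a) = \<zero>\<^bsub>leavitt_path_algebra E\<^esub>"
      using ops(1)[OF a(2) free_nonunital_closed(3)[OF a(2)]] ops(3) by simp
    then have "\<ominus>\<^bsub>leavitt_path_algebra E\<^esub> x = lpa_class E (- a)"
      using a(2) free_nonunital_closed(3)[OF a(2)] L.minus_equality[of "lpa_class E (- a)" x]
      unfolding lpa_carrier a(3) by (metis L.a_comm image_eqI lpa_carrier)
    then show "\<ominus>\<^bsub>leavitt_path_algebra E\<^esub> x \<in> lpa_class E ` (P \<inter> ?C)"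
      using img[OF uminus_mem[OF a(1)] free_nonunital_closed(3)[OF a(2)]] by simp
    show "x \<oplus>\<^bsub>leavitt_path_algebra E\<^esub> y \<in> lpa_class E ` (P \<inter> ?C)"
      if y: "y \<in> lpa_class E ` (P \<inter> ?C)" for y
    proof -
      obtain b where b: "b \<in> P" "b \<in> ?C" "y = lpa_class E b" using y by blast
      show ?thesis unfolding a(3) b(3) ops(1)[OF a(2) b(2)]
        by (rule img[OF add_mem[OF a(1) b(1)] free_nonunital_closed(2)[OF a(2) b(2)]])
    qed
    fix y assume "y \<in> carrier (leavitt_path_algebra E :: ('v, 'e, 'k) lpa)"
    then obtain b where b: "b \<in> ?C" "y = lpa_class E b" unfolding lpa_carrier by blast
    show "y \<otimes>\<^bsub>leavitt_path_algebra E\<^esub> x \<in> lpa_class E ` (P \<inter> ?C)"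
      unfolding a(3) b(2) ops(2)[OF b(1) a(2)]
      by (rule img[OF lmul_mem[OF a(1)] free_nonunital_closed(5)[OF b(1) a(2)]])
    show "x \<otimes>\<^bsub>leavitt_path_algebra E\<^esub> y \<in> lpa_class E ` (P \<inter> ?C)"
      unfolding a(3) b(2) ops(2)[OF a(2) b(1)]
      by (rule img[OF rmul_mem[OF a(1)] free_nonunital_closed(5)[OF a(2) b(1)]])
  qed
qed

end

text \<open>
  Ideals of the free algebra on the generators of \<open>E\<close> are enlarged to ideals of the whole type by the
  elements all of whose words contain a foreign generator. This spares all carrier conditions.
\<close>

definition junk :: "('v, 'e) pre_digraph \<Rightarrow> ('v, 'e, 'k::field) free_element set" where
  "junk E = {a. \<forall>w \<in> Poly_Mapping.keys a. \<not> set (letters w) \<subseteq> generators E}"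

lemma junk_zero: "0 \<in> junk E" by (simp add: junk_def)

lemma junk_add: "a \<in> junk E \<Longrightarrow> b \<in> junk E \<Longrightarrow> a + b \<in> junk E"
  using Poly_Mapping.keys_add[of a b] unfolding junk_def by blast

lemma junk_mult:
  assumes "a \<in> junk E \<or> b \<in> junk E"
  shows "a * b \<in> junk E"
  unfolding junk_def
proof (intro CollectI ballI notI)
  fix w assume "w \<in> Poly_Mapping.keys (a * b)" and w: "set (letters w) \<subseteq> generators E"
  then obtain u u' where u: "w = u + u'" "u \<in> Poly_Mapping.keys a" "u' \<in> Poly_Mapping.keys b"
    using keys_mult[of a b] by blast
  then have "set (letters u) \<subseteq> generators E" "set (letters u') \<subseteq> generators E" using w by simp_all
  then show False using assms u by (auto simp: junk_def)
qed

lemma junk_free_algebra: "a \<in> junk E \<Longrightarrow> a \<in> carrier (free_algebra E) \<Longrightarrow> a = 0"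
  unfolding junk_def free_algebra_def by (metis (mono_tags, lifting) all_not_in_conv keys_eq_empty
      mem_Collect_eq partial_object.select_convs(1))

lemma junk_decompose: "\<exists>c \<in> carrier (free_algebra E). a - c \<in> junk E"
proof (induction a rule: poly_mapping_single_induct)
  case zero
  show ?case using free_algebra_closed(1) junk_zero by force
next
  case (add w d a)
  then obtain c where c: "c \<in> carrier (free_algebra E)" "a - c \<in> junk E" by blast
  show ?case
  proof (cases "set (letters w) \<subseteq> generators E")
    case True
    then have "Poly_Mapping.single w d \<in> carrier (free_algebra E)" by (simp add: free_algebra_def)
    then show ?thesis using c free_algebra_closed(3)
      by (intro bexI[of _ "Poly_Mapping.single w d + c"]) simp_all
  next
    case False
    then have "Poly_Mapping.single w d \<in> junk E" by (simp add: junk_def)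
    from junk_add[OF this c(2)] show ?thesis using c(1) by (intro bexI[of _ c]) (simp_all add: algebra_simps)
  qed
qed

definition extend :: "('v, 'e) pre_digraph \<Rightarrow> ('v, 'e, 'k::field) free_element set \<Rightarrow> ('v, 'e, 'k) free_element set" where
  "extend E B = {a. \<exists>b \<in> B. a - b \<in> junk E}"

text \<open>The enlargement adds nothing inside the free algebra on the generators of
  \<open>E\<close>, because \<open>junk E\<close> meets it only in zero.\<close>

lemma extend_mem_iff:
  assumes "B \<subseteq> carrier (free_algebra E)" "a \<in> carrier (free_algebra E)"
  shows "a \<in> extend E B \<longleftrightarrow> a \<in> B"
proof
  assume "a \<in> extend E B"
  then obtain b where b: "b \<in> B" "a - b \<in> junk E" by (auto simp: extend_def)
  have "a + - b \<in> carrier (free_algebra E)"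
    using assms b free_algebra_closed(3,4) by blast
  then show "a \<in> B" using junk_free_algebra[OF b(2)] b(1) by simp
next
  show "a \<in> B \<Longrightarrow> a \<in> extend E B" using junk_zero by (force simp: extend_def)
qed

lemma lpa_ideal_extend:
  fixes B :: "('v, 'e, 'k::field) free_element set"
  assumes "wf_digraph E" "B \<subseteq> carrier (free_algebra E)" "lpa_relations E \<subseteq> B"
    and "0 \<in> B" "\<And>x y. x \<in> B \<Longrightarrow> y \<in> B \<Longrightarrow> x + y \<in> B"
    and "\<And>c x. c \<in> carrier (free_algebra E) \<Longrightarrow> x \<in> B \<Longrightarrow> c * x \<in> B"
    and "\<And>c x. c \<in> carrier (free_algebra E) \<Longrightarrow> x \<in> B \<Longrightarrow> x * c \<in> B"
  shows "lpa_ideal E (extend E B)"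
proof (intro lpa_ideal.intro lpa_ideal_axioms.intro)
  show "0 \<in> extend E B" using assms(4) junk_zero by (force simp: extend_def)
  show "lpa_relations E \<subseteq> extend E B" using assms(3) junk_zero by (force simp: extend_def)
  show "x + y \<in> extend E B" if xy: "x \<in> extend E B" "y \<in> extend E B" for x y
  proof -
    obtain b b' where b: "b \<in> B" "x - b \<in> junk E" "b' \<in> B" "y - b' \<in> junk E"
      using xy by (auto simp: extend_def)
    have "x + y - (b + b') = (x - b) + (y - b')" by (simp add: algebra_simps)
    also have "\<dots> \<in> junk E" by (rule junk_add[OF b(2,4)])
    finally show ?thesis using assms(5)[OF b(1,3)] by (auto simp: extend_def)
  qed
  fix x a :: "('v, 'e, 'k) free_element" assume "x \<in> extend E B"
  then obtain b where b: "b \<in> B" "x - b \<in> junk E" by (auto simp: extend_def)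
  obtain c where c: "c \<in> carrier (free_algebra E)" "a - c \<in> junk E" using junk_decompose by blast
  \<comment> \<open>Both factors are replaced by their parts over the generators of
    \<open>E\<close>; each error term has a factor in \<open>junk E\<close>.\<close>
  have "a * x - c * b = c * (x - b) + (a - c) * x" by (simp add: algebra_simps)
  also have "\<dots> \<in> junk E" by (intro junk_add junk_mult) (simp_all add: b c)
  finally show "a * x \<in> extend E B" using assms(6)[OF c(1) b(1)] by (auto simp: extend_def)
  have "x * a - b * c = (x - b) * c + x * (a - c)" by (simp add: algebra_simps)
  also have "\<dots> \<in> junk E" by (intro junk_add junk_mult) (simp_all add: b c)
  finally show "x * a \<in> extend E B" using assms(7)[OF c(1) b(1)] by (auto simp: extend_def)
qed (rule assms(1))

section \<open>Preimages of ideals of the Leavitt path algebra\<close>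

definition full :: "('v, 'e) pre_digraph \<Rightarrow> ('v, 'e, 'k::field) free_element set set \<Rightarrow> ('v, 'e, 'k) free_element set" where
  "full E I = extend E {b \<in> carrier (free_nonunital E). lpa_class E b \<in> I}"

lemma free_nonunital_subset: "carrier (free_nonunital E) \<subseteq> carrier (free_algebra E)"
  by (auto simp: free_nonunital_def)

lemma full_mem_iff:
  "a \<in> carrier (free_nonunital E) \<Longrightarrow> a \<in> full E I \<longleftrightarrow> lpa_class E a \<in> I"
  using free_nonunital_subset unfolding full_def by (subst extend_mem_iff) auto

lemma free_nonunital_mult:
  fixes c x :: "('v, 'e, 'k::field) free_element"
  assumes "c \<in> carrier (free_algebra E)" "x \<in> carrier (free_nonunital E)"
  shows "c * x \<in> carrier (free_nonunital E)" "x * c \<in> carrier (free_nonunital E)"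
  using assms free_algebra_closed(5)[of c E x] free_algebra_closed(5)[of x E c] lookup_mult_zero_word[of c x]
    lookup_mult_zero_word[of x c]
  by (simp_all add: free_nonunital_def)

lemma lpa_ideal_kernel: 
  assumes "wf_digraph E"
  shows "lpa_ideal E (extend E (lpa_kernel E :: ('v, 'e, 'k::field) free_element set))"
proof -
  interpret K: ideal "lpa_kernel E" "free_algebra E :: ('v, 'e, 'k) free_element ring"
    by (rule ideal_lpa_kernel[OF assms])
  show ?thesis
    by (rule lpa_ideal_extend[OF assms K.a_subset ideal_lpa_kernel(3)[OF assms]])
       (use K.I_l_closed K.I_r_closed additive_subgroup.a_closed[OF K.is_additive_subgroup] additive_subgroup.zero_closed[OF K.is_additive_subgroup]
         in \<open>simp_all add: free_algebra_simps\<close>)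
qed

text \<open>Local units are first found modulo the kernel of the presentation: the proof that
  \<open>full E I\<close> is an ideal already uses them to let scalars act on
  \<open>I\<close>.\<close>

lemma right_unit_kernel:
  fixes a :: "('v, 'e, 'k::field) free_element"
  assumes "wf_digraph E" "a \<in> carrier (free_nonunital E)"
  obtains u where "u \<in> carrier (free_nonunital E)" "a * u - a \<in> lpa_kernel E"
proof -
  interpret lpa_ideal E "extend E (lpa_kernel E) :: ('v, 'e, 'k) free_element set"
    by (rule lpa_ideal_kernel[OF assms(1)])
  obtain Y where Y: "finite Y" "Y \<subseteq> verts E" "eqv (a * (\<Sum>v\<in>Y. vtx v)) a" using right_unit[OF assms(2)] .
  have u: "(\<Sum>v\<in>Y. vtx v) \<in> (carrier (free_nonunital E) :: ('v, 'e, 'k) free_element set)"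
    using Y(1,2) by (induction Y rule: finite_induct)
      (simp_all add: free_nonunital_closed(1) free_nonunital_closed(2) vtx_mem_free_nonunital)
  have "a * (\<Sum>v\<in>Y. vtx v) - a \<in> carrier (free_nonunital E)"
    using free_nonunital_closed(4,5) assms(2) u by blast
  then have "a * (\<Sum>v\<in>Y. vtx v) - a \<in> lpa_kernel E"
    using Y(3) free_nonunital_subset ideal_lpa_kernel(2)[OF assms(1)] unfolding eqv_def
    by (subst (asm) extend_mem_iff) auto
  then show ?thesis by (rule that[OF u])
qed

lemma lpa_ideal_full:
  fixes I :: "('v, 'e, 'k::field) free_element set set"
  assumes wf: "wf_digraph E" and I: "two_sided_ideal I (leavitt_path_algebra E)"
  shows "lpa_ideal E (full E I)"
proof -
  interpret L: nonunital_ring "leavitt_path_algebra E :: ('v, 'e, 'k) lpa"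
    by (rule nonunital_ring_lpa[OF wf])
  note ID = L.two_sided_idealD[OF I]
  have zero: "\<zero>\<^bsub>leavitt_path_algebra E\<^esub> = lpa_class E (0 :: ('v, 'e, 'k) free_element)"
    by (rule lpa_ops(3)[OF wf free_nonunital_closed(1) free_nonunital_closed(1)])
  note ops = lpa_ops(1,2)[OF wf] zero
  let ?C = "carrier (free_nonunital E) :: ('v, 'e, 'k) free_element set"
  let ?B = "{b \<in> ?C. lpa_class E b \<in> I}"
  have cls: "lpa_class E b \<in> carrier (leavitt_path_algebra E)" if "b \<in> ?C" for b
    using that unfolding lpa_carrier by blast
  have add: "x + y \<in> ?B" if "x \<in> ?B" "y \<in> ?B" for x y
    using that ID(3)[of "lpa_class E x" "lpa_class E y"] ops(1)[of x y] free_nonunital_closed(2)[of x E y] by simp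
  have mul: "c * x \<in> ?B" "x * c \<in> ?B" if "c \<in> ?C" "x \<in> ?B" for c x
    using that ID(6,7)[OF cls[OF that(1)], of "lpa_class E x"] ops(2)[of x c] ops(2)[of c x]
      free_nonunital_closed(5)[of x E c] free_nonunital_closed(5)[of c E x] by simp_all
  \<comment> \<open>\<open>I\<close> is only an ideal of a ring; it admits scalars because there are local units.\<close>
  have sc: "scalar d * x \<in> ?B" if x: "x \<in> ?B" for d x
  proof -
    have xC: "x \<in> ?C" using x by simp
    obtain u where u: "u \<in> ?C" "x * u - x \<in> lpa_kernel E" using right_unit_kernel[OF wf xC] .
    have s: "scalar d \<in> (carrier (free_algebra E) :: ('v, 'e, 'k) free_element set)"
      by (auto simp: scalar_def free_algebra_def)
    interpret K: ideal "lpa_kernel E" "free_algebra E :: ('v, 'e, 'k) free_element ring"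
      by (rule ideal_lpa_kernel[OF wf])
    have su: "scalar d * u \<in> ?C" using free_nonunital_mult[OF s u(1)] by simp
    have sx: "scalar d * x \<in> ?C" using free_nonunital_mult[OF s xC] by simp
    have "scalar d * (x * u - x) \<in> lpa_kernel E"
      using K.I_l_closed[OF u(2) s] by (simp add: free_algebra_simps)
    then have "x * (scalar d * u) - scalar d * x \<in> lpa_kernel E"
      by (simp add: scalar_left right_diff_distrib)
    then have "lpa_class E (x * (scalar d * u)) = lpa_class E (scalar d * x)"
      using lpa_ops(4)[OF wf free_nonunital_closed(5)[OF xC su] sx] by blast
    then show ?thesis using mul(2)[OF su x] sx by simp
  qed
  \<comment> \<open>A multiplier from the unital free algebra splits into its constant term, which
    is a scalar, and an element without constant term.\<close>
  have split: "c - scalar (Poly_Mapping.lookup c 0) \<in> ?C"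
    if "c \<in> carrier (free_algebra E)" for c :: "('v, 'e, 'k) free_element"
  proof -
    have "scalar d \<in> (carrier (free_algebra E) :: ('v, 'e, 'k) free_element set)" for d
      by (auto simp: scalar_def free_algebra_def)
    then have "c + - scalar (Poly_Mapping.lookup c 0) \<in> carrier (free_algebra E)"
      using that free_algebra_closed(3,4) by blast
    then show ?thesis by (simp add: free_nonunital_def scalar_def lookup_minus)
  qed
  show ?thesis
    unfolding full_def
  proof (rule lpa_ideal_extend[OF wf])
    show "?B \<subseteq> carrier (free_algebra E)" using free_nonunital_subset by blast
    show "lpa_relations E \<subseteq> ?B"
    proof
      fix r :: "('v, 'e, 'k) free_element" assume r: "r \<in> lpa_relations E"
      then have rC: "r \<in> ?C" using lpa_relations_subset[OF wf] by blast
      have "r - 0 \<in> lpa_kernel E" using r ideal_lpa_kernel(3)[OF wf] by auto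
      then have "lpa_class E r = \<zero>\<^bsub>leavitt_path_algebra E\<^esub>"
        using lpa_ops(4)[OF wf rC free_nonunital_closed(1)] ops(3) by simp
      then show "r \<in> ?B" using rC ID(2) by simp
    qed
    show "0 \<in> ?B" using ID(2) ops(3) free_nonunital_closed(1) by simp
    fix c x :: "('v, 'e, 'k) free_element" assume c: "c \<in> carrier (free_algebra E)" and x: "x \<in> ?B"
    let ?d = "Poly_Mapping.lookup c 0"
    have "(c - scalar ?d) * x + scalar ?d * x \<in> ?B"
      by (rule add[OF mul(1)[OF split[OF c] x] sc[OF x]])
    then show "c * x \<in> ?B" by (simp only: left_diff_distrib diff_add_cancel)
    have "x * (c - scalar ?d) + scalar ?d * x \<in> ?B"
      by (rule add[OF mul(2)[OF split[OF c] x] sc[OF x]])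
    then show "x * c \<in> ?B" by (simp only: right_diff_distrib diff_add_cancel scalar_commute)
  qed (rule add)
qed

section \<open>Real paths, closed paths and gap vertices\<close>

definition gap :: "('v, 'e) pre_digraph \<Rightarrow> 'v set \<Rightarrow> 'v \<Rightarrow> ('v, 'e, 'k::field) free_element" where
  "gap E H v = vtx v - (\<Sum>e \<in> arcs_avoiding E H v. edg e * gho e)"

lemma lpa_gap_vertex_conv: "lpa_gap_vertex E H v = lpa_class E (gap E H v)"
  by (simp add: lpa_gap_vertex_def gap_def)

lemma append_eq_append_prefix:
  assumes "xs @ ys = zs @ ts"
  shows "(\<exists>us. xs = zs @ us) \<or> (\<exists>us. us \<noteq> [] \<and> zs = xs @ us)"
proof -
  obtain us where "xs = zs @ us \<and> us @ ys = ts \<or> xs @ us = zs \<and> ys = us @ ts"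
    using assms unfolding append_eq_append_conv2 by blast
  then show ?thesis by (cases "us = []") auto
qed

context wf_digraph
begin

lemma awalk_append_tail: "awalk u p v \<Longrightarrow> awalk u (p @ q) w \<Longrightarrow> awalk v q w"
proof (induction p arbitrary: u)
  case (Cons e p)
  then show ?case using Cons.IH[of "head G e"] by (simp add: awalk_Cons_iff del: awalk_append_iff)
qed (simp add: awalk_Nil_iff)

definition real_paths :: "'a \<Rightarrow> (('a, 'b) generator word \<Rightarrow>\<^sub>0 'k::field) \<Rightarrow> bool" where
  "real_paths v x \<longleftrightarrow> (\<forall>w \<in> Poly_Mapping.keys x. \<exists>p u. w = Word (map Edge p) \<and> awalk u p v)"

definition closed_paths :: "'a \<Rightarrow> (('a, 'b) generator word \<Rightarrow>\<^sub>0 'k::field) \<Rightarrow> bool" where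
  "closed_paths v x \<longleftrightarrow>
     (\<forall>w \<in> Poly_Mapping.keys x. \<exists>p. w = Word (map Edge p) \<and> p \<noteq> [] \<and> awalk v p v)"

text \<open>A closed simple path returns to its base only at its end, whereas the first edge of
  \<open>t\<close> would leave from the base again.\<close>

lemma closed_simple_path_no_prefix:
  assumes "closed_simple_path G v (p @ t)" "p \<noteq> []" "t \<noteq> []" "awalk v p v"
  shows False
proof -
  have w: "awalk v (p @ t) v" and d: "\<forall>e \<in> set (tl (p @ t)). tail G e \<noteq> tail G (hd (p @ t))"
    using assms(1) by (simp_all add: closed_simple_path_def closed_path_def)
  have t: "awalk v t v" by (rule awalk_append_tail[OF assms(4) w])
  have "tail G (hd t) = v" using t assms(3) by (cases t) (simp_all add: awalk_Cons_iff)
  moreover have "tail G (hd (p @ t)) = v"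
    using assms(2,4) by (cases p) (simp_all add: awalk_Cons_iff)
  moreover have "hd t \<in> set (tl (p @ t))" using assms(2,3) by (cases p) simp_all
  ultimately show False using d by metis
qed

text \<open>A closed path starts with one closed simple path only, and Condition (K) offers another one.\<close>

lemma condition_K_incomparable:
  assumes K: "condition_K G" and p: "awalk v p v" "p \<noteq> []"
  obtains q where "q \<noteq> []" "awalk v q v" "\<nexists>r. p @ q = q @ r"
proof -
  have v: "v \<in> verts G" using p(1) by (rule awalk_hd_in_verts)
  have "closed_path G v p" using p by (simp add: closed_path_def)
  then obtain s t where st: "s \<noteq> t" "closed_simple_path G v s" "closed_simple_path G v t"
    using K v unfolding condition_K_def by blast
  have csD: "q \<noteq> []" "awalk v q v" if "closed_simple_path G v q" for q
    using that by (simp_all add: closed_simple_path_def closed_path_def)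
  \<comment> \<open>Both \<open>p\<close> and \<open>q\<close> are prefixes of one word. If
    \<open>q\<close> were the longer one, it would be a closed simple path with a proper closed
    prefix.\<close>
  have pre: "\<exists>r. p = q @ r" if q: "closed_simple_path G v q" and r: "p @ q = q @ r" for q r
  proof -
    have "(\<exists>r'. p = q @ r') \<or> (\<exists>r'. r' \<noteq> [] \<and> q = p @ r')"
      by (rule append_eq_append_prefix[OF r])
    then show ?thesis
    proof
      assume "\<exists>r'. r' \<noteq> [] \<and> q = p @ r'"
      then obtain r' where r': "r' \<noteq> []" "q = p @ r'" by blast
      show ?thesis using closed_simple_path_no_prefix[OF q[unfolded r'(2)] p(2) r'(1) p(1)] by blast
    qed
  qed
  have "(\<nexists>r. p @ s = s @ r) \<or> (\<nexists>r. p @ t = t @ r)"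
  proof (rule ccontr)
    assume "\<not> ?thesis"
    then obtain r1 r2 where "p = s @ r1" "p = t @ r2" using pre[OF st(2)] pre[OF st(3)] by blast
    then have eq: "s @ r1 = t @ r2" by simp
    have no: False if "a \<noteq> []" "x = y @ a" "closed_simple_path G v x" "closed_simple_path G v y" for a x y
      using closed_simple_path_no_prefix[OF that(3)[unfolded that(2)] csD(1)[OF that(4)] that(1) csD(2)[OF that(4)]] .
    from append_eq_append_prefix[OF eq] show False
    proof
      assume "\<exists>us. s = t @ us"
      then obtain us where us: "s = t @ us" by blast
      then have "us \<noteq> []" using st(1) by auto
      then show False using no us st(2,3) by blast
    next
      assume "\<exists>us. us \<noteq> [] \<and> t = s @ us"
      then show False using no st(2,3) by blast
    qed
  qed
  then show ?thesis using that csD[OF st(2)] csD[OF st(3)] by blast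
qed

end

section \<open>Removing closed paths with Condition (K)\<close>

context lpa_ideal
begin

lemma head_mem: "e \<in> arcs E \<Longrightarrow> vtx (tail E e) \<in> P \<Longrightarrow> vtx (head E e) \<in> P"
proof -
  assume e: "e \<in> arcs E" and t: "vtx (tail E e) \<in> P"
  have "edg e \<in> P" using eqv_mem_iff[OF vtx_edg[OF e]] rmul_mem[OF t, of "edg e"] by blast
  then have "gho e * edg e \<in> P" by (rule lmul_mem)
  then show ?thesis using eqv_mem_iff[OF gho_edg[OF e]] by blast
qed

lemma awalk_mem: "awalk u p v \<Longrightarrow> vtx u \<in> P \<Longrightarrow> vtx v \<in> P"
proof (induction p arbitrary: u)
  case Nil
  then show ?case by (simp add: awalk_Nil_iff)
next
  case (Cons e p)
  note e = awalk_ConsD[OF Cons.prems(1)]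
  then have "vtx (head E e) \<in> P" using head_mem Cons.prems(2) by blast
  with Cons.IH e show ?case by blast
qed

lemma edg_mem: "e \<in> arcs E \<Longrightarrow> vtx (head E e) \<in> P \<Longrightarrow> edg e \<in> P"
  using eqv_mem_iff[OF edg_vtx, of e] lmul_mem[of "vtx (head E e)" "edg e"] by blast

text \<open>Applied to multiplications \<open>A\<close>, \<open>B\<close> that turn every word of
  \<open>x\<close> into zero or a closed path. Words may vanish or merge, so their number does not
  grow; this feeds the induction in \<open>closed_vertex_mem\<close>.\<close>

lemma closed_paths_compress:
  assumes "\<And>w. w \<in> Poly_Mapping.keys x \<Longrightarrow> A * Poly_Mapping.single w 1 * B \<approx> 0 \<or>
     (\<exists>r. r \<noteq> [] \<and> awalk v r v \<and> A * Poly_Mapping.single w 1 * B \<approx> epath r * vtx v)"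
  shows "\<exists>y. closed_paths v y \<and> card (Poly_Mapping.keys y) \<le> card (Poly_Mapping.keys x) \<and>
     A * x * B \<approx> y * vtx v"
  using assms
proof (induction x rule: poly_mapping_single_induct)
  case zero
  then show ?case by (intro exI[of _ 0]) (simp add: closed_paths_def)
next
  case (add w c x)
  have keys: "Poly_Mapping.keys (Poly_Mapping.single w c + x) = insert w (Poly_Mapping.keys x)"
    by (rule keys_single_add[OF add.hyps(1,2)])
  then have card: "card (Poly_Mapping.keys (Poly_Mapping.single w c + x)) = Suc (card (Poly_Mapping.keys x))"
    using add.hyps(1) by simp
  have "\<exists>y. closed_paths v y \<and> card (Poly_Mapping.keys y) \<le> card (Poly_Mapping.keys x) \<and>
     A * x * B \<approx> y * vtx v"
    by (rule add.IH) (rule add.prems, simp add: keys)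
  then obtain y where y: "closed_paths v y" "card (Poly_Mapping.keys y) \<le> card (Poly_Mapping.keys x)"
    "A * x * B \<approx> y * vtx v" by blast
  have eq: "A * (Poly_Mapping.single w c + x) * B = scalar c * (A * Poly_Mapping.single w 1 * B) + A * x * B"
    by (simp only: single_conv_scalar[of w c] distrib_left distrib_right scalar_left mult.assoc)
  consider "A * Poly_Mapping.single w 1 * B \<approx> 0"
    | r where "r \<noteq> []" "awalk v r v" "A * Poly_Mapping.single w 1 * B \<approx> epath r * vtx v"
    using add.prems[of w] by (auto simp: keys)
  then show ?case
  proof cases
    case 1
    have "A * (Poly_Mapping.single w c + x) * B \<approx> scalar c * 0 + y * vtx v"
      unfolding eq by (intro eqv_add eqv_lmul 1 y(3))
    then show ?thesis using y(1,2) card by (intro exI[of _ y]) simp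
  next
    case 2
    let ?z = "Poly_Mapping.single (Word (map Edge r)) c + y"
    have "A * (Poly_Mapping.single w c + x) * B \<approx> scalar c * (epath r * vtx v) + y * vtx v"
      unfolding eq by (intro eqv_add eqv_lmul 2(3) y(3))
    also have "\<dots> = ?z * vtx v" by (simp add: single_edges distrib_right mult.assoc)
    finally have "A * (Poly_Mapping.single w c + x) * B \<approx> ?z * vtx v" .
    moreover have sub: "Poly_Mapping.keys ?z \<subseteq> insert (Word (map Edge r)) (Poly_Mapping.keys y)"
      using Poly_Mapping.keys_add[of "Poly_Mapping.single (Word (map Edge r)) c" y] by (auto split: if_splits)
    moreover have "closed_paths v ?z" using sub y(1) 2(1,2) unfolding closed_paths_def by blast
    moreover have "card (Poly_Mapping.keys ?z) \<le> Suc (card (Poly_Mapping.keys y))"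
      using card_mono[OF _ sub] by (simp add: card_insert_if split: if_splits)
    ultimately show ?thesis using y(2) card by (intro exI[of _ ?z]) simp
  qed
qed

lemma keys_split:
  fixes x :: "('v, 'e, 'k) free_element"
  assumes "w \<in> Poly_Mapping.keys x"
  obtains x' where "x = Poly_Mapping.single w (Poly_Mapping.lookup x w) + x'"
    "Poly_Mapping.keys x' = Poly_Mapping.keys x - {w}"
proof
  let ?x' = "x - Poly_Mapping.single w (Poly_Mapping.lookup x w)"
  show "x = Poly_Mapping.single w (Poly_Mapping.lookup x w) + ?x'" by simp
  show "Poly_Mapping.keys ?x' = Poly_Mapping.keys x - {w}"
    by (auto simp: in_keys_iff lookup_minus lookup_single when_def split: if_splits)
qed

text \<open>Induction on the number of closed paths in \<open>y\<close>. For one of them,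
  \<open>p\<close>, Condition (K) gives a closed path \<open>q\<close> such that \<open>q\<close> is
  no prefix of \<open>p @ q\<close>. Then \<open>q\<^sup>* (c + y) q\<close> keeps
  \<open>c v\<close>, loses the term of \<open>p\<close>, and turns every other term into zero or a
  nonempty closed path.\<close>

lemma closed_vertex_mem:
  assumes K: "condition_K E" and v: "v \<in> verts E"
  shows "closed_paths v y \<Longrightarrow> c \<noteq> 0 \<Longrightarrow> (scalar c + y) * vtx v \<in> P \<Longrightarrow> vtx v \<in> P"
proof (induction "card (Poly_Mapping.keys y)" arbitrary: y rule: less_induct)
  case less
  show ?case
  proof (cases "Poly_Mapping.keys y = {}")
    case True
    then have "y = 0" by simp
    then show ?thesis using less.prems scalar_mem_cancel by simp
  next
    case False
    then obtain w where w: "w \<in> Poly_Mapping.keys y" by blast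
    then obtain p where p: "w = Word (map Edge p)" "p \<noteq> []" "awalk v p v"
      using less.prems(1) unfolding closed_paths_def by blast
    obtain q where q: "q \<noteq> []" "awalk v q v" "\<nexists>r. p @ q = q @ r"
      using condition_K_incomparable[OF K p(3,2)] .
    obtain y0 where y0: "y = Poly_Mapping.single w (Poly_Mapping.lookup y w) + y0"
      "Poly_Mapping.keys y0 = Poly_Mapping.keys y - {w}" using keys_split[OF w] .
    define A :: "('v, 'e, 'k) free_element" where "A = vtx v * gpath q"
    define B :: "('v, 'e, 'k) free_element" where "B = vtx v * epath q * vtx v"
    have conj: "A * Poly_Mapping.single (Word (map Edge r)) 1 * B \<approx> 0 \<and> (\<nexists>t. r @ q = q @ t) \<or>
        (\<exists>t. r @ q = q @ t \<and> awalk v t v \<and> A * Poly_Mapping.single (Word (map Edge r)) 1 * B \<approx> epath t * vtx v)"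
      if r: "awalk v r v" for r
    proof -
      have "A * Poly_Mapping.single (Word (map Edge r)) 1 * B = vtx v * gpath q * epath r * (vtx v * epath q * vtx v)"
        by (simp add: A_def B_def single_edges mult.assoc)
      also have "\<dots> \<approx> vtx v * gpath q * epath r * (epath q * vtx v)"
        by (rule eqv_lmul[OF vtx_epath_vtx[OF q(2)]])
      also have "\<dots> = vtx v * gpath q * epath (r @ q) * vtx v" by (simp add: mult.assoc)
      finally have e: "A * Poly_Mapping.single (Word (map Edge r)) 1 * B \<approx> vtx v * gpath q * epath (r @ q) * vtx v" .
      have rq: "awalk v (r @ q) v" using r q(2) by (rule awalk_appendI)
      have "length q \<le> length (r @ q)" by simp
      from gpath_epath_compare[OF q(2) rq this] show ?thesis
      proof
        assume z: "vtx v * gpath q * epath (r @ q) * vtx v \<approx> 0"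
        \<comment> \<open>A product in \<open>P\<close> does not show that \<open>q\<close> is no
          prefix of \<open>r @ q\<close>. If it is a prefix, the product is computed directly, so
          that the first alternative of the claim always excludes a prefix.\<close>
        show ?thesis
        proof (cases "\<exists>t. r @ q = q @ t")
          case True
          then obtain t where t: "r @ q = q @ t" by blast
          have tw: "awalk v t v" by (rule awalk_append_tail[OF q(2) rq[unfolded t]])
          have "vtx v * gpath q * epath (q @ t) * vtx v = (vtx v * gpath q * epath q) * (epath t * vtx v)" 
            by (simp add: mult.assoc)
          also have "\<dots> \<approx> (vtx v * gpath q * epath q) * (vtx v * epath t)"
            by (rule eqv_lmul[OF eqv_sym[OF vtx_epath[OF tw]]])
          also have "\<dots> = (vtx v * gpath q * epath q * vtx v) * epath t" by (simp add: mult.assoc)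
          also have "\<dots> \<approx> vtx v * epath t" by (rule eqv_rmul[OF gpath_epath_self[OF q(2)]])
          also have "\<dots> \<approx> epath t * vtx v" by (rule vtx_epath[OF tw])
          finally have "vtx v * gpath q * epath (r @ q) * vtx v \<approx> epath t * vtx v" unfolding t .
          then have "A * Poly_Mapping.single (Word (map Edge r)) 1 * B \<approx> epath t * vtx v"
            by (rule eqv_trans[OF e])
          then show ?thesis using t tw by blast
        next
          case False
          then show ?thesis using eqv_trans[OF e z] by blast
        qed
      next
        assume "\<exists>t. r @ q = q @ t \<and> awalk v t v \<and> vtx v * gpath q * epath (r @ q) * vtx v \<approx> epath t * vtx v"
        then show ?thesis using eqv_trans[OF e] by blast
      qed
    qed
    have "\<exists>y'. closed_paths v y' \<and> card (Poly_Mapping.keys y') \<le> card (Poly_Mapping.keys y0) \<and>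
       A * y0 * B \<approx> y' * vtx v"
    proof (rule closed_paths_compress)
      fix w' assume "w' \<in> Poly_Mapping.keys y0"
      then obtain r where r: "w' = Word (map Edge r)" "r \<noteq> []" "awalk v r v"
        using less.prems(1) y0(2) unfolding closed_paths_def by blast
      \<comment> \<open>Conjugation by \<open>q\<close> preserves the length of the closed
        path.\<close>
      have "t \<noteq> []" if "r @ q = q @ t" for t
      proof -
        have "length (r @ q) = length (q @ t)" using that by simp
        then show ?thesis using r(2) by auto
      qed
      then show "A * Poly_Mapping.single w' 1 * B \<approx> 0 \<or>
         (\<exists>r. r \<noteq> [] \<and> awalk v r v \<and> A * Poly_Mapping.single w' 1 * B \<approx> epath r * vtx v)"
        using conj[OF r(3)] unfolding r(1) by blast
    qed
    then obtain y' where y': "closed_paths v y'" "card (Poly_Mapping.keys y') \<le> card (Poly_Mapping.keys y0)"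
      "A * y0 * B \<approx> y' * vtx v" by blast
    have less_card: "card (Poly_Mapping.keys y') < card (Poly_Mapping.keys y)"
      using y'(2) y0(2) card_Diff1_less[OF _ w] by simp
    have zero: "A * Poly_Mapping.single w (Poly_Mapping.lookup y w) * B \<approx> 0"
    proof -
      have "A * Poly_Mapping.single w (Poly_Mapping.lookup y w) * B =
          scalar (Poly_Mapping.lookup y w) * (A * Poly_Mapping.single w 1 * B)"
        by (simp only: single_conv_scalar[of w "Poly_Mapping.lookup y w"] scalar_left mult.assoc)
      also have "\<dots> \<approx> scalar (Poly_Mapping.lookup y w) * 0"
        using conj[OF p(3)] q(3) unfolding p(1) by (intro eqv_lmul) blast
      finally show ?thesis by simp
    qed
    have one: "A * scalar c * B \<approx> scalar c * vtx v"
    proof -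
      have "A * scalar c * B = scalar c * (vtx v * gpath q * (vtx v * epath q * vtx v))"
        by (simp only: A_def B_def scalar_commute[of c, symmetric] mult.assoc)
      also have "\<dots> \<approx> scalar c * (vtx v * gpath q * (epath q * vtx v))"
        by (intro eqv_lmul vtx_epath_vtx q(2))
      also have "\<dots> = scalar c * (vtx v * gpath q * epath q * vtx v)" by (simp add: mult.assoc)
      also have "\<dots> \<approx> scalar c * vtx v" by (rule eqv_lmul[OF gpath_epath_self[OF q(2)]])
      finally show ?thesis .
    qed
    have "A * (scalar c + y) * B = A * scalar c * B + (A * Poly_Mapping.single w (Poly_Mapping.lookup y w) * B + A * y0 * B)"
      by (subst y0(1)) (simp add: distrib_left distrib_right)
    also have "\<dots> \<approx> scalar c * vtx v + (0 + y' * vtx v)"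
      by (intro eqv_add one zero y'(3))
    finally have e: "A * (scalar c + y) * B \<approx> (scalar c + y') * vtx v" by (simp add: distrib_right)
    have "A * ((scalar c + y) * vtx v) * (epath q * vtx v) \<in> P"
      by (intro rmul_mem lmul_mem less.prems(3))
    then have "A * (scalar c + y) * B \<in> P" by (simp add: B_def mult.assoc)
    then have "(scalar c + y') * vtx v \<in> P" using eqv_mem_iff[OF e] by blast
    then show ?thesis using less.hyps[OF less_card y'(1) less.prems(2)] by blast
  qed
qed

text \<open>Here \<open>p\<close> is a shortest path in \<open>x\<close>. Multiplied by
  \<open>p\<^sup>*\<close>, its own term becomes \<open>c v\<close>; any other path is at least as
  long and is killed or leaves a nonempty remainder, which is closed at \<open>v\<close> since all
  paths in \<open>x\<close> end there.\<close>

lemma real_paths_leading: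
  assumes x: "real_paths v x" "x \<noteq> 0"
  obtains u p c y where "awalk u p v" "c \<noteq> 0" "closed_paths v y"
    "vtx v * gpath p * x * vtx v \<approx> (scalar c + y) * vtx v"
proof -
  let ?len = "\<lambda>w :: ('v, 'e) generator word. length (letters w)"
  have "Poly_Mapping.keys x \<noteq> {}" using x(2) by simp
  then have "\<exists>w. is_arg_min ?len (\<lambda>w. w \<in> Poly_Mapping.keys x) w"
    using ex_is_arg_min_if_finite[of "Poly_Mapping.keys x" ?len] by simp
  then obtain w0 where w0: "w0 \<in> Poly_Mapping.keys x"
    and min: "\<And>w. w \<in> Poly_Mapping.keys x \<Longrightarrow> ?len w0 \<le> ?len w"
    unfolding is_arg_min_linorder by blast
  obtain u p where p: "w0 = Word (map Edge p)" "awalk u p v" using x(1) w0 unfolding real_paths_def by blast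
  have v: "v \<in> verts E" by (rule awalk_last_in_verts[OF p(2)])
  let ?c = "Poly_Mapping.lookup x w0"
  obtain x' where x': "x = Poly_Mapping.single w0 ?c + x'" "Poly_Mapping.keys x' = Poly_Mapping.keys x - {w0}"
    using keys_split[OF w0] .
  let ?A = "vtx v * gpath p"
  have "\<exists>y. closed_paths v y \<and> card (Poly_Mapping.keys y) \<le> card (Poly_Mapping.keys x') \<and>
     ?A * x' * vtx v \<approx> y * vtx v"
  proof (rule closed_paths_compress)
    fix w assume w: "w \<in> Poly_Mapping.keys x'"
    then obtain u' p' where p': "w = Word (map Edge p')" "awalk u' p' v"
      using x(1) x'(2) unfolding real_paths_def by blast
    have "length p \<le> length p'" using min[of w] w x'(2) p(1) p'(1) by simp
    from gpath_epath_compare[OF p(2) p'(2) this]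
    show "?A * Poly_Mapping.single w 1 * vtx v \<approx> 0 \<or>
         (\<exists>r. r \<noteq> [] \<and> awalk v r v \<and> ?A * Poly_Mapping.single w 1 * vtx v \<approx> epath r * vtx v)"
    proof
      assume "\<exists>r. p' = p @ r \<and> awalk v r v \<and> vtx v * gpath p * epath p' * vtx v \<approx> epath r * vtx v"
      then obtain r where r: "p' = p @ r" "awalk v r v" "vtx v * gpath p * epath p' * vtx v \<approx> epath r * vtx v"
        by blast
      have "w \<noteq> w0" using w x'(2) by simp
      then have "r \<noteq> []" using r(1) p(1) p'(1) by auto
      moreover have "?A * Poly_Mapping.single w 1 * vtx v \<approx> epath r * vtx v"
        using r(3) by (simp add: p'(1) single_edges)
      ultimately show ?thesis using r(2) by blast
    qed (simp add: p'(1) single_edges)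
  qed
  then obtain y where y: "closed_paths v y" "?A * x' * vtx v \<approx> y * vtx v" by blast
  have "?A * x * vtx v = scalar ?c * (vtx v * gpath p * epath p * vtx v) + ?A * x' * vtx v"
    by (subst x'(1)) (simp only: p(1) single_edges distrib_left distrib_right scalar_left mult.assoc)
  also have "\<dots> \<approx> scalar ?c * vtx v + y * vtx v"
    by (intro eqv_add eqv_lmul y(2) gpath_epath_self[OF p(2)])
  finally have "?A * x * vtx v \<approx> (scalar ?c + y) * vtx v" by (simp add: distrib_right)
  then show ?thesis using that[OF p(2) _ y(1), of ?c] w0 by (simp add: in_keys_iff)
qed

lemma real_paths_vertex_mem:
  assumes "condition_K E" "real_paths v x" "x \<noteq> 0" "x * vtx v \<in> P"
  shows "vtx v \<in> P"
proof -
  obtain u p c y where p: "awalk u p v" "c \<noteq> 0" "closed_paths v y"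
    "vtx v * gpath p * x * vtx v \<approx> (scalar c + y) * vtx v"
    using real_paths_leading[OF assms(2,3)] .
  have "vtx v * gpath p * (x * vtx v) \<in> P" by (rule lmul_mem[OF assms(4)])
  then have "(scalar c + y) * vtx v \<in> P" using eqv_mem_iff[OF p(4)] by (simp add: mult.assoc)
  then show ?thesis using closed_vertex_mem[OF assms(1) awalk_last_in_verts[OF p(1)] p(3,2)] by blast
qed

section \<open>Splitting off the rightmost ghost edge\<close>

lemma real_paths_step:
  assumes "real_paths v b" "awalk u p v"
  shows "real_paths v (Poly_Mapping.single (Word (map Edge p)) c + b)"
proof -
  have "Poly_Mapping.keys (Poly_Mapping.single (Word (map Edge p)) c + b) \<subseteq>
      insert (Word (map Edge p)) (Poly_Mapping.keys b)"
    using Poly_Mapping.keys_add[of "Poly_Mapping.single (Word (map Edge p)) c" b] by (auto split: if_splits)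
  with assms show ?thesis unfolding real_paths_def by blast
qed

lemma gspan_0_real:
  assumes "x \<in> gspan 0 v" "v \<in> verts E"
  shows "\<exists>b. real_paths v b \<and> x \<approx> b * vtx v"
  using assms(1)
proof induction
  case (base x)
  then show ?case by (intro exI[of _ 0]) (simp add: real_paths_def eqv_zero_iff)
next
  case (step x u p y q c)
  then have [simp]: "q = []" "y = v" by (simp_all add: awalk_Nil_iff)
  obtain b where b: "real_paths v b" "x \<approx> b * vtx v" using step.IH by blast
  have "scalar c * (epath p * vtx y * gpath q) + x \<approx> scalar c * (epath p * vtx v) + b * vtx v"
    by (intro eqv_add b(2)) simp
  also have "\<dots> = (Poly_Mapping.single (Word (map Edge p)) c + b) * vtx v"
    by (simp add: single_edges distrib_right mult.assoc)
  finally show ?case using real_paths_step[OF b(1)] step.hyps(2) by auto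
qed

text \<open>The first edge of \<open>q\<close> is the rightmost letter of \<open>gpath q\<close>, so
  collecting monomials by it separates shorter ghosts \<open>a e\<close> from the ghost-free part
  \<open>b\<close>. Setting \<open>a\<close> to zero outside \<open>X\<close> allows sums over
  larger edge sets.\<close>

lemma gspan_Suc_real:
  assumes "x \<in> gspan (Suc m) v"
  shows "\<exists>X a b. finite X \<and> X \<subseteq> out_arcs E v \<and> (\<forall>e \<in> X. a e \<in> gspan m (head E e)) \<and>
     (\<forall>e. e \<notin> X \<longrightarrow> a e = 0) \<and> real_paths v b \<and> x \<approx> (\<Sum>e\<in>X. a e * gho e) + b * vtx v"
  using assms
proof induction
  case (base x)
  then show ?case
    by (intro exI[of _ "{}"] exI[of _ "\<lambda>_. 0"] exI[of _ 0]) (simp add: real_paths_def eqv_zero_iff)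
next
  case (step x u p y q c)
  obtain X a b where X: "finite X" "X \<subseteq> out_arcs E v" "\<And>e. e \<in> X \<Longrightarrow> a e \<in> gspan m (head E e)"
     "\<And>e. e \<notin> X \<Longrightarrow> a e = 0" "real_paths v b" "x \<approx> (\<Sum>e\<in>X. a e * gho e) + b * vtx v"
    using step.IH by blast
  show ?case
  proof (cases q)
    case Nil
    then have [simp]: "q = []" "y = v" using step.hyps(3) by (simp_all add: awalk_Nil_iff)
    have "scalar c * (epath p * vtx y * gpath q) + x \<approx>
        scalar c * (epath p * vtx v) + ((\<Sum>e\<in>X. a e * gho e) + b * vtx v)"
      by (intro eqv_add X(6)) simp
    also have "\<dots> = (\<Sum>e\<in>X. a e * gho e) + (Poly_Mapping.single (Word (map Edge p)) c + b) * vtx v"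
      by (simp add: single_edges distrib_right mult.assoc add.left_commute)
    finally have "scalar c * (epath p * vtx y * gpath q) + x \<approx>
      (\<Sum>e\<in>X. a e * gho e) + (Poly_Mapping.single (Word (map Edge p)) c + b) * vtx v" .
    moreover have "real_paths v (Poly_Mapping.single (Word (map Edge p)) c + b)"
      using real_paths_step[OF X(5)] step.hyps(2) by simp
    ultimately show ?thesis using X(1-4) by blast
  next
    case (Cons e q')
    note e = awalk_ConsD[OF step.hyps(3)[unfolded Cons]]
    have le: "length q' \<le> m" using step.hyps(4) Cons by simp
    let ?t = "scalar c * (epath p * vtx y * gpath q')"
    let ?a = "a(e := ?t + a e)"
    let ?X = "insert e X"
    have t: "?t \<in> gspan m (head E e)" using step.hyps(2) e le by (intro gspan_monomial) blast+
    have ae: "a e \<in> gspan m (head E e)"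
    proof (cases "e \<in> X")
      case False
      then show ?thesis using X(4) gspan.base[OF zero_mem] by simp
    qed (rule X(3))
    have sum: "(\<Sum>f\<in>X. a f * gho f) = (\<Sum>f\<in>?X. a f * gho f)"
      using X(1,4) by (intro sum.mono_neutral_left) auto
    have "(\<Sum>f\<in>?X. ?a f * gho f) = ?a e * gho e + (\<Sum>f\<in>?X - {e}. ?a f * gho f)"
      using X(1) by (intro sum.remove) auto
    also have "(\<Sum>f\<in>?X - {e}. ?a f * gho f) = (\<Sum>f\<in>?X - {e}. a f * gho f)"
      by (rule sum.cong) auto
    also have "?a e * gho e + (\<Sum>f\<in>?X - {e}. a f * gho f) = ?t * gho e + (a e * gho e + (\<Sum>f\<in>?X - {e}. a f * gho f))"
      by (simp add: distrib_right add.assoc)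
    also have "a e * gho e + (\<Sum>f\<in>?X - {e}. a f * gho f) = (\<Sum>f\<in>?X. a f * gho f)"
      using X(1) by (intro sum.remove[symmetric]) auto
    finally have sum': "(\<Sum>f\<in>?X. ?a f * gho f) = ?t * gho e + (\<Sum>f\<in>X. a f * gho f)" unfolding sum .
    have "scalar c * (epath p * vtx y * gpath q) + x \<approx> ?t * gho e + ((\<Sum>f\<in>X. a f * gho f) + b * vtx v)"
      by (intro eqv_add X(6)) (simp add: Cons mult.assoc)
    then have "scalar c * (epath p * vtx y * gpath q) + x \<approx> (\<Sum>f\<in>?X. ?a f * gho f) + b * vtx v"
      unfolding sum' by (simp add: add.assoc)
    moreover have "\<And>f. f \<in> ?X \<Longrightarrow> ?a f \<in> gspan m (head E f)"
      using X(3) gspan_add[OF t ae] by (auto split: if_splits)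
    moreover have "?X \<subseteq> out_arcs E v" using X(2) e by (simp add: in_out_arcs_conv)
    moreover have "\<And>f. f \<notin> ?X \<Longrightarrow> ?a f = 0" using X(4) by simp
    ultimately show ?thesis using X(1,5) by (intro exI[of _ ?X] exI[of _ ?a] exI[of _ b]) blast
  qed
qed

lemma gspan_vtx_right: "x \<in> gspan m v \<Longrightarrow> x * vtx v \<approx> x"
proof (induction rule: gspan.induct)
  case (base x)
  then show ?case unfolding eqv_def by (intro diff_mem rmul_mem)
next
  case (step x u p y q c)
  have y: "y \<in> verts E" by (rule awalk_last_in_verts[OF step.hyps(2)])
  have "(scalar c * (epath p * vtx y * gpath q)) * vtx v = (scalar c * epath p * vtx y) * (gpath q * vtx v)"
    by (simp add: mult.assoc)
  also have "\<dots> \<approx> (scalar c * epath p * vtx y) * (vtx y * gpath q)" by (rule eqv_lmul[OF gpath_vtx[OF step.hyps(3)]])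
  also have "\<dots> = (scalar c * epath p) * (vtx y * vtx y) * gpath q" by (simp add: mult.assoc)
  also have "\<dots> \<approx> (scalar c * epath p) * vtx y * gpath q" by (rule eqv_mid[OF vtx_vtx[OF y]])
  also have "\<dots> = scalar c * (epath p * vtx y * gpath q)" by (simp add: mult.assoc)
  finally show ?case unfolding distrib_right using step.IH by (rule eqv_add)
qed

text \<open>The product contains no ghosts, hence the bound \<open>m\<close> is arbitrary and can
  match that of the coefficient \<open>a f\<close> to which it is added.\<close>

lemma real_paths_edge_gspan:
  assumes f: "f \<in> out_arcs E v"
  shows "real_paths v b \<Longrightarrow> b * edg f \<in> gspan m (head E f)"
proof (induction b rule: poly_mapping_single_induct)
  case zero
  then show ?case using gspan.base[OF zero_mem] by simp
next
  case (add w c b)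
  have keys: "Poly_Mapping.keys (Poly_Mapping.single w c + b) = insert w (Poly_Mapping.keys b)"
    by (rule keys_single_add[OF add.hyps(1,2)])
  have b: "b * edg f \<in> gspan m (head E f)"
    by (rule add.IH) (use add.prems keys in \<open>simp add: real_paths_def\<close>)
  obtain p u where p: "w = Word (map Edge p)" "awalk u p v"
    using add.prems keys unfolding real_paths_def by blast
  have f': "f \<in> arcs E" "tail E f = v" using f by (simp_all add: in_out_arcs_conv)
  have "awalk v [f] (head E f)" using f' by (simp add: awalk_Cons_iff awalk_Nil_iff)
  then have pf: "awalk u (p @ [f]) (head E f)" using p(2) by (intro awalk_appendI)
  have "scalar c * (epath (p @ [f]) * vtx (head E f) * gpath []) \<in> gspan m (head E f)"
    using pf f' by (intro gspan_monomial) (simp_all add: awalk_Nil_iff)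
  moreover have "Poly_Mapping.single w c * edg f \<approx> scalar c * (epath (p @ [f]) * vtx (head E f) * gpath [])"
  proof -
    have "Poly_Mapping.single w c * edg f = scalar c * epath p * edg f" by (simp add: p(1) single_edges)
    also have "\<dots> \<approx> scalar c * epath p * (edg f * vtx (head E f))"
      by (rule eqv_lmul[OF eqv_sym[OF edg_vtx[OF f'(1)]]])
    also have "\<dots> = scalar c * (epath (p @ [f]) * vtx (head E f) * gpath [])" by (simp add: mult.assoc)
    finally show ?thesis .
  qed
  ultimately have "Poly_Mapping.single w c * edg f \<in> gspan m (head E f)" by (rule gspan_eqv)
  then show ?case unfolding distrib_right using b by (rule gspan_add)
qed

section \<open>Gap vertices as idempotents that kill the edges in their sum\<close>

lemma gap_edg:
  assumes "finite (arcs_avoiding E H v)" "f \<in> arcs_avoiding E H v"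
  shows "gap E H v * edg f \<approx> 0"
proof -
  have f: "f \<in> arcs E" "tail E f = v" and A: "arcs_avoiding E H v \<subseteq> arcs E"
    using assms(2) by (auto simp: arcs_avoiding_def)
  have "(\<Sum>e\<in>arcs_avoiding E H v. edg e * gho e * edg f) \<approx>
      (\<Sum>e\<in>arcs_avoiding E H v. if f = e then edg f else 0)"
  proof (rule eqv_sum)
    fix e assume e: "e \<in> arcs_avoiding E H v"
    show "edg e * gho e * edg f \<approx> (if f = e then edg f else 0)"
    proof (cases "f = e")
      case True
      have "edg e * (gho e * edg e) \<approx> edg e * vtx (head E e)"
        using f True by (intro eqv_lmul gho_edg) simp
      also have "\<dots> \<approx> edg e" using f True by (intro edg_vtx) simp
      finally show ?thesis using True by (simp add: mult.assoc)
    next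
      case False
      have "edg e * (gho e * edg f) * 1 \<approx> 0"
        by (rule eqv_zero_mid[OF gho_edg_neq]) (use e A f False in auto)
      then show ?thesis using False by (simp add: mult.assoc)
    qed
  qed
  then have "(\<Sum>e\<in>arcs_avoiding E H v. edg e * gho e * edg f) \<approx> edg f"
    using assms by simp
  moreover have "vtx v * edg f \<approx> edg f" using vtx_edg[OF f(1)] f(2) by simp
  ultimately have "vtx v * edg f - (\<Sum>e\<in>arcs_avoiding E H v. edg e * gho e * edg f) \<approx> edg f - edg f"
    by (rule eqv_minus[rotated])
  then show ?thesis by (simp add: gap_def left_diff_distrib sum_distrib_right)
qed

lemma vtx_gap:
  assumes "v \<in> verts E"
  shows "vtx v * gap E H v \<approx> gap E H v"
proof -
  have "(\<Sum>e\<in>arcs_avoiding E H v. vtx v * (edg e * gho e)) \<approx> (\<Sum>e\<in>arcs_avoiding E H v. edg e * gho e)"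
  proof (rule eqv_sum)
    fix e assume "e \<in> arcs_avoiding E H v"
    then have e: "e \<in> arcs E" "tail E e = v" by (auto simp: arcs_avoiding_def)
    show "vtx v * (edg e * gho e) \<approx> edg e * gho e"
      using eqv_rmul[OF vtx_edg[OF e(1)], of "gho e"] e(2) by (simp add: mult.assoc)
  qed
  with vtx_vtx[OF assms] show ?thesis
    unfolding gap_def right_diff_distrib sum_distrib_left by (rule eqv_minus)
qed

lemma gap_vtx:
  assumes "v \<in> verts E"
  shows "gap E H v * vtx v \<approx> gap E H v"
proof -
  have "(\<Sum>e\<in>arcs_avoiding E H v. edg e * gho e * vtx v) \<approx> (\<Sum>e\<in>arcs_avoiding E H v. edg e * gho e)"
  proof (rule eqv_sum)
    fix e assume "e \<in> arcs_avoiding E H v"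
    then have e: "e \<in> arcs E" "tail E e = v" by (auto simp: arcs_avoiding_def)
    show "edg e * gho e * vtx v \<approx> edg e * gho e"
      using eqv_lmul[OF gho_vtx[OF e(1)], of "edg e"] e(2) by (simp add: mult.assoc)
  qed
  with vtx_vtx[OF assms] show ?thesis
    unfolding gap_def left_diff_distrib sum_distrib_right by (rule eqv_minus)
qed

lemma gap_gap:
  assumes "v \<in> verts E" "finite (arcs_avoiding E H v)"
  shows "gap E H v * gap E H v \<approx> gap E H v"
proof -
  have "(\<Sum>e\<in>arcs_avoiding E H v. gap E H v * (edg e * gho e)) \<approx> (\<Sum>e\<in>arcs_avoiding E H v. 0)"
  proof (rule eqv_sum)
    fix e assume "e \<in> arcs_avoiding E H v"
    then have "gap E H v * edg e * gho e \<approx> 0 * gho e" by (intro eqv_rmul gap_edg assms(2))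
    then show "gap E H v * (edg e * gho e) \<approx> 0" by (simp add: mult.assoc)
  qed
  note sum = this
  have "gap E H v * gap E H v =
      gap E H v * vtx v - (\<Sum>e\<in>arcs_avoiding E H v. gap E H v * (edg e * gho e))"
    by (subst (2) gap_def) (simp add: right_diff_distrib sum_distrib_left)
  also have "\<dots> \<approx> gap E H v - (\<Sum>e\<in>arcs_avoiding E H v. 0)"
    by (rule eqv_minus[OF gap_vtx[OF assms(1)] sum])
  finally show ?thesis by simp
qed

lemma gap_epath:
  assumes "finite (arcs_avoiding E H v)" "awalk v p w" "p \<noteq> []" "head E (hd p) \<notin> H"
  shows "gap E H v * epath p \<approx> 0"
proof (cases p)
  case (Cons e p')
  have "e \<in> arcs_avoiding E H v"
    using assms(2,4) awalk_ConsD[of v e p' w] Cons by (simp add: arcs_avoiding_def in_out_arcs_conv)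
  from eqv_rmul[OF gap_edg[OF assms(1) this], of "epath p'"] show ?thesis
    by (simp add: Cons mult.assoc)
qed (use assms in simp)

end

section \<open>Ideals are determined by their vertices and gap vertices\<close>

context lpa_ideal
begin

text \<open>Induction on the ghost length. A vertex in \<open>Q\<close> settles \<open>v\<close> at
  once; otherwise the cases are a regular vertex, a sink and an infinite emitter. Only an infinite
  emitter with ghost-free part \<open>b \<noteq> 0\<close> leads to a gap vertex.\<close>

lemma gspan_mem_of_larger_ideal:
  fixes Q :: "('v, 'e, 'k) free_element set" and H :: "'v set"
  assumes Q: "lpa_ideal E Q" and sub: "P \<subseteq> Q" and K: "condition_K E"
    and H: "H = {v \<in> verts E. vtx v \<in> Q}"
    and vtxQ: "\<And>v. v \<in> H \<Longrightarrow> vtx v \<in> P"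
    and gapQ: "\<And>v. v \<in> B_of E H \<Longrightarrow> gap E H v \<in> Q \<Longrightarrow> gap E H v \<in> P"
  shows "v \<in> verts E \<Longrightarrow> x \<in> gspan m v \<Longrightarrow> x \<in> Q \<Longrightarrow> x \<in> P"
proof (induction m arbitrary: v x)
  interpret Q: lpa_ideal E Q by (rule Q)
  have iffQ: "a \<approx> b \<Longrightarrow> a \<in> Q \<longleftrightarrow> b \<in> Q" for a b
    using Q.eqv_mem_iff[of a b] sub unfolding eqv_def Q.eqv_def by blast
  \<comment> \<open>Condition (K) enters here: a nonzero ghost-free element of \<open>Q\<close>
    forces its end vertex into \<open>Q\<close>, hence into \<open>P\<close>.\<close>
  have real: "b * vtx v \<in> P" if "real_paths v b" "b * vtx v \<in> Q" "v \<in> verts E" for b v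
  proof (cases "b = 0")
    case False
    then have "vtx v \<in> Q" using Q.real_paths_vertex_mem[OF K] that by blast
    then show ?thesis using vtxQ that(3) H lmul_mem by blast
  qed (simp add: zero_mem)
  {
    case 0
    obtain b where b: "real_paths v b" "x \<approx> b * vtx v" using gspan_0_real[OF 0(2,1)] by blast
    then have "b * vtx v \<in> Q" using iffQ 0(3) by blast
    then have "b * vtx v \<in> P" using real b(1) 0(1) by blast
    then show ?case using eqv_mem_iff[OF b(2)] by blast
  next
    case (Suc m)
    obtain X a b where X: "finite X" "X \<subseteq> out_arcs E v" "\<And>e. e \<in> X \<Longrightarrow> a e \<in> gspan m (head E e)"
      "\<And>e. e \<notin> X \<Longrightarrow> a e = 0" "real_paths v b" "x \<approx> (\<Sum>e\<in>X. a e * gho e) + b * vtx v"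
      using gspan_Suc_real[OF Suc.prems(2)] by blast
    have arcD: "f \<in> arcs E" "tail E f = v" "head E f \<in> verts E" if "f \<in> out_arcs E v" for f
      using that by (simp_all add: in_out_arcs_conv)
    have b_edg: "b * vtx v * edg f \<approx> b * edg f" if f: "f \<in> out_arcs E v" for f
      using eqv_lmul[OF vtx_edg[OF arcD(1)[OF f]], of b] arcD(2)[OF f] by (simp add: mult.assoc)
    have a_span: "a f \<in> gspan m (head E f)" for f
      using X(3,4) gspan.base[OF zero_mem] by (cases "f \<in> X") simp_all
    have x_edg: "x * edg f \<approx> a f + b * edg f" if f: "f \<in> out_arcs E v" for f
    proof -
      have "(\<Sum>e\<in>X. a e * gho e * edg f) \<approx> (\<Sum>e\<in>X. if f = e then a f else 0)"
      proof (rule eqv_sum)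
        fix e assume e: "e \<in> X"
        then have e': "e \<in> out_arcs E v" using X(2) by blast
        show "a e * gho e * edg f \<approx> (if f = e then a f else 0)"
        proof (cases "f = e")
          case True
          have "a e * (gho e * edg e) \<approx> a e * vtx (head E e)" by (rule eqv_lmul[OF gho_edg[OF arcD(1)[OF e']]])
          also have "\<dots> \<approx> a e" by (rule gspan_vtx_right[OF a_span])
          finally show ?thesis using True by (simp add: mult.assoc)
        next
          case False
          have "a e * (gho e * edg f) \<approx> a e * 0"
            using False arcD(1)[OF e'] arcD(1)[OF f] by (intro eqv_lmul gho_edg_neq) auto
          then show ?thesis using False by (simp add: mult.assoc)
        qed
      qed
      also have "(\<Sum>e\<in>X. if f = e then a f else 0) = a f" using X(1,4) by simp
      finally have "(\<Sum>e\<in>X. a e * gho e * edg f) + b * vtx v * edg f \<approx> a f + b * edg f"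
        using b_edg[OF f] by (rule eqv_add)
      moreover have "x * edg f \<approx> (\<Sum>e\<in>X. a e * gho e * edg f) + b * vtx v * edg f"
        using eqv_rmul[OF X(6), of "edg f"] by (simp add: distrib_right sum_distrib_right)
      ultimately show ?thesis using eqv_trans by blast
    qed
    \<comment> \<open>Multiplying by \<open>f\<close> removes the rightmost ghost edge, so the
      induction hypothesis applies at the range of \<open>f\<close>.\<close>
    have ab: "a f + b * edg f \<in> P" if f: "f \<in> out_arcs E v" for f
    proof (rule Suc.IH)
      show "head E f \<in> verts E" by (rule arcD(3)[OF f])
      show "a f + b * edg f \<in> gspan m (head E f)"
        by (rule gspan_add[OF a_span real_paths_edge_gspan[OF f X(5)]])
      show "a f + b * edg f \<in> Q" using iffQ[OF x_edg[OF f]] Q.rmul_mem[OF Suc.prems(3)] by blast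
    qed
    then have xe: "x * edg f \<in> P" if "f \<in> out_arcs E v" for f
      using that eqv_mem_iff[OF x_edg] by blast
    have xv: "x * vtx v \<approx> x" by (rule gspan_vtx_right[OF Suc.prems(2)])
    show ?case
    proof (cases "v \<in> H")
      case True
      then show ?thesis using eqv_mem_iff[OF xv] lmul_mem[OF vtxQ] by blast
    next
      case False
      then have vQ: "vtx v \<notin> Q" using H Suc.prems(1) by blast
      consider "regular_vertex E v" | "out_arcs E v = {}" | "infinite (out_arcs E v)"
        unfolding regular_vertex_def by blast
      then show ?thesis
      proof cases
        case 1
        have "x \<approx> x * vtx v" by (rule eqv_sym[OF xv])
        also have "\<dots> \<approx> x * (\<Sum>e\<in>out_arcs E v. edg e * gho e)"
          by (rule eqv_lmul[OF vtx_sum[OF Suc.prems(1) 1]])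
        also have "\<dots> = (\<Sum>e\<in>out_arcs E v. x * edg e * gho e)" by (simp add: sum_distrib_left mult.assoc)
        finally have "x \<approx> (\<Sum>e\<in>out_arcs E v. x * edg e * gho e)" .
        moreover have "(\<Sum>e\<in>out_arcs E v. x * edg e * gho e) \<in> P" by (intro sum_mem rmul_mem xe)
        ultimately show ?thesis using eqv_mem_iff by blast
      next
        case 2
        then have xb: "x \<approx> b * vtx v" using X(2,6) by simp
        then have "b * vtx v \<in> Q" using iffQ Suc.prems(3) by blast
        then show ?thesis using real[OF X(5) _ Suc.prems(1)] eqv_mem_iff[OF xb] by blast
      next
        case 3
        show ?thesis
        proof (cases "b = 0")
          case True
          have "a e \<in> P" if "e \<in> X" for e using ab[of e] that X(2) True by auto
          then have "(\<Sum>e\<in>X. a e * gho e) \<in> P" by (intro sum_mem rmul_mem)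
          then show ?thesis using eqv_mem_iff[OF X(6)] True by simp
        next
          case False
          obtain u p c y where p: "awalk u p v" "c \<noteq> 0" "closed_paths v y"
            "vtx v * gpath p * b * vtx v \<approx> (scalar c + y) * vtx v"
            using real_paths_leading[OF X(5) False] .
          define A where "A = arcs_avoiding E H v"
          \<comment> \<open>Only the finitely many first edges of closed paths in \<open>y\<close>
            survive left multiplication by a ghost edge.\<close>
          define firsts where "firsts = {e. \<exists>p. Word (map Edge (e # p)) \<in> Poly_Mapping.keys y}"
          have fin_firsts: "finite firsts"
          proof -
            have "firsts \<subseteq> (\<lambda>w. case hd (letters w) of Edge e \<Rightarrow> e) ` Poly_Mapping.keys y"
              unfolding firsts_def by force
            then show ?thesis using finite_keys finite_surj by blast
          qed
          \<comment> \<open>For \<open>f\<close> outside \<open>X\<close> and \<open>firsts\<close>,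
            already \<open>b f\<close> lies in \<open>P\<close>. Multiplying it by
            \<open>f\<^sup>* p\<^sup>*\<close> isolates \<open>c r(f)\<close>, so the range of
            \<open>f\<close> lies in \<open>H\<close>. Thus \<open>A\<close> is finite and the gap
            vertex makes sense.\<close>
          have "A \<subseteq> X \<union> firsts"
          proof
            fix f assume f: "f \<in> A"
            then have fo: "f \<in> out_arcs E v" and fH: "head E f \<notin> H" by (auto simp: A_def arcs_avoiding_def)
            show "f \<in> X \<union> firsts"
            proof (rule ccontr)
              assume nf: "f \<notin> X \<union> firsts"
              then have "b * edg f \<in> P" using ab[OF fo] X(4)[of f] by simp
              then have "b * vtx v * edg f \<in> P" using eqv_mem_iff[OF b_edg[OF fo]] by blast
              then have mem: "(gho f * (vtx v * gpath p)) * (b * vtx v * edg f) \<in> P" by (rule lmul_mem)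
              have gy: "gho f * y' \<approx> 0" if "Poly_Mapping.keys y' \<subseteq> Poly_Mapping.keys y" for y'
                using that
              proof (induction y' rule: poly_mapping_single_induct)
                case (add w d y')
                have keys: "Poly_Mapping.keys (Poly_Mapping.single w d + y') = insert w (Poly_Mapping.keys y')"
                  by (rule keys_single_add[OF add.hyps(1,2)])
                obtain r where r: "w = Word (map Edge r)" "r \<noteq> []" "awalk v r v"
                  using p(3) add.prems keys unfolding closed_paths_def by blast
                obtain e r' where er: "r = e # r'" using r(2) by (cases r) auto
                have "e \<in> firsts" using r(1) add.prems keys unfolding firsts_def er by blast
                then have "e \<noteq> f" using nf by blast
                moreover have "e \<in> arcs E" using awalk_ConsD[OF r(3)[unfolded er]] by blast
                ultimately have "scalar d * (gho f * edg e) * epath r' \<approx> 0"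
                  using arcD(1)[OF fo] by (intro eqv_zero_mid gho_edg_neq) auto
                moreover have "gho f * Poly_Mapping.single w d = scalar d * (gho f * edg e) * epath r'"
                  unfolding r(1) er single_edges scalar_left by (simp add: mult.assoc)
                moreover have "gho f * y' \<approx> 0" using add.IH add.prems keys by blast
                ultimately have "gho f * Poly_Mapping.single w d + gho f * y' \<approx> 0 + 0"
                  by (intro eqv_add) simp_all
                then show ?case by (simp add: distrib_left)
              qed simp
              have "(gho f * (vtx v * gpath p)) * (b * vtx v * edg f) = gho f * (vtx v * gpath p * b * vtx v) * edg f"
                by (simp add: mult.assoc)
              also have "\<dots> \<approx> gho f * ((scalar c + y) * vtx v) * edg f" by (rule eqv_mid[OF p(4)])
              also have "\<dots> = (gho f * scalar c + gho f * y) * (vtx v * edg f)"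
                by (simp add: mult.assoc distrib_left distrib_right)
              also have "\<dots> \<approx> (gho f * scalar c + 0) * edg f"
                using vtx_edg[OF arcD(1)[OF fo]] arcD(2)[OF fo] by (intro eqv_mult eqv_add gy) auto
              also have "\<dots> = scalar c * (gho f * edg f)"
                by (simp only: scalar_commute[of c "gho f", symmetric] mult.assoc add_0_right)
              also have "\<dots> \<approx> scalar c * vtx (head E f)" by (rule eqv_lmul[OF gho_edg[OF arcD(1)[OF fo]]])
              finally have "scalar c * vtx (head E f) \<in> P" using mem eqv_mem_iff by blast
              then have "vtx (head E f) \<in> P" using p(2) by (rule scalar_mem_cancel)
              then show False using sub fH H arcD(3)[OF fo] by blast
            qed
          qed
          then have finA: "finite A" using X(1) fin_firsts finite_subset by blast
          have A_out: "A \<subseteq> out_arcs E v" by (auto simp: A_def arcs_avoiding_def)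
          \<comment> \<open>The difference is \<open>\<Sum> (a e + b e) e\<^sup>*\<close> over
            \<open>X \<union> A\<close>, whose terms lie in \<open>P\<close> by \<open>ab\<close>;
            edges of \<open>X\<close> outside \<open>A\<close> end in \<open>H\<close> and are zero
            modulo \<open>P\<close>.\<close>
          have xgap: "x \<approx> b * gap E H v"
          proof -
            let ?Z = "X \<union> A"
            have "x - b * gap E H v \<approx> (\<Sum>e\<in>X. a e * gho e) + b * vtx v - b * gap E H v"
              by (intro eqv_minus X(6)) simp
            also have "\<dots> = (\<Sum>e\<in>X. a e * gho e) + (\<Sum>e\<in>A. b * edg e * gho e)"
              by (simp add: gap_def A_def right_diff_distrib sum_distrib_left mult.assoc)
            also have "(\<Sum>e\<in>X. a e * gho e) = (\<Sum>e\<in>?Z. a e * gho e)"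
              using X(1,4) finA by (intro sum.mono_neutral_left) auto
            also have "(\<Sum>e\<in>A. b * edg e * gho e) = (\<Sum>e\<in>?Z. if e \<in> A then b * edg e * gho e else 0)"
              using X(1) finA by (intro sum.mono_neutral_cong_left) auto
            also have "(\<Sum>e\<in>?Z. a e * gho e) + \<dots> \<approx> (\<Sum>e\<in>?Z. a e * gho e) + (\<Sum>e\<in>?Z. b * edg e * gho e)"
            proof (intro eqv_add eqv_sum eqv_refl)
              fix e assume e: "e \<in> ?Z"
              then have eo: "e \<in> out_arcs E v" using X(2) A_out by blast
              show "(if e \<in> A then b * edg e * gho e else 0) \<approx> b * edg e * gho e"
              proof (cases "e \<in> A")
                case False
                then have "head E e \<in> H" using eo by (auto simp: A_def arcs_avoiding_def)
                then have "edg e \<in> P" using vtxQ edg_mem arcD(1)[OF eo] by blast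
                then have "b * edg e * gho e \<in> P" by (intro lmul_mem rmul_mem)
                then show ?thesis using False eqv_sym[of "b * edg e * gho e" 0] by (simp add: eqv_zero_iff)
              qed simp
            qed
            also have "\<dots> = (\<Sum>e\<in>?Z. (a e + b * edg e) * gho e)"
              by (simp add: sum.distrib distrib_right)
            finally have "x - b * gap E H v \<approx> (\<Sum>e\<in>?Z. (a e + b * edg e) * gho e)" .
            moreover have "(\<Sum>e\<in>?Z. (a e + b * edg e) * gho e) \<in> P"
              using X(2) A_out by (intro sum_mem rmul_mem ab) blast
            ultimately have "x - b * gap E H v \<in> P" using eqv_mem_iff by blast
            then show ?thesis unfolding eqv_def .
          qed
          then have bgapQ: "b * gap E H v \<in> Q" using iffQ Suc.prems(3) by blast
          \<comment> \<open>The gap vertex itself kills the closed paths. Their first edge has range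
            outside \<open>H\<close>, since otherwise \<open>H\<close> would be reached and the path
            would carry it back to \<open>v\<close>.\<close>
          have gapy: "gap E H v * y' \<approx> 0" if "Poly_Mapping.keys y' \<subseteq> Poly_Mapping.keys y" for y'
            using that
          proof (induction y' rule: poly_mapping_single_induct)
            case (add w d y')
            have keys: "Poly_Mapping.keys (Poly_Mapping.single w d + y') = insert w (Poly_Mapping.keys y')"
              by (rule keys_single_add[OF add.hyps(1,2)])
            obtain r where r: "w = Word (map Edge r)" "r \<noteq> []" "awalk v r v"
              using p(3) add.prems keys unfolding closed_paths_def by blast
            have "head E (hd r) \<notin> H"
            proof
              assume "head E (hd r) \<in> H"
              then have "vtx (head E (hd r)) \<in> Q" using H by blast
              moreover have "awalk (head E (hd r)) (tl r) v"
                using r(2,3) awalk_ConsD by (metis list.collapse)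
              ultimately show False using Q.awalk_mem vQ by blast
            qed
            then have "gap E H v * epath r \<approx> 0"
              using finA r(2,3) unfolding A_def by (intro gap_epath)
            then have "scalar d * (gap E H v * epath r) \<approx> scalar d * 0" by (rule eqv_lmul)
            moreover have "gap E H v * Poly_Mapping.single w d = scalar d * (gap E H v * epath r)"
              unfolding r(1) single_edges scalar_left ..
            moreover have "gap E H v * y' \<approx> 0" using add.IH add.prems keys by blast
            ultimately have "gap E H v * Poly_Mapping.single w d + gap E H v * y' \<approx> 0 + 0"
              by (intro eqv_add) simp_all
            then show ?case by (simp add: distrib_left)
          qed simp
          \<comment> \<open>Multiplying \<open>b v\<^sup>H\<close> by
            \<open>v\<^sup>H p\<^sup>*\<close> leaves \<open>c v\<^sup>H\<close>, because
            \<open>y\<close> dies and \<open>v\<^sup>H\<close> is idempotent. So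
            \<open>v\<^sup>H\<close> belongs to \<open>Q\<close>.\<close>
          have "(gap E H v * (vtx v * gpath p)) * (b * gap E H v) \<approx> (gap E H v * (vtx v * gpath p)) * (b * (vtx v * gap E H v))"
            by (intro eqv_lmul eqv_sym[OF vtx_gap] Suc.prems(1))
          also have "\<dots> = gap E H v * (vtx v * gpath p * b * vtx v) * gap E H v" by (simp add: mult.assoc)
          also have "\<dots> \<approx> gap E H v * ((scalar c + y) * vtx v) * gap E H v" by (rule eqv_mid[OF p(4)])
          also have "\<dots> = (gap E H v * scalar c + gap E H v * y) * (vtx v * gap E H v)"
            by (simp add: mult.assoc distrib_left distrib_right)
          also have "\<dots> \<approx> (gap E H v * scalar c + 0) * gap E H v"
            by (intro eqv_mult eqv_add gapy vtx_gap Suc.prems(1)) auto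
          also have "\<dots> = scalar c * (gap E H v * gap E H v)"
            by (simp only: scalar_commute[of c "gap E H v", symmetric] mult.assoc add_0_right)
          also have "\<dots> \<approx> scalar c * gap E H v"
            using finA unfolding A_def by (intro eqv_lmul gap_gap Suc.prems(1))
          finally have "scalar c * gap E H v \<in> Q" using iffQ Q.lmul_mem[OF bgapQ] by blast
          then have gQ: "gap E H v \<in> Q" using p(2) by (rule Q.scalar_mem_cancel)
          \<comment> \<open>With no edge avoiding \<open>H\<close> the gap vertex would be
            \<open>v\<close> itself, which is not in \<open>Q\<close>.\<close>
          have "A \<noteq> {}"
          proof
            assume "A = {}"
            then have "gap E H v = (vtx v :: ('v, 'e, 'k) free_element)" by (simp add: gap_def A_def)
            then show False using gQ vQ by simp
          qed
          then have "v \<in> B_of E H"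
            using finA 3 \<open>v \<notin> H\<close> Suc.prems(1) by (simp add: B_of_def A_def infinite_emitter_def)
          then have "gap E H v \<in> P" using gapQ gQ by blast
          then show ?thesis using eqv_mem_iff[OF xgap] lmul_mem by blast
        qed
      qed
    qed
  }
qed

lemma right_unit_sum:
  assumes "a \<in> carrier (free_nonunital E)"
  obtains Y where "finite Y" "Y \<subseteq> verts E" "a \<approx> (\<Sum>v\<in>Y. a * vtx v)"
proof -
  obtain Y where Y: "finite Y" "Y \<subseteq> verts E" "a * (\<Sum>v\<in>Y. vtx v) \<approx> a"
    using right_unit[OF assms] .
  have "a \<approx> (\<Sum>v\<in>Y. a * vtx v)" using eqv_sym[OF Y(3)] by (simp add: sum_distrib_left)
  with Y(1,2) show ?thesis by (rule that)
qed

text \<open>A local unit splits \<open>a\<close> into finitely many parts \<open>a * vtx v\<close>,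
  each in some \<open>gspan m v\<close> and each still in \<open>Q\<close>.\<close>

theorem mem_of_larger_ideal:
  fixes Q :: "('v, 'e, 'k) free_element set" and H :: "'v set"
  assumes "lpa_ideal E Q" "P \<subseteq> Q" "condition_K E" "H = {v \<in> verts E. vtx v \<in> Q}"
    and "\<And>v. v \<in> H \<Longrightarrow> vtx v \<in> P"
    and "\<And>v. v \<in> B_of E H \<Longrightarrow> gap E H v \<in> Q \<Longrightarrow> gap E H v \<in> P"
    and a: "a \<in> carrier (free_nonunital E)" "a \<in> Q"
  shows "a \<in> P"
proof -
  interpret Q: lpa_ideal E Q by (rule assms(1))
  obtain Y where Y: "finite Y" "Y \<subseteq> verts E" "a \<approx> (\<Sum>v\<in>Y. a * vtx v)" using right_unit_sum[OF a(1)] .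
  have "a * vtx v \<in> P" if "v \<in> Y" for v
  proof -
    have v: "v \<in> verts E" using that Y(2) by blast
    obtain m where "a * vtx v \<in> gspan m v"
      using gspan_free_algebra[OF v] a(1) free_nonunital_subset by blast
    then show ?thesis using gspan_mem_of_larger_ideal[OF assms(1-6) v] Q.rmul_mem[OF a(2)] by blast
  qed
  then have "(\<Sum>v\<in>Y. a * vtx v) \<in> P" by (rule sum_mem)
  then show ?thesis using eqv_mem_iff[OF Y(3)] by blast
qed

end

section \<open>Which vertices and gap vertices lie in a graph ideal\<close>

locale graph_with_ideal_data = wf_digraph E for E :: "('v, 'e) pre_digraph" +
  fixes H S :: "'v set"
  assumes countable_arcs: "countable (arcs E)"
    and H_verts: "H \<subseteq> verts E"
    and hereditary: "\<And>e. e \<in> arcs E \<Longrightarrow> tail E e \<in> H \<Longrightarrow> head E e \<in> H"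
    and saturated: "\<And>v. v \<in> verts E \<Longrightarrow> regular_vertex E v \<Longrightarrow>
                      (\<And>e. e \<in> out_arcs E v \<Longrightarrow> head E e \<in> H) \<Longrightarrow> v \<in> H"
    and S_B: "S \<subseteq> B_of E H"
begin

text \<open>
  The module is \<open>V \<times> \<nat> \<Rightarrow> k\<close> with \<open>V\<close> the vertices outside \<open>H\<close>. The copy of \<open>\<nat>\<close> at \<open>v\<close> is cut
  into infinite pieces indexed by \<open>slots v\<close>; an edge identifies the copy at its range with
  its piece at its source. The piece \<^const>\<open>None\<close> is where \<open>v\<close> differs from the sum of its \<open>ee\<^sup>*\<close>.
\<close>

definition slots :: "'v \<Rightarrow> 'e option set" where
  "slots v = Some ` arcs_avoiding E H v \<union> (if regular_vertex E v \<or> v \<in> S then {} else {None})"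

definition enc :: "'v \<Rightarrow> 'e option \<times> nat \<Rightarrow> nat" where
  "enc v = to_nat_on (slots v \<times> UNIV)"

definition dec :: "'v \<Rightarrow> nat \<Rightarrow> 'e option \<times> nat" where
  "dec v = from_nat_into (slots v \<times> UNIV)"

definition live :: "'e \<Rightarrow> bool" where
  "live e \<longleftrightarrow> e \<in> arcs E \<and> head E e \<notin> H"

text \<open>At a regular vertex saturation supplies an edge with range outside \<open>H\<close>, at
  a vertex of \<open>S\<close> the definition of \<open>B_of\<close> does; elsewhere
  \<open>None\<close> is a slot. Hence the pieces fill a whole copy of the naturals.\<close>

lemma slots_nonempty: "v \<in> verts E \<Longrightarrow> v \<notin> H \<Longrightarrow> slots v \<noteq> {}"
proof -
  assume v: "v \<in> verts E" "v \<notin> H"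
  have "arcs_avoiding E H v \<noteq> {}" if r: "regular_vertex E v"
  proof -
    obtain e where "e \<in> out_arcs E v" "head E e \<notin> H" using saturated[OF v(1) r] v(2) by blast
    then show ?thesis unfolding arcs_avoiding_def by blast
  qed
  moreover have "arcs_avoiding E H v \<noteq> {}" if "v \<in> S" using that S_B by (auto simp: B_of_def)
  ultimately show ?thesis by (auto simp: slots_def)
qed

lemma countable_slots: "countable (slots v)"
proof -
  have "arcs_avoiding E H v \<subseteq> arcs E" by (auto simp: arcs_avoiding_def)
  then have "countable (arcs_avoiding E H v)" using countable_arcs countable_subset by blast
  then show ?thesis by (simp add: slots_def)
qed

lemma dec_enc:
  assumes "s \<in> slots v"
  shows "dec v (enc v (s, n)) = (s, n)"
proof -
  have "countable (slots v \<times> (UNIV :: nat set))" using countable_slots by (intro countable_SIGMA) simp_all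
  then show ?thesis unfolding dec_def enc_def using assms by (intro from_nat_into_to_nat_on) simp_all
qed

lemma enc_dec:
  assumes "v \<in> verts E" "v \<notin> H"
  shows "enc v (dec v m) = m" "fst (dec v m) \<in> slots v"
proof -
  have c: "countable (slots v \<times> (UNIV :: nat set))" using countable_slots by (intro countable_SIGMA) simp_all
  have "infinite (slots v \<times> (UNIV :: nat set))"
    using slots_nonempty[OF assms] by (simp add: finite_cartesian_product_iff)
  then show "enc v (dec v m) = m" unfolding dec_def enc_def using c by (intro to_nat_on_from_nat_into_infinite)
  have "dec v m \<in> slots v \<times> UNIV"
    unfolding dec_def using slots_nonempty[OF assms] by (intro from_nat_into) simp
  then show "fst (dec v m) \<in> slots v" by auto
qed

lemma live_tail: "live e \<Longrightarrow> tail E e \<in> verts E \<and> tail E e \<notin> H \<and> head E e \<in> verts E \<and> Some e \<in> slots (tail E e)"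
  using hereditary by (auto simp: live_def slots_def arcs_avoiding_def in_out_arcs_conv)

section \<open>The representation on functions and its annihilator\<close>

fun act_gen :: "('v, 'e) generator \<Rightarrow> ('v \<times> nat \<Rightarrow> 'k::field) \<Rightarrow> 'v \<times> nat \<Rightarrow> 'k" where
  "act_gen (Vertex v) g (u, m) = (if v \<in> verts E \<and> v \<notin> H \<and> u = v then g (u, m) else 0)"
| "act_gen (Edge e) g (u, m) =
     (if live e \<and> u = tail E e \<and> fst (dec u m) = Some e then g (head E e, snd (dec u m)) else 0)"
| "act_gen (Ghost e) g (u, m) =
     (if live e \<and> u = head E e then g (tail E e, enc (tail E e) (Some e, m)) else 0)"

definition act_word :: "('v, 'e) generator word \<Rightarrow> ('v \<times> nat \<Rightarrow> 'k::field) \<Rightarrow> 'v \<times> nat \<Rightarrow> 'k" where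
  "act_word w g = foldr act_gen (letters w) g"

definition act :: "('v, 'e, 'k::field) free_element \<Rightarrow> ('v \<times> nat \<Rightarrow> 'k) \<Rightarrow> 'v \<times> nat \<Rightarrow> 'k" where
  "act a g x = (\<Sum>w\<in>Poly_Mapping.keys a. Poly_Mapping.lookup a w * act_word w g x)"

lemma act_gen_add: "act_gen s (\<lambda>x. g x + h x) = (\<lambda>x. act_gen s g x + act_gen s h x)"
proof
  fix x show "act_gen s (\<lambda>x. g x + h x) x = act_gen s g x + act_gen s h x"
    by (cases s; cases x) auto
qed

lemma act_gen_scale: "act_gen s (\<lambda>x. c * g x) = (\<lambda>x. c * act_gen s g x)"
proof
  fix x show "act_gen s (\<lambda>x. c * g x) x = c * act_gen s g x"
    by (cases s; cases x) auto
qed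

lemma act_word_add: "act_word w (\<lambda>x. g x + h x) = (\<lambda>x. act_word w g x + act_word w h x)"
proof -
  have "foldr act_gen l (\<lambda>x. g x + h x) = (\<lambda>x. foldr act_gen l g x + foldr act_gen l h x)" for l
    by (induction l) (simp_all add: act_gen_add)
  then show ?thesis by (simp add: act_word_def)
qed

lemma act_word_scale: "act_word w (\<lambda>x. c * g x) = (\<lambda>x. c * act_word w g x)"
proof -
  have "foldr act_gen l (\<lambda>x. c * g x) = (\<lambda>x. c * foldr act_gen l g x)" for l
    by (induction l) (simp_all add: act_gen_scale)
  then show ?thesis by (simp add: act_word_def)
qed

lemma act_word_plus: "act_word (u + w) g = act_word u (act_word w g)"
  by (simp add: act_word_def)

lemma act_superset:
  assumes "finite T" "Poly_Mapping.keys a \<subseteq> T"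
  shows "act a g x = (\<Sum>w\<in>T. Poly_Mapping.lookup a w * act_word w g x)"
  unfolding act_def using assms by (intro sum.mono_neutral_left) (auto simp: in_keys_iff)

lemma act_add: "act (a + b) g x = act a g x + act b g x"
proof -
  let ?T = "Poly_Mapping.keys a \<union> Poly_Mapping.keys b"
  have "Poly_Mapping.keys (a + b) \<subseteq> ?T" by (rule Poly_Mapping.keys_add)
  then have "act (a + b) g x = (\<Sum>w\<in>?T. Poly_Mapping.lookup (a + b) w * act_word w g x)"
    by (intro act_superset) simp_all
  also have "\<dots> = (\<Sum>w\<in>?T. Poly_Mapping.lookup a w * act_word w g x) + (\<Sum>w\<in>?T. Poly_Mapping.lookup b w * act_word w g x)"
    by (simp add: lookup_add distrib_right sum.distrib)
  also have "\<dots> = act a g x + act b g x"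
    by (intro arg_cong2[where f = "(+)"] act_superset[symmetric]) simp_all
  finally show ?thesis .
qed

lemma act_zero: "act 0 g x = 0" by (simp add: act_def)

lemma act_diff: "act (a - b) g x = act a g x - act b g x"
  using act_add[of "a - b" b g x] by simp

lemma act_single: "act (Poly_Mapping.single w c) g x = c * act_word w g x"
  by (simp add: act_def)

lemma act_single_mult: "act (Poly_Mapping.single w c * b) g x = c * act_word w (act b g) x"
proof (induction b arbitrary: x rule: poly_mapping_single_induct)
  case zero
  have "act_word w (\<lambda>x. 0 * g x) x = 0" unfolding act_word_scale by simp
  then show ?case by (simp add: act_zero[abs_def])
next
  case (add w' d b)
  have "act (Poly_Mapping.single w c * (Poly_Mapping.single w' d + b)) g x =
      c * d * act_word w (act_word w' g) x + c * act_word w (act b g) x"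
    by (simp add: distrib_left act_add mult_single act_single act_word_plus add.IH)
  moreover have "act (Poly_Mapping.single w' d + b) g = (\<lambda>x. d * act_word w' g x + act b g x)"
    by (simp add: act_add act_single fun_eq_iff)
  ultimately show ?case
    by (simp add: act_word_add act_word_scale distrib_left mult.assoc)
qed

lemma act_mult: "act (a * b) g x = act a (act b g) x"
proof (induction a rule: poly_mapping_single_induct)
  case (add w c a)
  then show ?case by (simp add: distrib_right act_add act_single_mult act_single)
qed (simp add: act_zero)

lemma act_gen: "act (gen s) g x = act_gen s g x"
  by (simp add: gen_def act_single act_word_def)

lemma act_gen_gen: "act (gen s * gen t) g x = act_gen s (act_gen t g) x"
  unfolding act_mult act_gen using act_gen[of t g] by presburger

lemma act_sum: "act (\<Sum>i\<in>X. a i) g x = (\<Sum>i\<in>X. act (a i) g x)"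
  by (induction X rule: infinite_finite_induct) (simp_all add: act_zero act_add)

lemma act_zero_right: "act a (\<lambda>_. 0 :: 'k::field) x = 0"
proof -
  have "act_word w (\<lambda>x. 0 * (0 :: 'k)) x = 0" for w unfolding act_word_scale by simp
  then show ?thesis by (simp add: act_def)
qed

text \<open>The ghost reads the piece of \<open>e\<close> and the edge writes it back, so
  \<open>e e\<^sup>*\<close> is the projection onto that piece.\<close>

lemma act_edge_ghost:
  "act (edg e * gho e) g (u, m) = (if live e \<and> u = tail E e \<and> fst (dec u m) = Some e then g (u, m) else 0)"
proof (cases "live e \<and> u = tail E e \<and> fst (dec u m) = Some e")
  case True
  then have "enc u (Some e, snd (dec u m)) = m"
    using enc_dec(1)[of u m] live_tail[of e] by (metis prod.collapse)
  then show ?thesis using True by (simp add: act_gen_gen)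
next
  case False
  then show ?thesis by (auto simp: act_gen_gen)
qed

lemma act_edge_ghost_sum:
  assumes "finite A" "A \<subseteq> out_arcs E v"
  shows "act (\<Sum>e\<in>A. edg e * gho e) g (u, m) =
    (if u = v \<and> (\<exists>e\<in>A. live e \<and> fst (dec u m) = Some e) then g (u, m) else 0)"
proof (cases "u = v \<and> (\<exists>e\<in>A. live e \<and> fst (dec u m) = Some e)")
  case True
  then obtain e where e: "e \<in> A" "live e" "fst (dec u m) = Some e" "u = v" by blast
  have "act (\<Sum>e\<in>A. edg e * gho e) g (u, m) = (\<Sum>f\<in>A. if e = f then g (u, m) else 0)"
    unfolding act_sum
  proof (rule sum.cong[OF refl])
    fix f assume "f \<in> A"
    then have "tail E f = v" using assms(2) by auto
    then show "act (edg f * gho f) g (u, m) = (if e = f then g (u, m) else 0)"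
      unfolding act_edge_ghost using e by auto
  qed
  then show ?thesis unfolding if_P[OF True] using e(1) assms(1) by simp
next
  case False
  have "act (edg f * gho f) g (u, m) = 0" if f: "f \<in> A" for f
  proof -
    have "tail E f = v" using f assms(2) by auto
    then show ?thesis unfolding act_edge_ghost using False f by auto
  qed
  then show ?thesis unfolding if_not_P[OF False] act_sum by simp
qed

text \<open>The projections \<open>e e\<^sup>*\<close> in the sum cover every piece except
  \<open>None\<close>, so what remains is the projection onto \<open>None\<close>.\<close>

lemma act_gap:
  assumes "v \<in> verts E" "v \<notin> H" "finite (arcs_avoiding E H v)"
  shows "act (gap E H v) g (u, m) = (if u = v \<and> fst (dec u m) = None then g (u, m) else 0)"
proof -
  have sub: "arcs_avoiding E H v \<subseteq> out_arcs E v" by (auto simp: arcs_avoiding_def)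
  have "(\<exists>e\<in>arcs_avoiding E H v. live e \<and> fst (dec u m) = Some e) \<longleftrightarrow> fst (dec u m) \<noteq> None" if "u = v"
    using enc_dec(2)[OF assms(1,2), of m] that
    by (auto simp: slots_def live_def arcs_avoiding_def split: if_splits)
  then show ?thesis
    using assms(1,2) unfolding gap_def act_diff act_edge_ghost_sum[OF assms(3) sub] by (auto simp: act_gen)
qed

definition annihilator :: "('v, 'e, 'k::field) free_element set" where
  "annihilator = {a. \<forall>g x. act a g x = 0}"

lemma annihilator_relations: "(lpa_relations E :: ('v, 'e, 'k::field) free_element set) \<subseteq> annihilator"
proof -
  let ?N = "annihilator :: ('v, 'e, 'k) free_element set"
  have eq: "a - b \<in> ?N" if "\<And>g u m. act a g (u, m) = act b g (u, m)" for a b :: "('v, 'e, 'k) free_element"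
    using that by (simp add: annihilator_def act_diff)
  have "gen (Vertex v) * gen (Vertex w) - (if v = w then gen (Vertex v) else 0) \<in> ?N" for v w
    by (rule eq) (auto simp: act_gen_gen act_gen act_zero)
  moreover have "gen (Vertex (tail E e)) * gen (Edge e) - gen (Edge e) \<in> ?N" for e
    using live_tail by (intro eq) (auto simp: act_gen_gen act_gen)
  moreover have "gen (Edge e) * gen (Vertex (head E e)) - gen (Edge e) \<in> ?N" for e
    using live_tail by (intro eq) (auto simp: act_gen_gen act_gen live_def)
  moreover have "gen (Vertex (head E e)) * gen (Ghost e) - gen (Ghost e) \<in> ?N" for e
    using live_tail by (intro eq) (auto simp: act_gen_gen act_gen live_def)
  moreover have "gen (Ghost e) * gen (Vertex (tail E e)) - gen (Ghost e) \<in> ?N" for e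
    using live_tail by (intro eq) (auto simp: act_gen_gen act_gen)
  moreover have "gen (Ghost e) * gen (Edge f) - (if e = f then gen (Vertex (head E e)) else 0) \<in> ?N"
    if e: "e \<in> arcs E" for e f
  proof (rule eq)
    fix g :: "'v \<times> nat \<Rightarrow> 'k" and u m
    have d: "dec (tail E e) (enc (tail E e) (Some e, m)) = (Some e, m)" if "live e"
      using dec_enc live_tail[OF that] by blast
    show "act (gen (Ghost e) * gen (Edge f)) g (u, m) = act (if e = f then gen (Vertex (head E e)) else 0) g (u, m)"
    proof (cases "live e \<and> u = head E e")
      case True
      then show ?thesis using d live_tail[of e] by (auto simp: act_gen_gen act_gen act_zero live_def)
    next
      case False
      then show ?thesis using e by (auto simp: act_gen_gen act_gen act_zero live_def)
    qed
  qed
  moreover have "gen (Vertex v) - (\<Sum>e \<in> out_arcs E v. gen (Edge e) * gen (Ghost e)) \<in> ?N"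
    if v: "v \<in> verts E" and r: "regular_vertex E v" for v
  proof (rule eq)
    fix g :: "'v \<times> nat \<Rightarrow> 'k" and u m
    have fin: "finite (out_arcs E v)" using r by (simp add: regular_vertex_def)
    \<comment> \<open>A regular vertex outside \<open>H\<close> has no slot \<open>None\<close>, so
      the pieces of its live edges exhaust its copy. Inside \<open>H\<close> there are no live edges
      and both sides are false.\<close>
    have "(u = v \<and> (\<exists>e\<in>out_arcs E v. live e \<and> fst (dec u m) = Some e)) \<longleftrightarrow> u = v \<and> v \<notin> H"
    proof (cases "v \<in> H")
      case True
      then have "\<not> live e" if "e \<in> out_arcs E v" for e
        using that live_tail by auto
      then show ?thesis using True by blast
    next
      case False
      have "fst (dec v m) \<in> slots v" by (rule enc_dec(2)[OF v False])
      then show ?thesis using r False by (auto simp: slots_def arcs_avoiding_def live_def)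
    qed
    then show "act (gen (Vertex v)) g (u, m) = act (\<Sum>e \<in> out_arcs E v. gen (Edge e) * gen (Ghost e)) g (u, m)"
      unfolding act_edge_ghost_sum[OF fin order_refl] using v by (simp add: act_gen)
  qed
  ultimately show ?thesis unfolding lpa_relations_def by (intro Un_least subsetI; clarify; blast)
qed

lemma lpa_ideal_annihilator: "lpa_ideal E annihilator"
proof (intro lpa_ideal.intro lpa_ideal_axioms.intro annihilator_relations wf_digraph)
  fix x a :: "('v, 'e, 'k::field) free_element" assume x: "x \<in> annihilator"
  then have "act x g = (\<lambda>_. 0)" for g by (simp add: annihilator_def fun_eq_iff)
  then show "a * x \<in> annihilator" by (simp add: annihilator_def act_mult act_zero_right)
  show "x * a \<in> annihilator" using x by (simp add: annihilator_def act_mult)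
qed (simp_all add: annihilator_def act_zero act_add)

lemma vtx_annihilator_iff:
  assumes "v \<in> verts E"
  shows "(vtx v :: ('v, 'e, 'k::field) free_element) \<in> annihilator \<longleftrightarrow> v \<in> H"
proof
  assume "(vtx v :: ('v, 'e, 'k) free_element) \<in> annihilator"
  then have "act (vtx v) (\<lambda>_. 1 :: 'k) (v, 0) = 0" unfolding annihilator_def by blast
  then show "v \<in> H" using assms by (simp add: act_gen split: if_splits)
qed (simp add: annihilator_def act_gen)

text \<open>A vertex of \<open>B_of E H\<close> is an infinite emitter, hence not regular, so it has
  the slot \<open>None\<close> exactly when it is outside \<open>S\<close>.\<close>

lemma gap_annihilator_iff:
  assumes "v \<in> B_of E H"
  shows "(gap E H v :: ('v, 'e, 'k::field) free_element) \<in> annihilator \<longleftrightarrow> v \<in> S"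
proof -
  have v: "v \<in> verts E" "v \<notin> H" "finite (arcs_avoiding E H v)" "\<not> regular_vertex E v"
    using assms by (auto simp: B_of_def infinite_emitter_def regular_vertex_def)
  show ?thesis
  proof
    assume g: "(gap E H v :: ('v, 'e, 'k) free_element) \<in> annihilator"
    show "v \<in> S"
    proof (rule ccontr)
      assume "v \<notin> S"
      then have "dec v (enc v (None, 0)) = (None, 0)" using v(4) by (intro dec_enc) (simp add: slots_def)
      then have "act (gap E H v) (\<lambda>_. 1 :: 'k) (v, enc v (None, 0)) = 1" by (simp add: act_gap[OF v(1-3)])
      then show False using g by (simp add: annihilator_def)
    qed
  next
    assume "v \<in> S"
    then have nn: "fst (dec v m) \<noteq> None" for m
      using enc_dec(2)[OF v(1,2), of m] by (auto simp: slots_def)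
    have "act (gap E H v) g (u, m) = 0" for g :: "'v \<times> nat \<Rightarrow> 'k" and u m
      unfolding act_gap[OF v(1-3)] using nn[of m] by (cases "u = v") auto
    then show "(gap E H v :: ('v, 'e, 'k) free_element) \<in> annihilator"
      by (simp add: annihilator_def)
  qed
qed

end

section \<open>Graph ideals and the annihilator\<close>

lemma gap_mem_free_nonunital:
  fixes E :: "('v, 'e) pre_digraph"
  assumes "wf_digraph E" "v \<in> verts E"
  shows "(gap E H v :: ('v, 'e, 'k::field) free_element) \<in> carrier (free_nonunital E)"
proof -
  let ?C = "carrier (free_nonunital E) :: ('v, 'e, 'k) free_element set"
  have t: "edg e * gho e \<in> ?C" if "e \<in> arcs_avoiding E H v" for e
    using that by (intro free_nonunital_closed(5) gen_in_free_nonunital)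
      (auto simp: arcs_avoiding_def generators_def)
  have "(\<Sum>e\<in>A. edg e * gho e) \<in> ?C" if "A \<subseteq> arcs_avoiding E H v" for A
    using that by (induction A rule: infinite_finite_induct)
      (simp_all add: free_nonunital_closed(1) free_nonunital_closed(2) t)
  then show ?thesis
    unfolding gap_def using assms(2)
    by (intro free_nonunital_closed(4) gen_in_free_nonunital) (auto simp: generators_def)
qed

lemma graph_ideal_generators_subset:
  fixes E :: "('v, 'e) pre_digraph"
  assumes "wf_digraph E" "H \<subseteq> verts E" "S \<subseteq> verts E"
  shows "lpa_vertex E ` H \<union> lpa_gap_vertex E H ` S \<subseteq> carrier (leavitt_path_algebra E :: ('v, 'e, 'k::field) lpa)"
proof -
  have "vtx v \<in> (carrier (free_nonunital E) :: ('v, 'e, 'k) free_element set)" if "v \<in> H" for v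
    using that assms(2) by (intro gen_in_free_nonunital) (auto simp: generators_def)
  moreover have "gap E H v \<in> (carrier (free_nonunital E) :: ('v, 'e, 'k) free_element set)" if "v \<in> S" for v
    using gap_mem_free_nonunital[OF assms(1)] that assms(3) by blast
  ultimately show ?thesis
    unfolding lpa_carrier lpa_vertex_def lpa_gap_vertex_conv by blast
qed

lemma two_sided_ideal_graph_ideal:
  fixes E :: "('v, 'e) pre_digraph"
  assumes "wf_digraph E" "H \<subseteq> verts E" "S \<subseteq> verts E"
  shows "two_sided_ideal (graph_ideal E H S) (leavitt_path_algebra E :: ('v, 'e, 'k::field) lpa)"
proof -
  interpret L: nonunital_ring "leavitt_path_algebra E :: ('v, 'e, 'k) lpa"
    by (rule nonunital_ring_lpa[OF assms(1)])
  show ?thesis unfolding graph_ideal_def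
    by (rule L.two_sided_ideal_generated[OF graph_ideal_generators_subset[OF assms]])
qed

context graph_with_ideal_data
begin

text \<open>This bounds the graph ideal from above: a vertex or gap vertex that acts nontrivially
  lies outside it.\<close>

lemma graph_ideal_subset_annihilator:
  "(graph_ideal E H S :: ('v, 'e, 'k::field) free_element set set)
     \<subseteq> lpa_class E ` (annihilator \<inter> carrier (free_nonunital E))"
proof -
  let ?I = "lpa_class E ` (annihilator \<inter> carrier (free_nonunital E)) :: ('v, 'e, 'k) free_element set set"
  interpret A: lpa_ideal E "annihilator :: ('v, 'e, 'k) free_element set" by (rule lpa_ideal_annihilator)
  show ?thesis
    unfolding graph_ideal_def
  proof (rule ideal_generated_subset[OF A.two_sided_ideal_image], rule Un_least)
    show "lpa_vertex E ` H \<subseteq> ?I"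
      using vtx_annihilator_iff A.vtx_mem_free_nonunital H_verts unfolding lpa_vertex_def by blast
    show "lpa_gap_vertex E H ` S \<subseteq> ?I"
    proof
      fix z :: "('v, 'e, 'k) free_element set" assume "z \<in> lpa_gap_vertex E H ` S"
      then obtain v where v: "v \<in> S" "z = lpa_class E (gap E H v)" unfolding lpa_gap_vertex_conv by blast
      have vB: "v \<in> B_of E H" "v \<in> verts E" using v(1) S_B by (auto simp: B_of_def)
      show "z \<in> ?I"
        using gap_annihilator_iff[OF vB(1)] gap_mem_free_nonunital[OF wf_digraph vB(2)] v by blast
    qed
  qed
qed

lemma vertex_in_graph_ideal_iff:
  assumes "v \<in> verts E"
  shows "lpa_vertex E v \<in> (graph_ideal E H S :: ('v, 'e, 'k::field) free_element set set) \<longleftrightarrow> v \<in> H"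
proof
  interpret A: lpa_ideal E "annihilator :: ('v, 'e, 'k) free_element set" by (rule lpa_ideal_annihilator)
  assume "lpa_vertex E v \<in> (graph_ideal E H S :: ('v, 'e, 'k) free_element set set)"
  then show "v \<in> H"
    using graph_ideal_subset_annihilator A.class_mem_image_iff[OF A.vtx_mem_free_nonunital[OF assms]]
      vtx_annihilator_iff[OF assms] unfolding lpa_vertex_def by blast
next
  assume "v \<in> H"
  then show "lpa_vertex E v \<in> (graph_ideal E H S :: ('v, 'e, 'k) free_element set set)"
    unfolding graph_ideal_def by (intro subsetD[OF subset_ideal_generated]) blast
qed

lemma gap_vertex_in_graph_ideal_iff:
  assumes "v \<in> B_of E H"
  shows "lpa_gap_vertex E H v \<in> (graph_ideal E H S :: ('v, 'e, 'k::field) free_element set set) \<longleftrightarrow> v \<in> S"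
proof
  interpret A: lpa_ideal E "annihilator :: ('v, 'e, 'k) free_element set" by (rule lpa_ideal_annihilator)
  have "v \<in> verts E" using assms by (simp add: B_of_def)
  note C = gap_mem_free_nonunital[OF wf_digraph this, of H]
  assume "lpa_gap_vertex E H v \<in> (graph_ideal E H S :: ('v, 'e, 'k) free_element set set)"
  then show "v \<in> S"
    using graph_ideal_subset_annihilator A.class_mem_image_iff[OF C]
      gap_annihilator_iff[OF assms] unfolding lpa_gap_vertex_conv by blast
next
  assume "v \<in> S"
  then show "lpa_gap_vertex E H v \<in> (graph_ideal E H S :: ('v, 'e, 'k) free_element set set)"
    unfolding graph_ideal_def by (intro subsetD[OF subset_ideal_generated]) blast
qed

end

section \<open>Descending idempotents in the quotient by a prime ideal\<close>

context lpa_ideal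
begin

text \<open>The mirror image of \<open>gap_edg\<close>, for paths that arrive at the gap vertex from
  the ghost side.\<close>

lemma gho_gap:
  assumes "finite (arcs_avoiding E H v)" "f \<in> arcs_avoiding E H v"
  shows "gho f * gap E H v \<approx> 0"
proof -
  have f: "f \<in> arcs E" "tail E f = v" and A: "arcs_avoiding E H v \<subseteq> arcs E"
    using assms(2) by (auto simp: arcs_avoiding_def)
  have "(\<Sum>e\<in>arcs_avoiding E H v. gho f * (edg e * gho e)) \<approx>
      (\<Sum>e\<in>arcs_avoiding E H v. if f = e then gho f else 0)"
  proof (rule eqv_sum)
    fix e assume e: "e \<in> arcs_avoiding E H v"
    show "gho f * (edg e * gho e) \<approx> (if f = e then gho f else 0)"
    proof (cases "f = e")
      case True
      have "(gho e * edg e) * gho e \<approx> vtx (head E e) * gho e"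
        using f True by (intro eqv_rmul gho_edg) simp
      also have "\<dots> \<approx> gho e" using f True by (intro vtx_gho) simp
      finally show ?thesis using True by (simp add: mult.assoc)
    next
      case False
      have "1 * (gho f * edg e) * gho e \<approx> 0"
        by (rule eqv_zero_mid[OF gho_edg_neq]) (use e A f False in auto)
      then show ?thesis using False by (simp add: mult.assoc)
    qed
  qed
  then have "(\<Sum>e\<in>arcs_avoiding E H v. gho f * (edg e * gho e)) \<approx> gho f"
    using assms by simp
  moreover have "gho f * vtx v \<approx> gho f" using gho_vtx[OF f(1)] f(2) by simp
  ultimately have "gho f * vtx v - (\<Sum>e\<in>arcs_avoiding E H v. gho f * (edg e * gho e)) \<approx> gho f - gho f"
    by (rule eqv_minus[rotated])
  then show ?thesis by (simp add: gap_def right_diff_distrib sum_distrib_left)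
qed

lemma gpath_gap:
  assumes "finite (arcs_avoiding E H v)" "awalk v p w" "p \<noteq> []" "head E (hd p) \<notin> H"
  shows "gpath p * gap E H v \<approx> 0"
proof (cases p)
  case (Cons e p')
  have "e \<in> arcs_avoiding E H v"
    using assms(2,4) awalk_ConsD[of v e p' w] Cons by (simp add: arcs_avoiding_def in_out_arcs_conv)
  from eqv_lmul[OF gho_gap[OF assms(1) this], of "gpath p'"] show ?thesis
    by (simp add: Cons mult.assoc)
qed (use assms in simp)

end

section \<open>Vertices and gap vertices outside a prime ideal\<close>

locale lpa_prime = lpa_ideal +
  fixes H S :: "'a set"
  assumes proper_factor:
    "\<And>a b. a \<in> carrier (free_nonunital E) \<Longrightarrow> b \<in> carrier (free_nonunital E) \<Longrightarrow>
       (\<And>x. x \<in> carrier (free_nonunital E) \<Longrightarrow> a * x * b \<in> P) \<Longrightarrow> a \<in> P \<or> b \<in> P"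
    and H_def: "H = {v \<in> verts E. vtx v \<in> P}"
    and S_def: "S = {v \<in> B_of E H. gap E H v \<in> P}"
begin

text \<open>A Boolean selects between vertex and gap vertex, so that both kinds of idempotents below
  \<open>v\<close> go through one argument.\<close>

definition mark :: "bool \<Rightarrow> 'a \<Rightarrow> ('a, 'b, 'c) free_element" where
  "mark g v = (if g then gap E H v else vtx v)"

definition marked :: "bool \<Rightarrow> 'a \<Rightarrow> bool" where
  "marked g v \<longleftrightarrow> (if g then v \<in> B_of E H - S else v \<in> verts E - H)"

lemma markedD:
  assumes "marked g v"
  shows "v \<in> verts E" "v \<notin> H" "mark g v \<notin> P" "vtx v * mark g v \<approx> mark g v" "mark g v * vtx v \<approx> mark g v"
    "mark g v * mark g v \<approx> mark g v" "mark g v \<in> carrier (free_nonunital E)"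
proof -
  show v: "v \<in> verts E" "v \<notin> H" using assms by (cases g; simp add: marked_def B_of_def)+
  show "mark g v \<notin> P"
  proof (cases g)
    case True
    then have "v \<in> B_of E H" "v \<notin> S" using assms by (simp_all add: marked_def)
    then have "gap E H v \<notin> P" using S_def by blast
    then show ?thesis using True by (simp add: mark_def)
  next
    case False
    then have "vtx v \<notin> P" using v H_def by blast
    then show ?thesis using False by (simp add: mark_def)
  qed
  show "vtx v * mark g v \<approx> mark g v" unfolding mark_def using vtx_gap[OF v(1)] vtx_vtx[OF v(1)] by simp
  show "mark g v * vtx v \<approx> mark g v" unfolding mark_def using gap_vtx[OF v(1)] vtx_vtx[OF v(1)] by simp
  show "mark g v * mark g v \<approx> mark g v"
  proof (cases g)
    case True
    then have "finite (arcs_avoiding E H v)" using assms by (auto simp: marked_def B_of_def)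
    then show ?thesis unfolding mark_def using gap_gap[OF v(1)] True by simp
  qed (simp add: mark_def vtx_vtx[OF v(1)])
  show "mark g v \<in> carrier (free_nonunital E)"
    by (cases g) (simp_all add: mark_def gap_mem_free_nonunital[OF wf_digraph v(1)] vtx_mem_free_nonunital[OF v(1)])
qed

lemma head_hd_notin_H:
  assumes "awalk v p y" "p \<noteq> []" "vtx y \<notin> P"
  shows "head E (hd p) \<notin> H"
proof
  assume "head E (hd p) \<in> H"
  then have "vtx (head E (hd p)) \<in> P" by (simp add: H_def)
  moreover have "awalk (head E (hd p)) (tl p) y" using assms(1,2) awalk_ConsD by (metis list.collapse)
  ultimately show False using awalk_mem assms(3) by blast
qed

text \<open>Primeness yields \<open>x\<close> with nonzero product between the marks, hence a
  monomial \<open>p y q\<^sup>*\<close> with this property. As \<open>y\<close> is outside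
  \<open>P\<close>, a nonempty path to \<open>y\<close> starts with an edge whose range is outside
  \<open>H\<close>, and a gap vertex kills such an edge; so the path at a gap vertex is
  empty.\<close>

lemma marks_connected:
  assumes s: "marked g v" and t: "marked h w"
  obtains p q y where "awalk v p y" "awalk w q y" "y \<in> verts E" "y \<notin> H" "g \<longrightarrow> p = []" "h \<longrightarrow> q = []"
proof -
  note sD = markedD[OF s] and tD = markedD[OF t]
  obtain x where x: "x \<in> carrier (free_nonunital E)" "mark g v * x * mark h w \<notin> P"
    using proper_factor[OF sD(7) tD(7)] sD(3) tD(3) by blast
  obtain m where m: "x * vtx w \<in> gspan m w"
    using gspan_free_algebra[OF tD(1)] x(1) free_nonunital_subset by blast
  have "mark g v * z * mark h w \<in> P"
    if z: "z \<in> gspan m w" and all: "\<And>u p y q. awalk u p y \<Longrightarrow> awalk w q y \<Longrightarrow>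
        mark g v * (epath p * vtx y * gpath q) * mark h w \<in> P" for z
    using z
  proof induction
    case (base z)
    then show ?case by (intro lmul_mem rmul_mem)
  next
    case (step z u p y q c)
    have "mark g v * (scalar c * (epath p * vtx y * gpath q)) * mark h w =
        scalar c * (mark g v * (epath p * vtx y * gpath q) * mark h w)"
      by (simp only: scalar_left mult.assoc)
    also have "\<dots> \<in> P" by (rule lmul_mem[OF all[OF step.hyps(2,3)]])
    finally show ?case unfolding distrib_left distrib_right using step.IH by (rule add_mem)
  qed
  moreover have "mark g v * (x * vtx w) * mark h w \<notin> P"
  proof -
    have "mark g v * (x * vtx w) * mark h w = mark g v * x * (vtx w * mark h w)" by (simp add: mult.assoc)
    also have "\<dots> \<approx> mark g v * x * mark h w" by (rule eqv_lmul[OF tD(4)])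
    finally show ?thesis using x(2) eqv_mem_iff by blast
  qed
  ultimately obtain u p y q where p: "awalk u p y" "awalk w q y"
    and nz: "mark g v * (epath p * vtx y * gpath q) * mark h w \<notin> P" using m by blast
  have y: "y \<in> verts E" by (rule awalk_last_in_verts[OF p(1)])
  have yP: "vtx y \<notin> P"
  proof
    assume "vtx y \<in> P"
    then have "mark g v * (epath p * vtx y * gpath q) * mark h w \<in> P" by (intro lmul_mem rmul_mem)
    with nz show False ..
  qed
  have uv: "u = v"
  proof (rule ccontr)
    assume "u \<noteq> v"
    then have z: "vtx v * epath p * vtx y \<approx> 0" using sD(1) by (intro vtx_epath_neq[OF p(1)]) auto
    have "mark g v * (epath p * vtx y * gpath q) * mark h w \<approx> mark g v * vtx v * (epath p * vtx y * gpath q) * mark h w"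
      by (intro eqv_rmul eqv_sym[OF sD(5)])
    also have "\<dots> = mark g v * (vtx v * epath p * vtx y) * (gpath q * mark h w)" by (simp add: mult.assoc)
    also have "\<dots> \<approx> 0" by (rule eqv_zero_mid[OF z])
    finally show False using nz by (simp add: eqv_zero_iff)
  qed
  have "p = []" if g
  proof (rule ccontr)
    assume ne: "p \<noteq> []"
    have fin: "finite (arcs_avoiding E H v)" using s that by (auto simp: marked_def B_of_def)
    have "mark g v * epath p \<approx> 0"
      using that gap_epath[OF fin p(1)[unfolded uv] ne head_hd_notin_H[OF p(1) ne yP]] by (simp add: mark_def)
    from eqv_zero_mid[OF this, of 1 "vtx y * gpath q * mark h w"]
    show False using nz by (simp add: eqv_zero_iff mult.assoc)
  qed
  moreover have "q = []" if h
  proof (rule ccontr)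
    assume ne: "q \<noteq> []"
    have fin: "finite (arcs_avoiding E H w)" using t that by (auto simp: marked_def B_of_def)
    have "gpath q * mark h w \<approx> 0"
      using that gpath_gap[OF fin p(2) ne head_hd_notin_H[OF p(2) ne yP]] by (simp add: mark_def)
    from eqv_zero_mid[OF this, of "mark g v * (epath p * vtx y)" 1]
    show False using nz by (simp add: eqv_zero_iff mult.assoc)
  qed
  moreover have "y \<notin> H" using yP H_def by blast
  ultimately show ?thesis using that[OF p(1)[unfolded uv] p(2) y] by blast
qed

text \<open>A vertex in \<open>R\<close> carries along every vertex that it reaches, and with it the
  gap vertex there. A gap vertex cannot be moved, which is why \<open>q\<close> must then be
  empty.\<close>

lemma mark_awalk_mem:
  assumes R: "lpa_ideal E R" "P \<subseteq> R"
    and t: "marked h w" "mark h w \<in> R"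
    and q: "awalk w q y" "y \<notin> H" "h \<longrightarrow> q = []" and g: "marked g y" "h \<Longrightarrow> g"
  shows "mark g y \<in> R"
proof (cases h)
  case True
  then have "q = []" using q(3) by blast
  then have "w = y" using q(1) by (simp add: awalk_Nil_iff)
  then show ?thesis using True t(2) g(2) by (simp add: mark_def)
next
  case False
  interpret R: lpa_ideal E R by (rule R(1))
  have "vtx w \<in> R" using t(2) False by (simp add: mark_def)
  then have "vtx y \<in> R" using R.awalk_mem[OF q(1)] by blast
  then have "vtx y * mark g y \<in> R" by (rule R.rmul_mem)
  moreover have "R.eqv (vtx y * mark g y) (mark g y)"
    using markedD(4)[OF g(1)] R(2) unfolding eqv_def R.eqv_def by blast
  ultimately show ?thesis using R.eqv_mem_iff by blast
qed

text \<open>The triple is kept instead of the element itself because the next idempotent is built by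
  prolonging the path and changing the mark at its end.\<close>

definition corner :: "'b list \<times> bool \<times> 'a \<Rightarrow> ('a, 'b, 'c) free_element" where
  "corner s = (case s of (l, g, v) \<Rightarrow> epath l * mark g v * gpath l)"

definition valid_corner :: "'b list \<times> bool \<times> 'a \<Rightarrow> bool" where
  "valid_corner s = (case s of (l, g, v) \<Rightarrow> marked g v \<and> (\<exists>u. awalk u l v))"

text \<open>Since \<open>l\<^sup>* l\<close> is the vertex \<open>v\<close>, conjugation by
  \<open>l\<close> carries the relation that \<open>N\<close> lies below the mark to the
  corners.\<close>

lemma corner_absorb:
  assumes s: "marked g v" "awalk u l v" and N: "vtx v * N \<approx> N" "N * vtx v \<approx> N"
    "mark g v * N \<approx> N" "N * mark g v \<approx> N"
  shows "(epath l * mark g v * gpath l) * (epath l * N * gpath l) \<approx> epath l * N * gpath l"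
    and "(epath l * N * gpath l) * (epath l * mark g v * gpath l) \<approx> epath l * N * gpath l"
proof -
  have mid: "A * gpath l * (epath l * B) \<approx> A * B"
    if "A * vtx v \<approx> A" "vtx v * B \<approx> B" for A B
  proof -
    have "A * gpath l * (epath l * B) \<approx> (A * vtx v) * gpath l * (epath l * (vtx v * B))"
      by (intro eqv_mult eqv_sym[OF that(1)] eqv_sym[OF that(2)] eqv_refl)
    also have "\<dots> = A * (vtx v * gpath l * epath l * vtx v) * B" by (simp add: mult.assoc)
    also have "\<dots> \<approx> A * vtx v * B" by (rule eqv_mid[OF gpath_epath_self[OF s(2)]])
    also have "\<dots> \<approx> A * B" by (rule eqv_rmul[OF that(1)])
    finally show ?thesis .
  qed
  have "(epath l * mark g v * gpath l) * (epath l * N * gpath l) = epath l * (mark g v * gpath l * (epath l * N)) * gpath l"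
    by (simp add: mult.assoc)
  also have "\<dots> \<approx> epath l * (mark g v * N) * gpath l" by (rule eqv_mid[OF mid[OF markedD(5)[OF s(1)] N(1)]])
  also have "\<dots> \<approx> epath l * N * gpath l" by (rule eqv_mid[OF N(3)])
  finally show "(epath l * mark g v * gpath l) * (epath l * N * gpath l) \<approx> epath l * N * gpath l" .
  have "(epath l * N * gpath l) * (epath l * mark g v * gpath l) = epath l * (N * gpath l * (epath l * mark g v)) * gpath l"
    by (simp add: mult.assoc)
  also have "\<dots> \<approx> epath l * (N * mark g v) * gpath l" by (rule eqv_mid[OF mid[OF N(2) markedD(4)[OF s(1)]]])
  also have "\<dots> \<approx> epath l * N * gpath l" by (rule eqv_mid[OF N(4)])
  finally show "(epath l * N * gpath l) * (epath l * mark g v * gpath l) \<approx> epath l * N * gpath l" .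
qed

lemma corner_idem: "valid_corner s \<Longrightarrow> corner s * corner s \<approx> corner s"
proof -
  assume s: "valid_corner s"
  obtain l g v where lgv: "s = (l, g, v)" by (cases s)
  obtain u where u: "marked g v" "awalk u l v" using s by (auto simp: valid_corner_def lgv)
  show ?thesis
    unfolding lgv corner_def prod.case
    by (rule corner_absorb(1)[OF u markedD(4)[OF u(1)] markedD(5)[OF u(1)] markedD(6)[OF u(1)] markedD(6)[OF u(1)]])
qed

text \<open>Multiplication by \<open>l\<^sup>*\<close> from the left and \<open>l\<close> from the
  right recovers the mark, which is outside \<open>P\<close>.\<close>

lemma corner_notin: "valid_corner s \<Longrightarrow> corner s \<notin> P"
proof
  assume s: "valid_corner s" and c: "corner s \<in> P"
  obtain l g v where lgv: "s = (l, g, v)" by (cases s)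
  obtain u where u: "marked g v" "awalk u l v" using s by (auto simp: valid_corner_def lgv)
  have "(vtx v * gpath l) * corner s * (epath l * vtx v) \<in> P" by (intro lmul_mem rmul_mem c)
  moreover have "(vtx v * gpath l) * corner s * (epath l * vtx v) \<approx> mark g v"
  proof -
    have "(vtx v * gpath l) * corner s * (epath l * vtx v) \<approx>
        (vtx v * gpath l) * (epath l * (vtx v * mark g v * vtx v) * gpath l) * (epath l * vtx v)"
      unfolding corner_def lgv prod.case
      by (intro eqv_mid eqv_sym[OF eqv_trans[OF eqv_rmul[OF markedD(4)] markedD(5)]] u(1))
    also have "\<dots> = (vtx v * gpath l * epath l * vtx v) * mark g v * (vtx v * gpath l * epath l * vtx v)"
      by (simp add: mult.assoc)
    also have "\<dots> \<approx> vtx v * mark g v * vtx v" by (intro eqv_mult gpath_epath_self[OF u(2)] eqv_refl)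
    also have "\<dots> \<approx> mark g v" by (rule eqv_trans[OF eqv_rmul[OF markedD(4)] markedD(5)]; rule u(1))
    finally show ?thesis .
  qed
  ultimately show False using eqv_mem_iff markedD(3)[OF u(1)] by blast
qed

lemma corner_mem_free_nonunital:
  assumes "valid_corner s"
  shows "corner s \<in> carrier (free_nonunital E)"
proof -
  obtain l g v where lgv: "s = (l, g, v)" by (cases s)
  obtain u where u: "marked g v" "awalk u l v" using assms by (auto simp: valid_corner_def lgv)
  have l: "set l \<subseteq> arcs E" using u(2) by (simp add: awalk_def)
  have "epath l * a \<in> carrier (free_nonunital E) \<and> a * gpath l \<in> carrier (free_nonunital E)"
    if "a \<in> carrier (free_nonunital E)" for a :: "('a, 'b, 'c) free_element"
    using l that
  proof (induction l arbitrary: a)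
    case (Cons e l)
    have "edg e * (epath l * a) \<in> carrier (free_nonunital E)"
      using Cons by (intro free_nonunital_closed(5)[OF edg_mem_free_nonunital]) simp_all
    moreover have "a * gpath l * gho e \<in> carrier (free_nonunital E)"
      using Cons by (intro free_nonunital_closed(5)[OF _ gho_mem_free_nonunital]) simp_all
    ultimately show ?case by (simp add: mult.assoc)
  qed simp
  then show ?thesis using markedD(7)[OF u(1)] by (simp add: corner_def lgv)
qed

text \<open>One step handles one mark \<open>h w\<close>: a common vertex \<open>y\<close> is
  reached from \<open>v\<close> by \<open>p\<close> and from \<open>w\<close> by \<open>q\<close>.
  The path \<open>p\<close> makes the new corner smaller than the old one, while \<open>q\<close>
  puts it into every ideal above \<open>P\<close> that contains the mark at
  \<open>w\<close>.\<close>

lemma corner_step: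
  assumes s: "valid_corner s" and t: "marked h w"
  shows "\<exists>s'. valid_corner s' \<and> corner s * corner s' \<approx> corner s' \<and> corner s' * corner s \<approx> corner s' \<and>
    (\<forall>R. lpa_ideal E R \<longrightarrow> P \<subseteq> R \<longrightarrow> mark h w \<in> R \<longrightarrow> corner s' \<in> R)"
proof -
  obtain l g v where lgv: "s = (l, g, v)" by (cases s)
  obtain u where u: "marked g v" "awalk u l v" using s by (auto simp: valid_corner_def lgv)
  obtain p q y where p: "awalk v p y" "awalk w q y" "y \<in> verts E" "y \<notin> H" "g \<longrightarrow> p = []" "h \<longrightarrow> q = []"
    using marks_connected[OF u(1) t] .
  \<comment> \<open>If either mark is a gap vertex, its path is empty and \<open>y\<close> is that
    vertex, so the gap vertex at \<open>y\<close> is again outside \<open>P\<close>. Otherwise the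
    vertex \<open>y\<close> serves.\<close>
  define g' where "g' = (g \<or> h)"
  have gD: "p = [] \<and> y = v" if g
  proof -
    have "p = []" using p(5) that by blast
    moreover have "y = v" using p(1) unfolding calculation by (simp add: awalk_Nil_iff)
    ultimately show ?thesis by blast
  qed
  have hD: "y = w" if h
  proof -
    have "q = []" using p(6) that by blast
    then show ?thesis using p(2) by (simp add: awalk_Nil_iff)
  qed
  have my: "marked g' y"
  proof (cases g)
    case True
    then show ?thesis using u(1) gD by (simp add: g'_def)
  next
    case False
    show ?thesis
    proof (cases h)
      case True
      then show ?thesis using t hD by (simp add: g'_def)
    next
      case False
      with \<open>\<not> g\<close> show ?thesis using p(3,4) by (simp add: marked_def g'_def)
    qed
  qed
  \<comment> \<open>The new corner before conjugation by \<open>l\<close>; it lies below the old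
    mark at \<open>v\<close>.\<close>
  let ?N = "epath p * mark g' y * gpath p"
  have lp: "awalk u (l @ p) y" using u(2) p(1) by (rule awalk_appendI)
  have vN: "vtx v * ?N \<approx> ?N"
  proof -
    have "vtx v * ?N \<approx> vtx v * (epath p * (vtx y * mark g' y) * gpath p)"
      by (intro eqv_lmul[where c = "vtx v"] eqv_mid eqv_sym[OF markedD(4)[OF my]])
    also have "\<dots> = (vtx v * epath p * vtx y) * (mark g' y * gpath p)" by (simp add: mult.assoc)
    also have "\<dots> \<approx> (epath p * vtx y) * (mark g' y * gpath p)" by (rule eqv_rmul[OF vtx_epath_vtx[OF p(1)]])
    also have "\<dots> = epath p * (vtx y * mark g' y) * gpath p" by (simp add: mult.assoc)
    also have "\<dots> \<approx> ?N" by (rule eqv_mid[OF markedD(4)[OF my]])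
    finally show ?thesis .
  qed
  have Nv: "?N * vtx v \<approx> ?N"
  proof -
    have "?N * vtx v = epath p * mark g' y * (gpath p * vtx v)" by (simp add: mult.assoc)
    also have "\<dots> \<approx> epath p * mark g' y * (vtx y * gpath p)" by (rule eqv_lmul[OF gpath_vtx[OF p(1)]])
    also have "\<dots> = epath p * (mark g' y * vtx y) * gpath p" by (simp add: mult.assoc)
    also have "\<dots> \<approx> ?N" by (rule eqv_mid[OF markedD(5)[OF my]])
    finally show ?thesis .
  qed
  have mN: "mark g v * ?N \<approx> ?N \<and> ?N * mark g v \<approx> ?N"
  proof (cases g)
    case True
    then have "p = []" "y = v" "g' = g" using gD by (simp_all add: g'_def)
    then show ?thesis using markedD(6)[OF u(1)] by simp
  next
    case False
    then have "mark g v = vtx v" by (simp add: mark_def)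
    then show ?thesis using vN Nv by simp
  qed
  have eq: "corner (l @ p, g', y) = epath l * ?N * gpath l" by (simp add: corner_def mult.assoc)
  have "mark g' y \<in> R" if R: "lpa_ideal E R" "P \<subseteq> R" "mark h w \<in> R" for R
    by (rule mark_awalk_mem[OF R(1,2) t R(3) p(2,4,6) my]) (simp_all add: g'_def)
  then have "corner (l @ p, g', y) \<in> R" if "lpa_ideal E R" "P \<subseteq> R" "mark h w \<in> R" for R
    using that unfolding corner_def prod.case by (intro lpa_ideal.lmul_mem lpa_ideal.rmul_mem) blast+
  moreover have "valid_corner (l @ p, g', y)" using my lp by (auto simp: valid_corner_def)
  moreover have "corner s * corner (l @ p, g', y) \<approx> corner (l @ p, g', y)"
    "corner (l @ p, g', y) * corner s \<approx> corner (l @ p, g', y)"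
    unfolding eq unfolding lgv corner_def prod.case using corner_absorb[OF u vN Nv] mN by blast+
  ultimately show ?thesis by blast
qed

text \<open>Countability of the vertices lets \<open>t\<close> enumerate all marks outside
  \<open>P\<close>. The step at \<open>n\<close> handles \<open>t n\<close>, so any ideal above
  \<open>P\<close> that contains a mark contains a member of the sequence.\<close>

lemma descending_corners:
  assumes nonempty: "marked g0 v0" and cnt: "countable (verts E)"
  obtains f :: "nat \<Rightarrow> ('a, 'b, 'c) free_element"
  where "\<And>n. f n \<in> carrier (free_nonunital E)" "\<And>n. f n \<notin> P" "\<And>n m. f n * f m \<approx> f (max n m)"
    "\<And>R g v. lpa_ideal E R \<Longrightarrow> P \<subseteq> R \<Longrightarrow> marked g v \<Longrightarrow> mark g v \<in> R \<Longrightarrow> \<exists>n. f n \<in> R"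
proof -
  let ?M = "{(g, v). marked g v}"
  have "?M \<subseteq> UNIV \<times> verts E" using markedD(1) by auto
  then have "countable ?M" by (rule countable_subset) (intro countable_SIGMA cnt, simp)
  moreover have "?M \<noteq> {}" using nonempty by blast
  ultimately have "\<exists>t :: nat \<Rightarrow> bool \<times> 'a. ?M = range t"
    using range_from_nat_into[of ?M] by metis
  then obtain t :: "nat \<Rightarrow> bool \<times> 'a" where t: "?M = range t" ..
  have tm: "marked (fst (t n)) (snd (t n))" for n
  proof -
    have "t n \<in> ?M" unfolding t by blast
    then show ?thesis by auto
  qed
  have "\<exists>s. \<forall>n. valid_corner (s n) \<and> (corner (s n) * corner (s (Suc n)) \<approx> corner (s (Suc n)) \<and>
      corner (s (Suc n)) * corner (s n) \<approx> corner (s (Suc n)) \<and>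
      (\<forall>R. lpa_ideal E R \<longrightarrow> P \<subseteq> R \<longrightarrow> mark (fst (t n)) (snd (t n)) \<in> R \<longrightarrow> corner (s (Suc n)) \<in> R))"
  proof (rule dependent_nat_choice)
    have "awalk v0 [] v0" using markedD(1)[OF nonempty] by (simp add: awalk_Nil_iff)
    then show "\<exists>s. valid_corner s" using nonempty unfolding valid_corner_def by blast
  qed (rule corner_step[OF _ tm])
  then obtain s where s: "\<And>n. valid_corner (s n)"
    "\<And>n. corner (s n) * corner (s (Suc n)) \<approx> corner (s (Suc n))"
    "\<And>n. corner (s (Suc n)) * corner (s n) \<approx> corner (s (Suc n))"
    "\<And>n R. lpa_ideal E R \<Longrightarrow> P \<subseteq> R \<Longrightarrow> mark (fst (t n)) (snd (t n)) \<in> R \<Longrightarrow> corner (s (Suc n)) \<in> R"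
    by blast
  have le: "corner (s n) * corner (s m) \<approx> corner (s m) \<and> corner (s m) * corner (s n) \<approx> corner (s m)"
    if "n \<le> m" for n m
    using that
  proof (induction m rule: dec_induct)
    case base
    show ?case using corner_idem[OF s(1)] by blast
  next
    case (step m)
    have "corner (s n) * corner (s (Suc m)) \<approx> corner (s n) * (corner (s m) * corner (s (Suc m)))"
      by (rule eqv_lmul[OF eqv_sym[OF s(2)]])
    also have "\<dots> = (corner (s n) * corner (s m)) * corner (s (Suc m))" by (simp add: mult.assoc)
    also have "\<dots> \<approx> corner (s m) * corner (s (Suc m))" using step.IH by (intro eqv_rmul) blast
    also have "\<dots> \<approx> corner (s (Suc m))" by (rule s(2))
    finally have 1: "corner (s n) * corner (s (Suc m)) \<approx> corner (s (Suc m))" .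
    have "corner (s (Suc m)) * corner (s n) \<approx> (corner (s (Suc m)) * corner (s m)) * corner (s n)"
      by (rule eqv_rmul[OF eqv_sym[OF s(3)]])
    also have "\<dots> = corner (s (Suc m)) * (corner (s m) * corner (s n))" by (simp add: mult.assoc)
    also have "\<dots> \<approx> corner (s (Suc m)) * corner (s m)" using step.IH by (intro eqv_lmul) blast
    also have "\<dots> \<approx> corner (s (Suc m))" by (rule s(3))
    finally show ?case using 1 by blast
  qed
  show ?thesis
  proof (rule that[of "\<lambda>n. corner (s n)"])
    show "corner (s n) * corner (s m) \<approx> corner (s (max n m))" for n m
      using le[of n m] le[of m n] by (cases "n \<le> m") (simp_all add: max_def)
    fix R g v assume R: "lpa_ideal E R" "P \<subseteq> R" and gv: "marked g v" "mark g v \<in> R"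
    have "(g, v) \<in> range t" using gv(1) unfolding t[symmetric] by blast
    then obtain n where "t n = (g, v)" by (metis rangeE)
    then show "\<exists>n. corner (s n) \<in> R" using s(4)[OF R, of n] gv(2) by auto
  qed (use corner_mem_free_nonunital corner_notin s(1) in blast)+
qed

end

section \<open>Prime and primitive ideals\<close>

context nonunital_ring
begin

text \<open>Colon ideals replace \<open>J1\<close> and \<open>J2\<close> by ideals strictly above
  \<open>Q\<close> whose product is still in \<open>Q\<close>. Being above \<open>Q\<close> is what
  provides a further vertex or gap vertex.\<close>

lemma ideal_prod_colon_ideals:
  assumes Q: "two_sided_ideal Q A" and J1: "two_sided_ideal J1 A" and J2: "two_sided_ideal J2 A"
    and prod: "ideal_prod A J1 J2 \<subseteq> Q" and n1: "\<not> J1 \<subseteq> Q" and n2: "\<not> J2 \<subseteq> Q"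
  obtains T1 T2 where "two_sided_ideal T1 A" "two_sided_ideal T2 A" "Q \<subset> T1" "Q \<subset> T2"
    "\<And>x y. x \<in> T1 \<Longrightarrow> y \<in> T2 \<Longrightarrow> x \<otimes> y \<in> Q"
proof -
  note QD = two_sided_idealD[OF Q] and D1 = two_sided_idealD[OF J1] and D2 = two_sided_idealD[OF J2]
  define T1 where "T1 = {x \<in> carrier A. \<forall>y \<in> J2. x \<otimes> y \<in> Q}"
  define T2 where "T2 = {y \<in> carrier A. \<forall>x \<in> T1. x \<otimes> y \<in> Q}"
  have c2: "y \<in> carrier A" if "y \<in> J2" for y using D2(1) that by blast
  have T1: "two_sided_ideal T1 A"
  proof (rule two_sided_idealI)
    show "T1 \<subseteq> carrier A" by (auto simp: T1_def)
    show "\<zero> \<in> T1" using QD(2) c2 by (simp add: T1_def)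
    show "x \<oplus> y \<in> T1" if "x \<in> T1" "y \<in> T1" for x y
      using that QD(3) c2 by (simp add: T1_def l_distr)
    show "\<ominus> x \<in> T1" if "x \<in> T1" for x
      using that QD(4) c2 by (simp add: T1_def minus_mult)
    show "a \<otimes> x \<in> T1" if "a \<in> carrier A" "x \<in> T1" for a x
      using that QD(6) c2 by (simp add: T1_def m_assoc m_closed)
    show "x \<otimes> a \<in> T1" if "a \<in> carrier A" "x \<in> T1" for a x
      using that D2(6) c2 by (simp add: T1_def m_assoc m_closed)
  qed
  note DT1 = two_sided_idealD[OF T1]
  have c1: "x \<in> carrier A" if "x \<in> T1" for x using DT1(1) that by blast
  have T2: "two_sided_ideal T2 A"
  proof (rule two_sided_idealI)
    show "T2 \<subseteq> carrier A" by (auto simp: T2_def)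
    show "\<zero> \<in> T2" using QD(2) c1 by (simp add: T2_def)
    show "x \<oplus> y \<in> T2" if "x \<in> T2" "y \<in> T2" for x y
      using that QD(3) c1 by (simp add: T2_def r_distr)
    show "\<ominus> x \<in> T2" if "x \<in> T2" for x
      using that QD(4) c1 by (simp add: T2_def mult_minus)
    show "a \<otimes> x \<in> T2" if "a \<in> carrier A" "x \<in> T2" for a x
      using that DT1(7) c1 by (simp add: T2_def m_assoc[symmetric] m_closed)
    show "x \<otimes> a \<in> T2" if "a \<in> carrier A" "x \<in> T2" for a x
      using that QD(7) c1 by (simp add: T2_def m_assoc[symmetric] m_closed)
  qed
  have "Q \<subseteq> T1" using QD(1,7) c2 unfolding T1_def by blast
  moreover have "J1 \<subseteq> T1"
    using D1(1) prod ideal_prod.prod[of _ J1 _ J2 A] unfolding T1_def by blast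
  moreover have "Q \<subseteq> T2" using QD(1,6) c1 unfolding T2_def by blast
  moreover have "J2 \<subseteq> T2" using D2(1) unfolding T1_def T2_def by blast
  ultimately have "Q \<subset> T1" "Q \<subset> T2" using n1 n2 by blast+
  moreover have "x \<otimes> y \<in> Q" if "x \<in> T1" "y \<in> T2" for x y using that by (simp add: T2_def)
  ultimately show ?thesis using that[OF T1 T2] by blast
qed

text \<open>Instead of generating ideals from \<open>a\<close> and \<open>b\<close>, the proof takes
  all \<open>x\<close> with \<open>x A b \<subseteq> I\<close>, and then all \<open>z\<close> with
  \<open>T1 A z \<subseteq> I\<close>. These contain \<open>a\<close> and \<open>b\<close>.\<close>

lemma prime_ideal_elementwise:
  assumes right_units: "\<And>x. x \<in> carrier A \<Longrightarrow> \<exists>u \<in> carrier A. x \<otimes> u = x"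
    and I: "I \<in> prime_ideals A" and ab: "a \<in> carrier A" "b \<in> carrier A"
    and all: "\<And>x. x \<in> carrier A \<Longrightarrow> a \<otimes> x \<otimes> b \<in> I"
  shows "a \<in> I \<or> b \<in> I"
proof -
  have id: "two_sided_ideal I A" using I by (simp add: prime_ideals_def)
  note D = two_sided_idealD[OF id]
  define T1 where "T1 = {x \<in> carrier A. \<forall>y \<in> carrier A. x \<otimes> y \<otimes> b \<in> I}"
  define T2 where "T2 = {z \<in> carrier A. \<forall>x \<in> T1. \<forall>y \<in> carrier A. x \<otimes> y \<otimes> z \<in> I}"
  have T1: "two_sided_ideal T1 A"
  proof (rule two_sided_idealI)
    show "T1 \<subseteq> carrier A" by (auto simp: T1_def)
    show "\<zero> \<in> T1" using D(2) ab by (simp add: T1_def)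
    show "x \<oplus> y \<in> T1" if "x \<in> T1" "y \<in> T1" for x y
      using that D(3) ab by (simp add: T1_def l_distr m_closed)
    show "\<ominus> x \<in> T1" if "x \<in> T1" for x
      using that D(4) ab by (simp add: T1_def minus_mult m_closed)
    show "c \<otimes> x \<in> T1" if cx: "c \<in> carrier A" "x \<in> T1" for c x
    proof -
      have "c \<otimes> x \<otimes> y \<otimes> b \<in> I" if y: "y \<in> carrier A" for y
      proof -
        have "c \<otimes> x \<otimes> y \<otimes> b = c \<otimes> (x \<otimes> y \<otimes> b)"
          using cx y ab by (simp add: T1_def m_assoc m_closed)
        then show ?thesis using D(6)[OF cx(1)] cx(2) y by (simp add: T1_def)
      qed
      then show ?thesis using cx by (simp add: T1_def m_closed)
    qed
    show "x \<otimes> c \<in> T1" if "c \<in> carrier A" "x \<in> T1" for c x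
      using that ab m_assoc[of x c] by (simp add: T1_def m_closed)
  qed
  note DT1 = two_sided_idealD[OF T1]
  have c1: "x \<in> carrier A" if "x \<in> T1" for x using DT1(1) that by blast
  have T2: "two_sided_ideal T2 A"
  proof (rule two_sided_idealI)
    show "T2 \<subseteq> carrier A" by (auto simp: T2_def)
    show "\<zero> \<in> T2" using D(2) c1 by (simp add: T2_def m_closed)
    show "x \<oplus> y \<in> T2" if "x \<in> T2" "y \<in> T2" for x y
      using that D(3) c1 by (simp add: T2_def r_distr m_closed)
    show "\<ominus> x \<in> T2" if "x \<in> T2" for x
      using that D(4) c1 by (simp add: T2_def mult_minus m_closed)
    show "c \<otimes> x \<in> T2" if cx: "c \<in> carrier A" "x \<in> T2" for c x
    proof -
      have "z \<otimes> y \<otimes> (c \<otimes> x) \<in> I" if zy: "z \<in> T1" "y \<in> carrier A" for z y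
      proof -
        have "z \<otimes> y \<otimes> (c \<otimes> x) = z \<otimes> (y \<otimes> c) \<otimes> x"
          using cx zy c1 by (simp add: T2_def m_assoc m_closed)
        then show ?thesis using cx zy m_closed by (simp add: T2_def)
      qed
      then show ?thesis using cx by (simp add: T2_def m_closed)
    qed
    show "x \<otimes> c \<in> T2" if "c \<in> carrier A" "x \<in> T2" for c x
      using that D(7) c1 by (simp add: T2_def m_assoc[symmetric] m_closed)
  qed
  have "x \<in> I" if "x \<in> ideal_prod A T1 T2" for x
    using that
  proof induction
    case (prod i j)
    \<comment> \<open>The right unit inserts the middle factor that the definition of
      \<open>T2\<close> requires.\<close>
    then obtain u where u: "u \<in> carrier A" "i \<otimes> u = i" using right_units[OF c1] by blast
    have "i \<otimes> u \<otimes> j \<in> I" using prod u(1) unfolding T2_def by blast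
    then show ?case using u(2) by simp
  qed (rule D(3))
  then have "T1 \<subseteq> I \<or> T2 \<subseteq> I" using I T1 T2 unfolding prime_ideals_def by blast
  moreover have "a \<in> T1" using all ab by (simp add: T1_def)
  moreover have "b \<in> T2" using ab by (simp add: T2_def T1_def)
  ultimately show ?thesis by blast
qed

end

lemma full_mono: "I \<subseteq> J \<Longrightarrow> full E I \<subseteq> full E J"
  unfolding full_def extend_def by (rule Collect_mono, rule impI, erule bexE) auto

lemma full_vtx_iff: "v \<in> verts E \<Longrightarrow> vtx v \<in> full E I \<longleftrightarrow> lpa_vertex E v \<in> I"
  unfolding lpa_vertex_def by (rule full_mem_iff, rule gen_in_free_nonunital) (simp add: generators_def)

lemma full_gap_iff: "wf_digraph E \<Longrightarrow> v \<in> verts E \<Longrightarrow> gap E H v \<in> full E I \<longleftrightarrow> lpa_gap_vertex E H v \<in> I"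
  unfolding lpa_gap_vertex_conv by (rule full_mem_iff[OF gap_mem_free_nonunital])

section \<open>The Leavitt path algebra of a countable graph with Condition (K)\<close>

locale lpa_graph = wf_digraph E for E :: "('v, 'e) pre_digraph" +
  fixes L :: "('v, 'e, 'k::field) lpa"
  assumes L_def: "L = leavitt_path_algebra E"
    and K: "condition_K E"
    and countable_graph: "countable (verts E)" "countable (arcs E)"
begin

sublocale L: nonunital_ring L
  unfolding L_def by (rule nonunital_ring_lpa[OF wf_digraph])

definition ideal_verts :: "('v, 'e, 'k) free_element set set \<Rightarrow> 'v set" where
  "ideal_verts I = {v \<in> verts E. lpa_vertex E v \<in> I}"

definition ideal_gaps :: "('v, 'e, 'k) free_element set set \<Rightarrow> 'v set" where
  "ideal_gaps I = {v \<in> B_of E (ideal_verts I). lpa_gap_vertex E (ideal_verts I) v \<in> I}"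

lemma full_ideal: "two_sided_ideal I L \<Longrightarrow> lpa_ideal E (full E I)"
  unfolding L_def by (rule lpa_ideal_full[OF wf_digraph])

lemma ideal_verts_full: "ideal_verts I = {v \<in> verts E. vtx v \<in> full E I}"
  unfolding ideal_verts_def by (intro Collect_cong conj_cong refl full_vtx_iff[symmetric])

lemma B_of_verts: "v \<in> B_of E H \<Longrightarrow> v \<in> verts E"
  by (simp add: B_of_def)

lemma ideal_gaps_full: "ideal_gaps I = {v \<in> B_of E (ideal_verts I). gap E (ideal_verts I) v \<in> full E I}"
  unfolding ideal_gaps_def
  by (intro Collect_cong conj_cong refl full_gap_iff[OF wf_digraph, symmetric] B_of_verts)

lemma ideal_subsetI:
  assumes Q: "two_sided_ideal Q L" and T: "two_sided_ideal T L" and sub: "Q \<subseteq> T"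
    and v: "\<And>v. v \<in> ideal_verts T \<Longrightarrow> lpa_vertex E v \<in> Q"
    and g: "\<And>v. v \<in> ideal_gaps T \<Longrightarrow> lpa_gap_vertex E (ideal_verts T) v \<in> Q"
  shows "T \<subseteq> Q"
proof
  interpret Q: lpa_ideal E "full E Q" by (rule full_ideal[OF Q])
  fix x assume x: "x \<in> T"
  then have "x \<in> carrier L" using L.two_sided_idealD(1)[OF T] by blast
  then obtain a where a: "a \<in> carrier (free_nonunital E)" "x = lpa_class E a"
    unfolding L_def lpa_carrier by blast
  have "a \<in> full E Q"
  proof (rule Q.mem_of_larger_ideal[OF full_ideal[OF T] full_mono[OF sub] K ideal_verts_full _ _ a(1)])
    show "vtx v \<in> full E Q" if "v \<in> ideal_verts T" for v
      using v[OF that] that full_vtx_iff[of v E Q] by (simp add: ideal_verts_def)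
    show "gap E (ideal_verts T) v \<in> full E Q"
      if "v \<in> B_of E (ideal_verts T)" "gap E (ideal_verts T) v \<in> full E T" for v
      using g[of v] that full_gap_iff[OF wf_digraph B_of_verts[OF that(1)]] unfolding ideal_gaps_full by blast
    show "a \<in> full E T" using full_mem_iff[OF a(1)] x a(2) by blast
  qed
  then show "x \<in> Q" using full_mem_iff[OF a(1)] a(2) by blast
qed

text \<open>If \<open>T\<close> has no further vertex, then both ideals have the same vertex set, so
  their gap vertices are formed with the same \<open>H\<close> and can be compared.\<close>

lemma larger_ideal_marker:
  assumes Q: "two_sided_ideal Q L" and T: "two_sided_ideal T L" and sub: "Q \<subset> T"
  obtains (vertex) v where "v \<in> verts E" "v \<notin> ideal_verts Q" "lpa_vertex E v \<in> T"
  | (gap) v where "v \<in> B_of E (ideal_verts Q)" "v \<notin> ideal_gaps Q" "lpa_gap_vertex E (ideal_verts Q) v \<in> T"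
proof (cases "ideal_verts T \<subseteq> ideal_verts Q")
  case False
  then show ?thesis using vertex unfolding ideal_verts_def by blast
next
  case True
  then have eq: "ideal_verts T = ideal_verts Q" using sub unfolding ideal_verts_def by blast
  have "\<not> T \<subseteq> Q" using sub by blast
  then have "\<not> (\<forall>v \<in> ideal_gaps T. lpa_gap_vertex E (ideal_verts T) v \<in> Q)"
    using ideal_subsetI[OF Q T] sub eq unfolding ideal_verts_def by blast
  then obtain v where "v \<in> ideal_gaps T" "lpa_gap_vertex E (ideal_verts T) v \<notin> Q" by blast
  then have "v \<in> B_of E (ideal_verts Q)" "v \<notin> ideal_gaps Q" "lpa_gap_vertex E (ideal_verts Q) v \<in> T"
    unfolding ideal_gaps_def eq by blast+
  then show ?thesis by (rule gap)
qed

text \<open>The graph ideal contains the vertices and gap vertices of \<open>I\<close> by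
  construction and is contained in \<open>I\<close>, so \<open>ideal_subsetI\<close> gives the other
  inclusion.\<close>

lemma ideal_eq_graph_ideal:
  assumes I: "two_sided_ideal I L"
  shows "I = graph_ideal E (ideal_verts I) (ideal_gaps I)"
proof
  let ?G = "graph_ideal E (ideal_verts I) (ideal_gaps I)"
  have v: "ideal_verts I \<subseteq> verts E" "ideal_gaps I \<subseteq> verts E"
    using B_of_verts by (auto simp: ideal_verts_def ideal_gaps_def)
  have gen: "lpa_vertex E ` ideal_verts I \<union> lpa_gap_vertex E (ideal_verts I) ` ideal_gaps I \<subseteq> ?G"
    unfolding graph_ideal_def by (rule subset_ideal_generated)
  show GI: "?G \<subseteq> I"
    unfolding graph_ideal_def
    by (rule ideal_generated_subset[OF I[unfolded L_def]]) (auto simp: ideal_verts_def ideal_gaps_def)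
  show "I \<subseteq> ?G"
    by (rule ideal_subsetI[OF _ I GI]) (use gen two_sided_ideal_graph_ideal[OF wf_digraph v] L_def in blast)+
qed

lemma right_units: "x \<in> carrier L \<Longrightarrow> \<exists>u \<in> carrier L. x \<otimes>\<^bsub>L\<^esub> u = x"
proof -
  assume "x \<in> carrier L"
  then obtain a where a: "a \<in> carrier (free_nonunital E)" "x = lpa_class E a"
    unfolding L_def lpa_carrier by blast
  obtain u where u: "u \<in> carrier (free_nonunital E)" "a * u - a \<in> lpa_kernel E"
    using right_unit_kernel[OF wf_digraph a(1)] .
  have "lpa_class E a \<otimes>\<^bsub>L\<^esub> lpa_class E u = lpa_class E a"
    unfolding L_def lpa_ops(2)[OF wf_digraph a(1) u(1)]
    using lpa_ops(4)[OF wf_digraph free_nonunital_closed(5)[OF a(1) u(1)] a(1)] u(2) by blast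
  then show ?thesis using u(1) a(2) unfolding L_def lpa_carrier by blast
qed

lemma prime_full:
  assumes I: "I \<in> prime_ideals L"
  shows "lpa_prime E (full E I) (ideal_verts I) (ideal_gaps I)"
proof -
  have id: "two_sided_ideal I L" using I by (simp add: prime_ideals_def)
  interpret F: lpa_ideal E "full E I" by (rule full_ideal[OF id])
  show ?thesis
  proof (unfold_locales)
    fix a b :: "('v, 'e, 'k) free_element"
    assume a: "a \<in> carrier (free_nonunital E)" and b: "b \<in> carrier (free_nonunital E)"
      and all: "\<And>x. x \<in> carrier (free_nonunital E) \<Longrightarrow> a * x * b \<in> full E I"
    have c: "lpa_class E z \<in> carrier L" if "z \<in> carrier (free_nonunital E)" for z
      using that unfolding L_def lpa_carrier by blast
    have "lpa_class E a \<in> I \<or> lpa_class E b \<in> I"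
    proof (rule L.prime_ideal_elementwise[OF right_units I c[OF a] c[OF b]])
      fix x assume "x \<in> carrier L"
      then obtain z where z: "z \<in> carrier (free_nonunital E)" "x = lpa_class E z"
        unfolding L_def lpa_carrier by blast
      note az = free_nonunital_closed(5)[OF a z(1)]
      have "lpa_class E a \<otimes>\<^bsub>L\<^esub> x \<otimes>\<^bsub>L\<^esub> lpa_class E b = lpa_class E (a * z * b)"
        unfolding z(2) L_def lpa_ops(2)[OF wf_digraph a z(1)] lpa_ops(2)[OF wf_digraph az b] ..
      then show "lpa_class E a \<otimes>\<^bsub>L\<^esub> x \<otimes>\<^bsub>L\<^esub> lpa_class E b \<in> I"
        using all[OF z(1)] full_mem_iff[OF free_nonunital_closed(5)[OF az b]] by simp
    qed
    then show "a \<in> full E I \<or> b \<in> full E I"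
      using full_mem_iff[OF a] full_mem_iff[OF b] by blast
  qed (rule ideal_verts_full ideal_gaps_full)+
qed

text \<open>An ideal with all vertices contains the local units and is therefore the whole
  algebra.\<close>

lemma prime_proper_vertex:
  assumes I: "I \<in> prime_ideals L"
  obtains v where "v \<in> verts E" "v \<notin> ideal_verts I"
proof -
  have id: "two_sided_ideal I L" and ne: "I \<noteq> carrier L" using I by (simp_all add: prime_ideals_def)
  interpret F: lpa_ideal E "full E I" by (rule full_ideal[OF id])
  have "\<exists>v \<in> verts E. v \<notin> ideal_verts I"
  proof (rule ccontr)
    assume all: "\<not> ?thesis"
    have "x \<in> I" if x: "x \<in> carrier L" for x
    proof -
      obtain a where a: "a \<in> carrier (free_nonunital E)" "x = lpa_class E a"
        using x unfolding L_def lpa_carrier by blast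
      obtain Y where Y: "finite Y" "Y \<subseteq> verts E" "F.eqv a (\<Sum>v\<in>Y. a * vtx v)"
        using F.right_unit_sum[OF a(1)] .
      have "(\<Sum>v\<in>Y. a * vtx v) \<in> full E I"
        using all Y(2) unfolding ideal_verts_full by (intro F.sum_mem F.lmul_mem) blast
      then have "a \<in> full E I" using F.eqv_mem_iff[OF Y(3)] by blast
      then show ?thesis using full_mem_iff[OF a(1)] a(2) by blast
    qed
    then show False using ne L.two_sided_idealD(1)[OF id] by blast
  qed
  then show ?thesis using that by blast
qed

text \<open>A vertex outside \<open>I\<close> starts the descending sequence. The hypotheses on it
  are symmetric, so the same sequence gives left and right primitivity.\<close>

lemma prime_imp_primitive:
  assumes I: "I \<in> prime_ideals L"
  shows "left_primitive (L Quot I)" "right_primitive (L Quot I)"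
proof -
  have id: "two_sided_ideal I L" using I by (simp add: prime_ideals_def)
  interpret F: lpa_prime E "full E I" "ideal_verts I" "ideal_gaps I" by (rule prime_full[OF I])
  interpret Q: ring_mod_ideal L I
    by (intro ring_mod_ideal.intro ring_mod_ideal_axioms.intro L.nonunital_ring_axioms id)
  obtain v0 where v0: "v0 \<in> verts E" "v0 \<notin> ideal_verts I" using prime_proper_vertex[OF I] .
  then have "F.marked False v0" by (simp add: F.marked_def)
  then obtain f :: "nat \<Rightarrow> ('v, 'e, 'k) free_element" where
    f: "\<And>n. f n \<in> carrier (free_nonunital E)" "\<And>n. f n \<notin> full E I" "\<And>n m. F.eqv (f n * f m) (f (max n m))"
    "\<And>R g v. lpa_ideal E R \<Longrightarrow> full E I \<subseteq> R \<Longrightarrow> F.marked g v \<Longrightarrow> F.mark g v \<in> R \<Longrightarrow> \<exists>n. f n \<in> R"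
    using F.descending_corners[OF _ countable_graph(1)] by blast
  define h where "h n = lpa_class E (f n)" for n
  have h1: "h n \<in> carrier L" for n using f(1) unfolding h_def L_def lpa_carrier by blast
  have h2: "h n \<otimes>\<^bsub>L\<^esub> h m \<ominus>\<^bsub>L\<^esub> h (max n m) \<in> I" for n m
  proof -
    let ?d = "f n * f m - f (max n m)"
    have p: "f n * f m \<in> carrier (free_nonunital E)" by (rule free_nonunital_closed(5)[OF f(1) f(1)])
    have d: "?d \<in> carrier (free_nonunital E)" by (rule free_nonunital_closed(4)[OF p f(1)])
    have dI: "lpa_class E ?d \<in> I"
      using f(3)[of n m] full_mem_iff[OF d] unfolding F.eqv_def by blast
    have eq: "lpa_class E ?d \<oplus>\<^bsub>L\<^esub> h (max n m) = h n \<otimes>\<^bsub>L\<^esub> h m"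
      unfolding h_def L_def lpa_ops(1)[OF wf_digraph d f(1)] lpa_ops(2)[OF wf_digraph f(1) f(1)] by simp
    have "h n \<otimes>\<^bsub>L\<^esub> h m \<ominus>\<^bsub>L\<^esub> h (max n m) = lpa_class E ?d"
      unfolding eq[symmetric]
      using h1[of "max n m"] subsetD[OF L.two_sided_idealD(1)[OF id] dI]
      by (simp add: L.minus_eq L.a_assoc L.r_neg)
    then show ?thesis using dI by simp
  qed
  have h3: "h n \<notin> I" for n using f(2)[of n] full_mem_iff[OF f(1)] unfolding h_def by blast
  have h4: "\<exists>n. h n \<in> J" if J: "two_sided_ideal J L" "I \<subset> J" for J
  proof -
    have sub: "full E I \<subseteq> full E J" using J(2) by (intro full_mono) blast
    \<comment> \<open>A larger ideal contains a new vertex or gap vertex; this is the mark that the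
      sequence has met at some step.\<close>
    have "\<exists>g v. F.marked g v \<and> F.mark g v \<in> full E J"
    proof (rule larger_ideal_marker[OF id J])
      fix v assume v: "v \<in> verts E" "v \<notin> ideal_verts I" "lpa_vertex E v \<in> J"
      then have "F.marked False v \<and> F.mark False v \<in> full E J"
        using full_vtx_iff[OF v(1), of J] by (simp add: F.marked_def F.mark_def)
      then show ?thesis by blast
    next
      fix v assume v: "v \<in> B_of E (ideal_verts I)" "v \<notin> ideal_gaps I"
        "lpa_gap_vertex E (ideal_verts I) v \<in> J"
      then have "F.marked True v \<and> F.mark True v \<in> full E J"
        using full_gap_iff[OF wf_digraph B_of_verts[OF v(1)], of "ideal_verts I" J]
        by (simp add: F.marked_def F.mark_def)
      then show ?thesis by blast
    qed
    then obtain n where "f n \<in> full E J" using f(4)[OF full_ideal[OF J(1)] sub] by blast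
    then show ?thesis using full_mem_iff[OF f(1)] unfolding h_def by blast
  qed
  show "left_primitive (L Quot I)" by (rule Q.left_primitive_quot[OF h1 h2 h3 h4])
  show "right_primitive (L Quot I)" by (rule Q.right_primitive_quot[OF h1 h2 h3 h4])
qed

section \<open>The path preorder on vertices\<close>

lemma path_geI: "awalk v p w \<Longrightarrow> path_ge E v w"
  unfolding path_ge_def by blast

lemma path_ge_refl: "v \<in> verts E \<Longrightarrow> path_ge E v v"
  using path_geI[of v "[]" v] by (simp add: awalk_Nil_iff)

lemma path_geE:
  assumes "path_ge E v w"
  obtains p where "awalk v p w"
  using assms unfolding path_ge_def by (elim exE)

lemma path_ge_trans:
  assumes "path_ge E u v" "path_ge E v w"
  shows "path_ge E u w"
proof -
  obtain p where p: "awalk u p v" using assms(1) by (rule path_geE)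
  obtain q where q: "awalk v q w" using assms(2) by (rule path_geE)
  show ?thesis by (rule path_geI[OF awalk_appendI[OF p q]])
qed

lemma path_ge_arc: "e \<in> arcs E \<Longrightarrow> path_ge E (tail E e) (head E e)"
  by (rule path_geI[of "tail E e" "[e]"]) (simp add: awalk_Cons_iff awalk_Nil_iff)

lemma path_ge_verts:
  assumes "path_ge E v w"
  shows "v \<in> verts E \<and> w \<in> verts E"
proof -
  obtain p where p: "awalk v p w" using assms by (rule path_geE)
  show ?thesis by (rule conjI[OF awalk_hd_in_verts[OF p] awalk_last_in_verts[OF p]])
qed

lemma ideal_verts_path_ge:
  assumes "two_sided_ideal I L" "v \<in> ideal_verts I" "path_ge E v w"
  shows "w \<in> ideal_verts I"
proof -
  interpret F: lpa_ideal E "full E I" by (rule full_ideal[OF assms(1)])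
  obtain p where p: "awalk v p w" using assms(3) by (rule path_geE)
  have "vtx v \<in> full E I" using assms(2) unfolding ideal_verts_full by simp
  then have "vtx w \<in> full E I" by (rule F.awalk_mem[OF p])
  then show ?thesis using path_ge_verts[OF assms(3)] unfolding ideal_verts_full by simp
qed

definition special_ideals :: "('v, 'e, 'k) free_element set set set" where
  "special_ideals =
     {graph_ideal E (Omega E M) (B_of E (Omega E M)) | M. M \<in> maximal_tails E} \<union>
     {graph_ideal E (Omega E {v}) (B_of E (Omega E {v}) - {v}) | v. v \<in> breaking_vertices E}"

text \<open>If no gap vertex is missing from \<open>I\<close>, the complement of \<open>H\<close> is
  a maximal tail. If the one at \<open>v\<close> is missing, its connecting paths have length 0 on
  its side, so every vertex outside \<open>H\<close> reaches \<open>v\<close> itself.\<close>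

lemma prime_imp_special:
  assumes I: "I \<in> prime_ideals L"
  shows "I \<in> special_ideals"
proof -
  have id: "two_sided_ideal I L" using I by (simp add: prime_ideals_def)
  define H where "H = ideal_verts I"
  define S where "S = ideal_gaps I"
  have IG: "I = graph_ideal E H S" unfolding H_def S_def by (rule ideal_eq_graph_ideal[OF id])
  interpret F: lpa_prime E "full E I" H S unfolding H_def S_def by (rule prime_full[OF I])
  have H_verts: "H \<subseteq> verts E" by (auto simp: H_def ideal_verts_def)
  have H_ge: "w \<in> H" if "v \<in> H" "path_ge E v w" for v w
    using ideal_verts_path_ge[OF id] that unfolding H_def by blast
  show ?thesis
  proof (cases "S = B_of E H")
    case True
    define M where "M = verts E - H"
    have "M \<in> maximal_tails E"
      unfolding maximal_tails_def
    proof (intro CollectI conjI ballI impI)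
      show "M \<noteq> {}" using prime_proper_vertex[OF I] unfolding M_def H_def by blast
      show "M \<subseteq> verts E" by (auto simp: M_def)
      show "v \<in> M" if "v \<in> verts E" "w \<in> M" "path_ge E v w" for v w
        using that H_ge unfolding M_def by blast
      show "\<exists>e \<in> out_arcs E v. head E e \<in> M" if v: "v \<in> M" "regular_vertex E v" for v
      proof (rule ccontr)
        assume none: "\<not> ?thesis"
        have vv: "v \<in> verts E" using v(1) by (simp add: M_def)
        \<comment> \<open>If all ranges were in \<open>H\<close>, the relation at the regular vertex
          \<open>v\<close> would put \<open>v\<close> into \<open>I\<close>.\<close>
        have "(\<Sum>e\<in>out_arcs E v. edg e * gho e) \<in> full E I"
        proof (rule F.sum_mem)
          fix e assume e: "e \<in> out_arcs E v"
          then have "e \<in> arcs E" by simp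
          moreover have "head E e \<in> H" using none e head_in_verts[OF calculation] unfolding M_def by blast
          then have "vtx (head E e) \<in> full E I" unfolding H_def ideal_verts_full by blast
          ultimately show "edg e * gho e \<in> full E I" by (intro F.rmul_mem F.edg_mem)
        qed
        then have "vtx v \<in> full E I" using F.eqv_mem_iff[OF F.vtx_sum[OF vv v(2)]] by blast
        then show False using v(1) vv unfolding M_def H_def ideal_verts_full by blast
      qed
      show "\<exists>y\<in>M. path_ge E v y \<and> path_ge E w y" if vw: "v \<in> M" "w \<in> M" for v w
      proof -
        have "F.marked False v" "F.marked False w" using vw by (simp_all add: F.marked_def M_def)
        then obtain p q y where "awalk v p y" "awalk w q y" "y \<in> verts E" "y \<notin> H"
          by (rule F.marks_connected)
        then show ?thesis using path_geI unfolding M_def by blast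
      qed
    qed
    moreover have "Omega E M = H"
    proof
      show "Omega E M \<subseteq> H" by (auto simp: Omega_def M_def)
      show "H \<subseteq> Omega E M" using H_verts H_ge unfolding Omega_def M_def by blast
    qed
    ultimately show ?thesis using IG True unfolding special_ideals_def by blast
  next
    case False
    have "S \<subseteq> B_of E H" unfolding S_def H_def ideal_gaps_def by blast
    with False obtain v where v: "v \<in> B_of E H" "v \<notin> S" by blast
    have vH: "v \<in> verts E" "v \<notin> H" using v(1) by (auto simp: B_of_def)
    have mv: "F.marked True v" using v by (simp add: F.marked_def)
    have "w = v" if w: "w \<in> B_of E H" "w \<notin> S" for w
    proof -
      have "F.marked True w" using w by (simp add: F.marked_def)
      then obtain p q y where "awalk v p y" "awalk w q y" "True \<longrightarrow> p = []" "True \<longrightarrow> q = []"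
        using F.marks_connected[OF mv] by blast
      then show ?thesis by (simp add: awalk_Nil_iff)
    qed
    then have S: "S = B_of E H - {v}" using v \<open>S \<subseteq> B_of E H\<close> by blast
    have "Omega E {v} = H"
    proof
      show "H \<subseteq> Omega E {v}" using H_verts H_ge vH unfolding Omega_def by blast
      show "Omega E {v} \<subseteq> H"
      proof
        fix w assume w: "w \<in> Omega E {v}"
        show "w \<in> H"
        proof (rule ccontr)
          assume "w \<notin> H"
          then have "F.marked False w" using w by (simp add: F.marked_def Omega_def)
          then obtain p q y where pq: "awalk v p y" "awalk w q y" "True \<longrightarrow> p = []"
            using F.marks_connected[OF mv] by blast
          then have "v = y" by (simp add: awalk_Nil_iff)
          then show False using w path_geI[OF pq(2)] by (simp add: Omega_def)
        qed
      qed
    qed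
    moreover have "v \<in> breaking_vertices E"
      using v(1) calculation by (simp add: breaking_vertices_def B_of_def)
    ultimately show ?thesis using IG S unfolding special_ideals_def by blast
  qed
qed

text \<open>If the graph ideal were not prime, two ideals strictly above it would have their product
  inside it. By \<open>common\<close> they share a vertex or gap vertex outside it, and the square
  of this idempotent would lie in the graph ideal.\<close>

lemma special_prime_criterion:
  assumes data: "graph_with_ideal_data E H S" and w0: "w0 \<in> verts E" "w0 \<notin> H"
    and common: "\<And>T1 T2. two_sided_ideal T1 L \<Longrightarrow> two_sided_ideal T2 L \<Longrightarrow>
      (\<exists>v. v \<in> verts E \<and> v \<notin> H \<and> lpa_vertex E v \<in> T1) \<or> (\<exists>v. v \<in> B_of E H - S \<and> lpa_gap_vertex E H v \<in> T1) \<Longrightarrow>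
      (\<exists>v. v \<in> verts E \<and> v \<notin> H \<and> lpa_vertex E v \<in> T2) \<or> (\<exists>v. v \<in> B_of E H - S \<and> lpa_gap_vertex E H v \<in> T2) \<Longrightarrow>
      (\<exists>v. v \<in> verts E \<and> v \<notin> H \<and> lpa_vertex E v \<in> T1 \<inter> T2) \<or>
      (\<exists>v. v \<in> B_of E H - S \<and> lpa_gap_vertex E H v \<in> T1 \<inter> T2)"
  shows "graph_ideal E H S \<in> prime_ideals L"
proof -
  interpret D: graph_with_ideal_data E H S by (rule data)
  let ?Q = "graph_ideal E H S :: ('v, 'e, 'k) free_element set set"
  have S: "S \<subseteq> B_of E H" by (rule D.S_B)
  then have S_verts: "S \<subseteq> verts E" using B_of_verts by blast
  have Q: "two_sided_ideal ?Q L"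
    unfolding L_def by (rule two_sided_ideal_graph_ideal[OF wf_digraph D.H_verts S_verts])
  interpret F: lpa_ideal E "full E ?Q" by (rule full_ideal[OF Q])
  have verts: "ideal_verts ?Q = H"
    unfolding ideal_verts_def using D.vertex_in_graph_ideal_iff D.H_verts by blast
  have gaps: "ideal_gaps ?Q = S"
    unfolding ideal_gaps_def verts using D.gap_vertex_in_graph_ideal_iff S by blast
  \<comment> \<open>Idempotency is available as a congruence in the free algebra, hence the passage
    through \<open>full\<close>.\<close>
  have idem: "lpa_class E a \<in> ?Q"
    if "a \<in> carrier (free_nonunital E)" "F.eqv (a * a) a" "lpa_class E a \<otimes>\<^bsub>L\<^esub> lpa_class E a \<in> ?Q" for a
  proof -
    have "a * a \<in> full E ?Q"
      using that(3) full_mem_iff[OF free_nonunital_closed(5)[OF that(1,1)]]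
        lpa_ops(2)[OF wf_digraph that(1,1)] unfolding L_def by simp
    then show ?thesis using F.eqv_mem_iff[OF that(2)] full_mem_iff[OF that(1)] by blast
  qed
  have "lpa_vertex E w0 \<in> carrier L"
    unfolding L_def lpa_carrier lpa_vertex_def using F.vtx_mem_free_nonunital[OF w0(1)] by blast
  then have proper: "?Q \<noteq> carrier L"
    using D.vertex_in_graph_ideal_iff[OF w0(1)] w0(2) by blast
  have "J1 \<subseteq> ?Q \<or> J2 \<subseteq> ?Q"
    if J: "two_sided_ideal J1 L" "two_sided_ideal J2 L" "ideal_prod L J1 J2 \<subseteq> ?Q" for J1 J2
  proof (rule ccontr)
    assume "\<not> ?thesis"
    then have n: "\<not> J1 \<subseteq> ?Q" "\<not> J2 \<subseteq> ?Q" by blast+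
    obtain T1 T2 where T: "two_sided_ideal T1 L" "two_sided_ideal T2 L" "?Q \<subset> T1" "?Q \<subset> T2"
      "\<And>x y. x \<in> T1 \<Longrightarrow> y \<in> T2 \<Longrightarrow> x \<otimes>\<^bsub>L\<^esub> y \<in> ?Q"
      using L.ideal_prod_colon_ideals[OF Q J n] by blast
    have marker: "(\<exists>v. v \<in> verts E \<and> v \<notin> H \<and> lpa_vertex E v \<in> T) \<or> (\<exists>v. v \<in> B_of E H - S \<and> lpa_gap_vertex E H v \<in> T)"
      if T: "two_sided_ideal T L" "?Q \<subset> T" for T
      by (rule larger_ideal_marker[OF Q T]; unfold verts gaps; blast)
    from common[OF T(1,2) marker[OF T(1,3)] marker[OF T(2,4)]] show False
    proof (elim disjE exE conjE)
      fix v assume v: "v \<in> verts E" "v \<notin> H" "lpa_vertex E v \<in> T1 \<inter> T2"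
      then have "lpa_vertex E v \<otimes>\<^bsub>L\<^esub> lpa_vertex E v \<in> ?Q" using T(5) by blast
      then have "lpa_vertex E v \<in> ?Q"
        unfolding lpa_vertex_def by (rule idem[OF F.vtx_mem_free_nonunital[OF v(1)] F.vtx_vtx[OF v(1)]])
      then show False using D.vertex_in_graph_ideal_iff[OF v(1)] v(2) by blast
    next
      fix v assume v: "v \<in> B_of E H - S" "lpa_gap_vertex E H v \<in> T1 \<inter> T2"
      then have vB: "v \<in> B_of E H" "v \<notin> S" "v \<in> verts E" "finite (arcs_avoiding E H v)"
        by (auto simp: B_of_def)
      have "lpa_gap_vertex E H v \<otimes>\<^bsub>L\<^esub> lpa_gap_vertex E H v \<in> ?Q" using v(2) T(5) by blast
      then have "lpa_gap_vertex E H v \<in> ?Q"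
        unfolding lpa_gap_vertex_conv by (rule idem[OF gap_mem_free_nonunital[OF wf_digraph vB(3)] F.gap_gap[OF vB(3,4)]])
      then show False using D.gap_vertex_in_graph_ideal_iff[OF vB(1)] vB(2) by blast
    qed
  qed
  then show ?thesis using Q proper by (simp add: prime_ideals_def)
qed

lemma Omega_hereditary: "e \<in> arcs E \<Longrightarrow> tail E e \<in> Omega E X \<Longrightarrow> X \<subseteq> verts E \<Longrightarrow> head E e \<in> Omega E X"
proof -
  assume e: "e \<in> arcs E" "tail E e \<in> Omega E X" "X \<subseteq> verts E"
  have "\<not> path_ge E (head E e) v" if "v \<in> X" for v
    using e(2) path_ge_trans[OF path_ge_arc[OF e(1)]] that by (auto simp: Omega_def)
  moreover have "head E e \<notin> X" using calculation path_ge_refl[of "head E e"] e(1) by auto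
  ultimately show ?thesis using e(1) by (simp add: Omega_def)
qed

lemma maximal_tail_Omega:
  assumes "M \<in> maximal_tails E"
  shows "Omega E M = verts E - M"
  using assms unfolding maximal_tails_def Omega_def by blast

lemma lpa_vertex_path_ge:
  assumes "two_sided_ideal I L" "lpa_vertex E v \<in> I" "path_ge E v w"
  shows "lpa_vertex E w \<in> I"
  using ideal_verts_path_ge[OF assms(1) _ assms(3)] path_ge_verts[OF assms(3)] assms(2)
  by (simp add: ideal_verts_def)

text \<open>With all gap vertices in the ideal, only vertices of \<open>M\<close> can be new. Two of
  them have a common successor in \<open>M\<close> by directedness, and it lies in both
  ideals.\<close>

lemma maximal_tail_prime:
  assumes M: "M \<in> maximal_tails E"
  shows "graph_ideal E (Omega E M) (B_of E (Omega E M)) \<in> prime_ideals L"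
proof -
  have ne: "M \<noteq> {}" and Mv: "M \<subseteq> verts E"
    and reg: "\<And>v. v \<in> M \<Longrightarrow> regular_vertex E v \<Longrightarrow> \<exists>e \<in> out_arcs E v. head E e \<in> M"
    and dir: "\<And>v w. v \<in> M \<Longrightarrow> w \<in> M \<Longrightarrow> \<exists>y \<in> M. path_ge E v y \<and> path_ge E w y"
    using M unfolding maximal_tails_def by blast+
  note Om = maximal_tail_Omega[OF M]
  obtain w0 where w0: "w0 \<in> M" using ne by blast
  show ?thesis
  proof (rule special_prime_criterion)
    show "graph_with_ideal_data E (Omega E M) (B_of E (Omega E M))"
    proof unfold_locales
      show "v \<in> Omega E M"
        if "v \<in> verts E" "regular_vertex E v" "\<And>e. e \<in> out_arcs E v \<Longrightarrow> head E e \<in> Omega E M" for v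
        using that reg unfolding Om by blast
      show "head E e \<in> Omega E M" if "e \<in> arcs E" "tail E e \<in> Omega E M" for e
        using Omega_hereditary[OF that Mv] .
    qed (use countable_graph in \<open>auto simp: Om\<close>)
    show "w0 \<in> verts E" "w0 \<notin> Omega E M" using w0 Mv by (auto simp: Om)
    fix T1 T2
    assume T: "two_sided_ideal T1 L" "two_sided_ideal T2 L"
      and 1: "(\<exists>v. v \<in> verts E \<and> v \<notin> Omega E M \<and> lpa_vertex E v \<in> T1) \<or>
        (\<exists>v. v \<in> B_of E (Omega E M) - B_of E (Omega E M) \<and> lpa_gap_vertex E (Omega E M) v \<in> T1)"
      and 2: "(\<exists>v. v \<in> verts E \<and> v \<notin> Omega E M \<and> lpa_vertex E v \<in> T2) \<or>
        (\<exists>v. v \<in> B_of E (Omega E M) - B_of E (Omega E M) \<and> lpa_gap_vertex E (Omega E M) v \<in> T2)"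
    obtain v w where vw: "v \<in> M" "w \<in> M" "lpa_vertex E v \<in> T1" "lpa_vertex E w \<in> T2"
      using 1 2 unfolding Om by blast
    obtain y where y: "y \<in> M" "path_ge E v y" "path_ge E w y" using dir[OF vw(1,2)] by blast
    have "lpa_vertex E y \<in> T1 \<inter> T2"
      using lpa_vertex_path_ge[OF T(1) vw(3) y(2)] lpa_vertex_path_ge[OF T(2) vw(4) y(3)] by blast
    then show "(\<exists>v. v \<in> verts E \<and> v \<notin> Omega E M \<and> lpa_vertex E v \<in> T1 \<inter> T2) \<or>
        (\<exists>v. v \<in> B_of E (Omega E M) - B_of E (Omega E M) \<and> lpa_gap_vertex E (Omega E M) v \<in> T1 \<inter> T2)"
      using y(1) Mv unfolding Om by blast
  qed
qed

text \<open>The common element is always the gap vertex at \<open>v0\<close>: every vertex outside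
  \<open>Omega E {v0}\<close> reaches \<open>v0\<close>, so an ideal that contains it contains
  \<open>v0\<close> and with it this gap vertex.\<close>

lemma breaking_vertex_prime:
  assumes v0: "v0 \<in> breaking_vertices E"
  shows "graph_ideal E (Omega E {v0}) (B_of E (Omega E {v0}) - {v0}) \<in> prime_ideals L"
proof -
  let ?H = "Omega E {v0}"
  have v0v: "v0 \<in> verts E" and inf: "infinite_emitter E v0" using v0 by (simp_all add: breaking_vertices_def)
  have v0H: "v0 \<notin> ?H" by (simp add: Omega_def)
  have v0B: "v0 \<in> B_of E ?H" using v0 v0H by (simp add: breaking_vertices_def B_of_def)
  show ?thesis
  proof (rule special_prime_criterion[OF _ v0v v0H])
    show "graph_with_ideal_data E ?H (B_of E ?H - {v0})"
    proof unfold_locales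
      show "head E e \<in> ?H" if "e \<in> arcs E" "tail E e \<in> ?H" for e
        using Omega_hereditary[OF that] v0v by blast
      show "v \<in> ?H"
        if v: "v \<in> verts E" "regular_vertex E v" and out: "\<And>e. e \<in> out_arcs E v \<Longrightarrow> head E e \<in> ?H" for v
      proof -
        \<comment> \<open>A regular vertex differs from the infinite emitter \<open>v0\<close>, so a
          path from it to \<open>v0\<close> has a first edge, whose range also reaches
          \<open>v0\<close>. This gives saturation.\<close>
        have ne: "v \<noteq> v0" using v(2) inf by (auto simp: regular_vertex_def infinite_emitter_def)
        have "\<not> path_ge E v v0"
        proof
          assume "path_ge E v v0"
          then obtain p where p: "awalk v p v0" unfolding path_ge_def by blast
          then obtain e q where eq: "p = e # q" using ne by (cases p) (simp_all add: awalk_Nil_iff)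
          have e: "e \<in> out_arcs E v" "awalk (head E e) q v0"
            using p unfolding eq by (simp_all add: awalk_Cons_iff)
          show False using out[OF e(1)] path_geI[OF e(2)] by (simp add: Omega_def)
        qed
        then show ?thesis using v(1) ne by (simp add: Omega_def)
      qed
    qed (use countable_graph in \<open>auto simp: Omega_def\<close>)
    fix T1 T2
    assume T: "two_sided_ideal T1 L" "two_sided_ideal T2 L"
      and 1: "(\<exists>v. v \<in> verts E \<and> v \<notin> ?H \<and> lpa_vertex E v \<in> T1) \<or>
        (\<exists>v. v \<in> B_of E ?H - (B_of E ?H - {v0}) \<and> lpa_gap_vertex E ?H v \<in> T1)"
      and 2: "(\<exists>v. v \<in> verts E \<and> v \<notin> ?H \<and> lpa_vertex E v \<in> T2) \<or>
        (\<exists>v. v \<in> B_of E ?H - (B_of E ?H - {v0}) \<and> lpa_gap_vertex E ?H v \<in> T2)"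
    have gap_mem: "lpa_gap_vertex E ?H v0 \<in> T"
      if T: "two_sided_ideal T L"
        and 1: "(\<exists>v. v \<in> verts E \<and> v \<notin> ?H \<and> lpa_vertex E v \<in> T) \<or>
          (\<exists>v. v \<in> B_of E ?H - (B_of E ?H - {v0}) \<and> lpa_gap_vertex E ?H v \<in> T)" for T
      using 1
    proof (elim disjE exE conjE)
      fix v assume v: "v \<in> verts E" "v \<notin> ?H" "lpa_vertex E v \<in> T"
      then have "path_ge E v v0" using path_ge_refl[OF v0v] by (auto simp: Omega_def)
      then have "lpa_vertex E v0 \<in> T" by (rule lpa_vertex_path_ge[OF T v(3)])
      then have v0T: "vtx v0 \<in> full E T" using full_vtx_iff[OF v0v] by blast
      interpret F: lpa_ideal E "full E T" by (rule full_ideal[OF T])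
      have "gap E ?H v0 \<in> full E T" using F.eqv_mem_iff[OF F.vtx_gap[OF v0v]] F.rmul_mem[OF v0T] by blast
      then show ?thesis using full_gap_iff[OF wf_digraph v0v] by blast
    next
      fix v assume "v \<in> B_of E ?H - (B_of E ?H - {v0})" "lpa_gap_vertex E ?H v \<in> T"
      then show ?thesis by auto
    qed
    show "(\<exists>v. v \<in> verts E \<and> v \<notin> ?H \<and> lpa_vertex E v \<in> T1 \<inter> T2) \<or>
        (\<exists>v. v \<in> B_of E ?H - (B_of E ?H - {v0}) \<and> lpa_gap_vertex E ?H v \<in> T1 \<inter> T2)"
      using gap_mem[OF T(1) 1] gap_mem[OF T(2) 2] v0B by blast
  qed
qed

lemma prime_ideals_eq_special: "prime_ideals L = special_ideals"
  using prime_imp_special maximal_tail_prime breaking_vertex_prime unfolding special_ideals_def by blast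

lemma primitive_ideals_eq_prime:
  "left_primitive_ideals L = prime_ideals L" "right_primitive_ideals L = prime_ideals L"
proof -
  have "I \<in> prime_ideals L" if "two_sided_ideal I L" "left_primitive (L Quot I) \<or> right_primitive (L Quot I)" for I
  proof -
    interpret ring_mod_ideal L I
      by (intro ring_mod_ideal.intro ring_mod_ideal_axioms.intro L.nonunital_ring_axioms that(1))
    show ?thesis using that(2) left_primitive_imp_prime right_primitive_imp_prime by blast
  qed
  moreover have "two_sided_ideal I L" if "I \<in> prime_ideals L" for I
    using that by (simp add: prime_ideals_def)
  ultimately show "left_primitive_ideals L = prime_ideals L" "right_primitive_ideals L = prime_ideals L"
    using prime_imp_primitive unfolding left_primitive_ideals_def right_primitive_ideals_def by blast+
qed

end

theorem corollary6p10:
  fixes E :: "('v, 'e) pre_digraph"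
  assumes "wf_digraph E" and "countable (verts E)" and "countable (arcs E)"
    and "condition_K E"
  shows "let L = (leavitt_path_algebra E :: ('v, 'e, 'k::field) lpa);
             P = {graph_ideal E (Omega E M) (B_of E (Omega E M)) | M. M \<in> maximal_tails E} \<union>
                 {graph_ideal E (Omega E {v}) (B_of E (Omega E {v}) - {v}) | v. v \<in> breaking_vertices E}
         in left_primitive_ideals L = P \<and> right_primitive_ideals L = P \<and>
            prime_ideals L = left_primitive_ideals L \<and> prime_ideals L = right_primitive_ideals L"
proof -
  interpret lpa_graph E "leavitt_path_algebra E :: ('v, 'e, 'k) lpa"
    by (intro lpa_graph.intro lpa_graph_axioms.intro assms refl)
  show ?thesis
    unfolding Let_def primitive_ideals_eq_prime prime_ideals_eq_special special_ideals_def by blast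
qed

end
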